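(* Let $(\mathcal{X},d)$, with $\mathcal{X}=\bigcup_{i=1}^m\mathcal{X}_i$ and fairness parameters $k_1,\dots,k_m$, be an instance of Fair Max-Min diversification with optimal diversity $\ell^*$, and let $\gamma>0$ satisfy $\gamma\le \ell^*$. There is a randomized polynomial-time algorithm that, given the instance and $\gamma$, returns a set $\mathcal{S}\subseteq\mathcal{X}$ such that for all groups $i\in[m]$, $$\mathbb{E}\big[|\mathcal{S}\cap\mathcal{X}_i|\big]\ge k_i ,$$ and (with certainty) all points of $\mathcal{S}$ are at pairwise distance at least $\gamma/2$.
   Context: Fair Max-Min diversification: the input is a finite metric space $(\mathcal{X},d)$ with $|\mathcal{X}|=n$, where $\mathcal{X}=\bigcup_{i=1}^m\mathcal{X}_i$ is partitioned into $m$ disjoint groups, and non-negative integers $k_1,\dots,k_m$ with $k_i\le|\mathcal{X}_i|$. For $\mathcal{S}\subseteq\mathcal{X}$ let $\mathrm{div}(\mathcal{S})=\min_{u,v\in\mathcal{S},u\ne v}d(u,v)$ (the minimum over the empty set is $+\infty$). The optimal diversity is $\ell^*=\max\{\mathrm{div}(\mathcal{S}):\mathcal{S}\subseteq\mathcal{X},\ |\mathcal{S}\cap\mathcal{X}_i|=k_i\ \forall i\in[m]\}$. The number $\gamma$ is a guess of the optimal diversity. *)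

theory Defs
  imports "HOL-Probability.Probability" "HOL-Computational_Algebra.Polynomial"
begin

section \<open>Fair Max-Min diversification\<close>

locale fair_diversification = Metric_space X d
  for X :: "'a set" and d :: "'a \<Rightarrow> 'a \<Rightarrow> real" +
  fixes m :: nat and G :: "nat \<Rightarrow> 'a set" and k :: "nat \<Rightarrow> nat"
  assumes finite_points: "finite X"
    and groups_cover: "(\<Union>i<m. G i) = X"
    and groups_disjoint: "disjoint_family_on G {..<m}"
    and demand_le: "\<And>i. i < m \<Longrightarrow> k i \<le> card (G i)"

text \<open>
  The infimum of the empty set is \<open>\<infinity>\<close> in \<^typ>\<open>ereal\<close>; on a finite \<open>S\<close> with at least two
  points the infimum is a minimum.
\<close>

definition diversity :: "('a \<Rightarrow> 'a \<Rightarrow> real) \<Rightarrow> 'a set \<Rightarrow> ereal" where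
  "diversity d S = Inf {ereal (d u v) | u v. u \<in> S \<and> v \<in> S \<and> u \<noteq> v}"

definition fair_sets :: "'a set \<Rightarrow> nat \<Rightarrow> (nat \<Rightarrow> 'a set) \<Rightarrow> (nat \<Rightarrow> nat) \<Rightarrow> 'a set set" where
  "fair_sets X m G k = {S. S \<subseteq> X \<and> (\<forall>i<m. card (S \<inter> G i) = k i)}"

definition optimal_diversity ::
  "'a set \<Rightarrow> ('a \<Rightarrow> 'a \<Rightarrow> real) \<Rightarrow> nat \<Rightarrow> (nat \<Rightarrow> 'a set) \<Rightarrow> (nat \<Rightarrow> nat) \<Rightarrow> ereal" where
  "optimal_diversity X d m G k = Max (diversity d ` fair_sets X m G k)"

text \<open>The maximum is taken over a finite nonempty family.\<close>

lemma (in fair_diversification) finite_fair_sets: "finite (fair_sets X m G k)"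
  unfolding fair_sets_def using finite_points by simp

lemma (in fair_diversification) fair_sets_nonempty: "fair_sets X m G k \<noteq> {}"
proof -
  have "\<exists>T. T \<subseteq> G i \<and> card T = k i" if "i < m" for i
    using obtain_subset_with_card_n[OF demand_le[OF that]] by metis
  then obtain T where T: "\<And>i. i < m \<Longrightarrow> T i \<subseteq> G i \<and> card (T i) = k i"
    by metis
  have "(\<Union>j<m. T j) \<inter> G i = T i" if "i < m" for i
  proof -
    have "T j \<inter> G i = {}" if "j < m" "j \<noteq> i" for j
      using T[OF that(1)] groups_disjoint that \<open>i < m\<close>
      unfolding disjoint_family_on_def by blast
    moreover have "T i \<inter> G i = T i"
      using T[OF that] by blast
    ultimately show ?thesis
      using that by blast
  qed
  moreover have "(\<Union>j<m. T j) \<subseteq> X"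
    using T groups_cover by blast
  ultimately have "(\<Union>j<m. T j) \<in> fair_sets X m G k"
    using T by (auto simp: fair_sets_def)
  then show ?thesis by blast
qed

section \<open>Randomized real RAM programs\<close>

text \<open>
  Algorithms are programs of a real RAM. The memory consists of natural-number cells and
  real cells, both addressed by an array name (fixed in the program text) and two computed
  indices. Every step of the small-step semantics has cost 1; as expressions are part of the
  fixed program text, evaluating one counts as a constant number of machine operations.

  The following restrictions keep the unit-cost measure meaningful:
  \<^item> natural numbers are only added, subtracted (truncated) and compared, so that
    \<open>t\<close> steps produce numbers of \<open>O(t)\<close> additional bits;
  \<^item> real cells admit field arithmetic and comparison, but nothing (such as a floor function)
    converts reals to naturals other than by branching on a comparison;
  \<^item> program texts contain no real constants, only natural numbers, which may be cast to reals.

  Randomness comes from independent coin flips with a computed bias.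
\<close>

datatype nexp =
    NConst nat
  | NCell nat nexp nexp
  | NPlus nexp nexp
  | NMinus nexp nexp

datatype rexp =
    RNat nexp
  | RCell nat nexp nexp
  | RPlus rexp rexp
  | RMinus rexp rexp
  | RTimes rexp rexp
  | RDiv rexp rexp

datatype bexp =
    NLess nexp nexp
  | RLess rexp rexp
  | BNot bexp
  | BAnd bexp bexp

datatype program =
    Skip
  | SetNat nat nexp nexp nexp
  | SetReal nat nexp nexp rexp
  | Flip nat nexp nexp rexp
  | Seq program program
  | Cond bexp program program
  | While bexp program

record memory =
  nat_cells :: "nat \<Rightarrow> nat \<Rightarrow> nat \<Rightarrow> nat"
  real_cells :: "nat \<Rightarrow> nat \<Rightarrow> nat \<Rightarrow> real"

primrec nval :: "nexp \<Rightarrow> memory \<Rightarrow> nat" where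
  "nval (NConst c) s = c"
| "nval (NCell a i j) s = nat_cells s a (nval i s) (nval j s)"
| "nval (NPlus e f) s = nval e s + nval f s"
| "nval (NMinus e f) s = nval e s - nval f s"

primrec rval :: "rexp \<Rightarrow> memory \<Rightarrow> real" where
  "rval (RNat e) s = real (nval e s)"
| "rval (RCell a i j) s = real_cells s a (nval i s) (nval j s)"
| "rval (RPlus e f) s = rval e s + rval f s"
| "rval (RMinus e f) s = rval e s - rval f s"
| "rval (RTimes e f) s = rval e s * rval f s"
| "rval (RDiv e f) s = rval e s / rval f s"

primrec bval :: "bexp \<Rightarrow> memory \<Rightarrow> bool" where
  "bval (NLess e f) s \<longleftrightarrow> nval e s < nval f s"
| "bval (RLess e f) s \<longleftrightarrow> rval e s < rval f s"
| "bval (BNot b) s \<longleftrightarrow> \<not> bval b s"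
| "bval (BAnd b c) s \<longleftrightarrow> bval b s \<and> bval c s"

definition upd_cell :: "(nat \<Rightarrow> nat \<Rightarrow> nat \<Rightarrow> 'v) \<Rightarrow> nat \<Rightarrow> nat \<Rightarrow> nat \<Rightarrow> 'v \<Rightarrow> nat \<Rightarrow> nat \<Rightarrow> nat \<Rightarrow> 'v" where
  "upd_cell h a i j x = h(a := (h a)(i := (h a i)(j := x)))"

definition set_nat :: "nat \<Rightarrow> nexp \<Rightarrow> nexp \<Rightarrow> nat \<Rightarrow> memory \<Rightarrow> memory" where
  "set_nat a i j x s = s\<lparr>nat_cells := upd_cell (nat_cells s) a (nval i s) (nval j s) x\<rparr>"

definition set_real :: "nat \<Rightarrow> nexp \<Rightarrow> nexp \<Rightarrow> real \<Rightarrow> memory \<Rightarrow> memory" where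
  "set_real a i j x s = s\<lparr>real_cells := upd_cell (real_cells s) a (nval i s) (nval j s) x\<rparr>"

text \<open>
  One step from a program and a memory to the remaining program and the new memory; \<^const>\<open>Skip\<close>
  is the halted program. A bias outside the unit interval is clamped by \<^const>\<open>bernoulli_pmf\<close>.
\<close>

primrec step :: "program \<Rightarrow> memory \<Rightarrow> (program \<times> memory) pmf" where
  "step Skip s = return_pmf (Skip, s)"
| "step (SetNat a i j e) s = return_pmf (Skip, set_nat a i j (nval e s) s)"
| "step (SetReal a i j e) s = return_pmf (Skip, set_real a i j (rval e s) s)"
| "step (Flip a i j e) s =
     map_pmf (\<lambda>b. (Skip, set_nat a i j (if b then 1 else 0) s)) (bernoulli_pmf (rval e s))"
| "step (Seq c c') s =
     (if c = Skip then return_pmf (c', s)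
      else map_pmf (\<lambda>(c'', s'). (Seq c'' c', s')) (step c s))"
| "step (Cond b c c') s = return_pmf (if bval b s then c else c', s)"
| "step (While b c) s = return_pmf (if bval b s then Seq c (While b c) else Skip, s)"

primrec run :: "nat \<Rightarrow> program \<Rightarrow> memory \<Rightarrow> (program \<times> memory) pmf" where
  "run 0 c s = return_pmf (c, s)"
| "run (Suc t) c s = bind_pmf (step c s) (\<lambda>(c', s'). run t c' s')"

definition halts_within :: "nat \<Rightarrow> program \<Rightarrow> memory \<Rightarrow> bool" where
  "halts_within t c s \<longleftrightarrow> (\<forall>(c', s') \<in> set_pmf (run t c s). c' = Skip)"

text \<open>Once all executions have halted, the distribution of the final memory is stable.\<close>

lemma run_add: "run (t + t') c s = bind_pmf (run t c s) (\<lambda>(c', s'). run t' c' s')"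
proof (induction t arbitrary: c s)
  case 0
  then show ?case by (simp add: bind_return_pmf)
next
  case (Suc t)
  then show ?case by (simp add: bind_assoc_pmf case_prod_unfold)
qed

lemma run_Skip: "run t Skip s = return_pmf (Skip, s)"
  by (induction t) (auto simp: bind_return_pmf)

lemma run_stable:
  assumes "halts_within t c s"
  shows "run (t + t') c s = run t c s"
proof -
  have "run (t + t') c s = bind_pmf (run t c s) return_pmf"
    unfolding run_add
    by (rule bind_pmf_cong[OF refl]) (use assms in \<open>auto simp: halts_within_def run_Skip\<close>)
  then show ?thesis by (simp add: bind_return_pmf')
qed

section \<open>Input and output\<close>

text \<open>
  The points are numbered by a list \<open>xs\<close>. Natural-number array 0 holds the number of points and
  the number of groups, array 1 the membership matrix of the groups, array 2 the demands; real
  array 0 holds the distance matrix and real array 1 the guess \<open>\<gamma>\<close>. All other cells are 0.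
\<close>

definition encode_instance ::
  "'a list \<Rightarrow> ('a \<Rightarrow> 'a \<Rightarrow> real) \<Rightarrow> nat \<Rightarrow> (nat \<Rightarrow> 'a set) \<Rightarrow> (nat \<Rightarrow> nat) \<Rightarrow> real \<Rightarrow> memory" where
  "encode_instance xs d m G k \<gamma> = \<lparr>
     nat_cells = (\<lambda>a p q.
       if a = 0 \<and> p = 0 \<and> q = 0 then length xs
       else if a = 0 \<and> p = 0 \<and> q = 1 then m
       else if a = 1 \<and> p < length xs \<and> q < m \<and> xs ! p \<in> G q then 1
       else if a = 2 \<and> p < m \<and> q = 0 then k p
       else 0),
     real_cells = (\<lambda>a p q.
       if a = 0 \<and> p < length xs \<and> q < length xs then d (xs ! p) (xs ! q)
       else if a = 1 \<and> p = 0 \<and> q = 0 then \<gamma>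
       else 0)\<rparr>"

text \<open>The returned set consists of the points whose entry in natural-number array 3 is nonzero.\<close>

definition decode_set :: "'a list \<Rightarrow> memory \<Rightarrow> 'a set" where
  "decode_set xs s = {xs ! p | p. p < length xs \<and> nat_cells s 3 p 0 \<noteq> 0}"

definition output_distribution ::
  "'a list \<Rightarrow> nat \<Rightarrow> program \<Rightarrow> memory \<Rightarrow> 'a set pmf" where
  "output_distribution xs t c s = map_pmf (\<lambda>(c', s'). decode_set xs s') (run t c s)"

end

theory Submission
  imports Defs "Jordan_Normal_Form.Determinant"
begin

text \<open>
  Let \<open>B(p)\<close> be the open ball of radius \<open>\<gamma> / 2\<close>. An optimal set has at most one point in every ball,
  so the linear program \<open>x \<ge> 0\<close>, \<open>x(B(p)) \<le> 1\<close>, \<open>x(G i) \<ge> k i\<close> is feasible. Given an exact solution,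
  repeatedly draw a point \<open>q\<close> with probability proportional to its weight, select it, and set the
  weights on \<open>B(q)\<close> to zero. By the ball constraints the number of selected points of a group plus its
  remaining weight is a submartingale.

  An exact solution is found in two phases. The simplex-shrinking method of Yamnitsky and Levin, a
  variant of the ellipsoid method without square roots, finds a point that violates every constraint by
  at most \<open>\<epsilon>\<close>, with \<open>\<epsilon>\<close> exponentially small. This point is moved to a vertex of the relaxed
  polyhedron; as the constraint matrix has entries in \<open>{-1, 0, 1}\<close>, the basic solution of the original
  system with the same basis is then feasible by Cramer's rule. Gaussian elimination tracks both
  points at once, through their slacks only.
\<close>

section \<open>Determinants of functions\<close>

text \<open>The bound \<open>k i\<close> on the expectation leaves no room for error, so an
  approximate solution would not do, and the running time has to be polynomial in
  \<open>card X + m\<close> whatever the distances and demands are. This works because distances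
  enter only through comparisons with \<open>\<gamma> / 2\<close>, and demands only as constant
  terms, which have to be integral but may be large: neither \<epsilon> nor the number of rounds
  depends on them. The indicator of an optimal set, although unknown, lies in the unit cube, so a
  simplex that is fixed in advance encloses it. The tolerance \<epsilon> has two conflicting tasks:
  it must leave the relaxed system a simplex of points large enough to stop the shrinking after
  polynomially many rounds, and it must be small enough for Cramer's rule to repair the vertex. An
  inverse exponential value does both, since the number of rounds grows only with log(1 /
  \<epsilon>). Coordinates need not be stored, because nonnegativity is among the constraints and
  its slacks are the negated coordinates.\<close>

abbreviation fdet :: "nat \<Rightarrow> (nat \<Rightarrow> nat \<Rightarrow> real) \<Rightarrow> real" where
  "fdet n f \<equiv> Determinant.det (Matrix.mat n n (\<lambda>(i, j). f i j))"

lemma fdet_mult: "fdet n (\<lambda>i j. \<Sum>l<n. f i l * g l j) = fdet n f * fdet n g"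
proof -
  have "Matrix.mat n n (\<lambda>(i, j). \<Sum>l<n. f i l * g l j) =
      Matrix.mat n n (\<lambda>(i, j). f i j) * Matrix.mat n n (\<lambda>(i, j). g i j)"
    by (intro eq_matI) (auto simp: scalar_prod_def atLeast0LessThan)
  then show ?thesis
    by (simp add: det_mult[of _ n])
qed

lemma fdet_leibniz:
  "fdet n f = (\<Sum>p | p permutes {0..<n}. signof p * (\<Prod>i=0..<n. f i (p i)))"
proof -
  have "(\<Prod>i=0..<n. Matrix.mat n n (\<lambda>(i, j). f i j) $$ (i, p i)) = (\<Prod>i=0..<n. f i (p i))"
    if "p permutes {0..<n}" for p
    using permutes_in_image[OF that] by (intro prod.cong) auto
  then show ?thesis
    by (subst det_def'[of _ n]) (auto intro!: sum.cong)
qed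

lemma fdet_cong: "(\<And>i j. i < n \<Longrightarrow> j < n \<Longrightarrow> f i j = g i j) \<Longrightarrow> fdet n f = fdet n g"
  by (intro arg_cong[where f = Determinant.det] eq_matI) auto

lemma fdet_lower: "(\<And>i j. i < j \<Longrightarrow> j < n \<Longrightarrow> f i j = 0) \<Longrightarrow> fdet n f = (\<Prod>i<n. f i i)"
  by (subst det_lower_triangular[of n])
    (auto simp: diag_mat_def prod.list_conv_set_nth atLeast0LessThan)

lemma fdet_upper: "(\<And>i j. j < i \<Longrightarrow> i < n \<Longrightarrow> f i j = 0) \<Longrightarrow> fdet n f = (\<Prod>i<n. f i i)"
  by (subst det_upper_triangular[of _ n])
    (auto simp: diag_mat_def prod.list_conv_set_nth atLeast0LessThan upper_triangular_def)

text \<open>Without signs, the Leibniz sum over permutations is part of the sum over all maps, which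
  is the expanded product of the row sums. This crude bound serves stochastic matrices (at most 1)
  and matrices with entries of absolute value at most 1 (at most n^n).\<close>

lemma abs_fdet_le: "\<bar>fdet n f\<bar> \<le> (\<Prod>i<n. \<Sum>j<n. \<bar>f i j\<bar>)"
proof -
  have "\<bar>fdet n f\<bar> \<le> (\<Sum>p | p permutes {0..<n}. \<bar>signof p * (\<Prod>i=0..<n. f i (p i))\<bar>)"
    unfolding fdet_leibniz by (rule sum_abs)
  also have "\<dots> = (\<Sum>p | p permutes {0..<n}. \<Prod>i=0..<n. \<bar>f i (p i)\<bar>)"
    by (intro sum.cong) (auto simp: abs_mult abs_prod sign_def)
  \<comment> \<open>\<open>Pi\<^sub>E\<close> contains only functions that are undefined outside the
    index set, hence the restriction; it is injective because permutations are the identity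
    there.\<close>
  also have "\<dots> = (\<Sum>p \<in> (\<lambda>p. restrict p {0..<n}) ` {p. p permutes {0..<n}}. \<Prod>i=0..<n. \<bar>f i (p i)\<bar>)"
  proof (subst sum.reindex)
    show "inj_on (\<lambda>p. restrict p {0..<n}) {p. p permutes {0..<n}}"
    proof (rule inj_onI)
      fix p q assume *: "p \<in> {p. p permutes {0..<n}}" "q \<in> {p. p permutes {0..<n}}"
        "restrict p {0..<n} = restrict q {0..<n}"
      show "p = q"
      proof
        fix x
        show "p x = q x"
        proof (cases "x \<in> {0..<n}")
          case True
          then show ?thesis using fun_cong[OF *(3), of x] by simp
        next
          case False
          then show ?thesis using * by (simp add: permutes_def)
        qed
      qed
    qed
  qed (auto intro!: sum.cong prod.cong)
  also have "\<dots> \<le> (\<Sum>p \<in> Pi\<^sub>E {0..<n} (\<lambda>_. {0..<n}). \<Prod>i=0..<n. \<bar>f i (p i)\<bar>)"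
  proof (rule sum_mono2)
    show "(\<lambda>p. restrict p {0..<n}) ` {p. p permutes {0..<n}} \<subseteq> Pi\<^sub>E {0..<n} (\<lambda>_. {0..<n})"
    proof (intro image_subsetI)
      fix p assume "p \<in> {p. p permutes {0..<n}}"
      then have p: "p permutes {0..<n}" by simp
      then have "p i \<in> {0..<n}" if "i \<in> {0..<n}" for i
        using that by (simp only: permutes_in_image[OF p])
      then show "restrict p {0..<n} \<in> Pi\<^sub>E {0..<n} (\<lambda>_. {0..<n})"
        by (simp add: PiE_iff)
    qed
  qed (auto intro!: finite_PiE prod_nonneg)
  also have "\<dots> = (\<Prod>i=0..<n. \<Sum>j\<in>{0..<n}. \<bar>f i j\<bar>)"
    by (subst prod_sum_PiE) auto
  finally show ?thesis by (simp add: atLeast0LessThan)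
qed

lemma fdet_only_diagonal:
  assumes "\<And>p. p permutes {0..<n} \<Longrightarrow> p \<noteq> id \<Longrightarrow> \<exists>i<n. f i (p i) = 0"
  shows "fdet n f = (\<Prod>i<n. f i i)"
proof -
  have "fdet n f = (\<Sum>p\<in>{id}. signof p * (\<Prod>i=0..<n. f i (p i)))"
    unfolding fdet_leibniz
  proof (rule sum.mono_neutral_right)
    show "\<forall>p\<in>{p. p permutes {0..<n}} - {id}. signof p * (\<Prod>i=0..<n. f i (p i)) = 0"
    proof
      fix p assume "p \<in> {p. p permutes {0..<n}} - {id}"
      with assms[of p] obtain i where "i < n" "f i (p i) = 0" by auto
      then have "(\<Prod>i=0..<n. f i (p i)) = 0" by (auto intro!: prod_zero)
      then show "signof p * (\<Prod>i=0..<n. f i (p i)) = 0" by simp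
    qed
  qed (auto intro: finite_permutations permutes_id)
  then show ?thesis by (simp add: atLeast0LessThan)
qed

text \<open>Row \<open>k\<close> has only its diagonal entry, so a contributing permutation fixes
  \<open>k\<close>; any other row offers its diagonal entry and column \<open>k\<close>, which is
  taken.\<close>

lemma fdet_arrow:
  assumes k: "k < n" and "\<And>i j. i < n \<Longrightarrow> j < n \<Longrightarrow> j \<noteq> i \<Longrightarrow> j \<noteq> k \<Longrightarrow> f i j = 0"
    and "\<And>j. j < n \<Longrightarrow> j \<noteq> k \<Longrightarrow> f k j = 0"
  shows "fdet n f = (\<Prod>i<n. f i i)"
proof (rule fdet_only_diagonal)
  fix p assume p: "p permutes {0..<n}" and "p \<noteq> id"
  show "\<exists>i<n. f i (p i) = 0"
  proof (rule ccontr)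
    assume *: "\<not> ?thesis"
    have lt: "p i < n" if "i < n" for i using permutes_in_image[OF p, of i] that by auto
    have nz: "f i (p i) \<noteq> 0" if "i < n" for i using * that by blast
    have pk: "p k = k" using nz[OF k] assms(3)[OF lt[OF k]] by blast
    have "p i = i" if i: "i < n" for i
    proof (rule ccontr)
      assume ne: "p i \<noteq> i"
      then have "i \<noteq> k" using pk by blast
      then have "p i \<noteq> k" using pk injD[OF permutes_inj[OF p], of i k] by auto
      then show False using nz[OF i] assms(2)[OF i lt[OF i]] ne by blast
    qed
    moreover have "p i = i" if "\<not> i < n" for i using p that by (auto simp: permutes_def)
    ultimately have "p = id" by (intro ext) (metis id_apply)
    with \<open>p \<noteq> id\<close> show False ..
  qed
qed

section \<open>Shrinking a simplex around a polyhedron\<close>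

text \<open>Weierstrass' product inequality: the terms dropped from the expanded product are
  nonnegative.\<close>

lemma prod_one_plus_ge: 
  fixes y :: "'i \<Rightarrow> real"
  assumes "finite A" "\<And>i. i \<in> A \<Longrightarrow> 0 \<le> y i" "0 \<le> \<rho>"
  shows "1 + \<rho> * sum y A \<le> (\<Prod>i\<in>A. 1 + \<rho> * y i)"
  using assms(1,2)
proof (induction A)
  case (insert a A)
  have 0: "0 \<le> \<rho> * y a" "0 \<le> \<rho> * sum y A"
    using insert.prems assms(3) by (auto intro!: mult_nonneg_nonneg sum_nonneg)
  have "1 + \<rho> * sum y (insert a A) \<le> (1 + \<rho> * y a) * (1 + \<rho> * sum y A)"
    using insert.hyps mult_nonneg_nonneg[OF 0] by (simp add: algebra_simps)
  also have "\<dots> \<le> (1 + \<rho> * y a) * (\<Prod>i\<in>A. 1 + \<rho> * y i)"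
    using insert 0 by (intro mult_left_mono) auto
  finally show ?case using insert.hyps by simp
qed simp

text \<open>The product is smallest when one \<open>a i\<close> equals n and the others equal -1.
  Its value (1 - \<sigma>)^(n - 1) (1 + n \<sigma>) is at least 1 + \<sigma> - n (n - 1) \<sigma>^2
  by Bernoulli's inequality, and the choice of \<sigma> keeps the quadratic loss at most \<sigma> /
  2.\<close>

lemma shrink_factor:
  fixes a :: "'i \<Rightarrow> real"
  assumes fin: "finite A" and card: "card A = n" and low: "\<And>i. i \<in> A \<Longrightarrow> -1 \<le> a i" and sum: "sum a A = 1"
    and \<sigma>: "\<sigma> = 1 / (2 * (real n + 1)\<^sup>2)"
  shows "1 + \<sigma> / 2 \<le> (\<Prod>i\<in>A. 1 + \<sigma> * a i)"
proof -
  have n: "n > 0" using card fin sum by (cases n) auto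
  have s: "0 < \<sigma>" "\<sigma> \<le> 1/2" unfolding \<sigma> by (auto simp: field_simps)
  \<comment> \<open>Taking out 1 - \<sigma> turns 1 + \<sigma> a into (1 - \<sigma>) (1 + \<rho> (1
    + a)), so that the product inequality applies to the nonnegative numbers 1 + a, whose sum is n +
    1.\<close>
  define \<rho> where "\<rho> = \<sigma> / (1 - \<sigma>)"
  have \<rho>: "0 \<le> \<rho>" "(1 - \<sigma>) * \<rho> = \<sigma>" using s by (auto simp: \<rho>_def)
  have "(1 - \<sigma>) ^ n * (1 + \<rho> * sum (\<lambda>i. 1 + a i) A) \<le> (1 - \<sigma>) ^ n * (\<Prod>i\<in>A. 1 + \<rho> * (1 + a i))"
    using fin low \<rho>(1) s by (intro mult_left_mono prod_one_plus_ge) (force+)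
  also have "\<dots> = (\<Prod>i\<in>A. (1 - \<sigma>) * (1 + \<rho> * (1 + a i)))"
    by (simp add: prod.distrib card)
  also have "\<dots> = (\<Prod>i\<in>A. 1 + \<sigma> * a i)"
  proof (rule prod.cong)
    fix i
    have "(1 - \<sigma>) * (1 + \<rho> * (1 + a i)) = (1 - \<sigma>) + ((1 - \<sigma>) * \<rho>) * (1 + a i)"
      by (simp add: algebra_simps)
    also have "\<dots> = 1 + \<sigma> * a i"
      unfolding \<rho>(2) by (simp add: algebra_simps)
    finally show "(1 - \<sigma>) * (1 + \<rho> * (1 + a i)) = 1 + \<sigma> * a i" .
  qed simp
  finally have 1: "(1 - \<sigma>) ^ n * (1 + \<rho> * (real n + 1)) \<le> (\<Prod>i\<in>A. 1 + \<sigma> * a i)"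
    using sum card by (simp add: sum.distrib)
  obtain n' where n': "n = Suc n'" using n by (cases n) auto
  have "(1 - \<sigma>) ^ n * (1 + \<rho> * (real n + 1)) = (1 - \<sigma>) ^ n' * ((1 - \<sigma>) + (1 - \<sigma>) * \<rho> * (real n + 1))"
    unfolding n' by (simp add: algebra_simps)
  also have "\<dots> = (1 - \<sigma>) ^ n' * (1 + \<sigma> * n)"
    unfolding \<rho>(2) by (simp add: algebra_simps)
  also have "(1 - \<sigma>) ^ n' * (1 + \<sigma> * n) \<ge> (1 + real n' * (-\<sigma>)) * (1 + \<sigma> * n)"
    using Bernoulli_inequality[of "-\<sigma>" n'] s by (intro mult_right_mono) auto
  finally have 2: "(1 + real n' * (-\<sigma>)) * (1 + \<sigma> * n) \<le> (\<Prod>i\<in>A. 1 + \<sigma> * a i)" using 1 by linarith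
  have "real n' * real n \<le> (real n + 1)\<^sup>2" unfolding n' by (simp add: power2_eq_square algebra_simps)
  then have "\<sigma> * (real n' * real n) \<le> \<sigma> * (real n + 1)\<^sup>2" using s by (intro mult_left_mono) auto
  also have "\<dots> = 1/2" unfolding \<sigma> by simp
  finally have "\<sigma> * (\<sigma> * (real n' * real n)) \<le> \<sigma> * (1/2)" using s by (intro mult_left_mono) auto
  then have "1 + \<sigma> / 2 \<le> (1 + real n' * (-\<sigma>)) * (1 + \<sigma> * n)"
    unfolding n' by (simp add: algebra_simps)
  with 2 show ?thesis by linarith
qed


text \<open>
  The points with slack vectors \<open>T j\<close> lie in the simplex whose vertices have slack vectors \<open>Y i\<close>; the
  matrix of their barycentric coordinates is stochastic, and its determinant, which is at most 1,
  grows whenever the simplex shrinks.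
\<close>

definition covers :: "nat \<Rightarrow> nat \<Rightarrow> (nat \<Rightarrow> nat \<Rightarrow> real) \<Rightarrow> (nat \<Rightarrow> nat \<Rightarrow> real) \<Rightarrow> real \<Rightarrow> bool" where
  "covers L R T Y c \<longleftrightarrow> (\<exists>M. (\<forall>j<L. \<forall>i<L. 0 \<le> M j i) \<and> (\<forall>j<L. (\<Sum>i<L. M j i) = 1) \<and>
     (\<forall>j<L. \<forall>r<R. T j r = (\<Sum>i<L. M j i * Y i r)) \<and> c \<le> \<bar>fdet L M\<bar>)"

lemma covers_le_1: assumes "covers L R T Y c" shows "c \<le> 1"
proof -
  obtain M where M: "\<And>j i. j < L \<Longrightarrow> i < L \<Longrightarrow> 0 \<le> M j i" "\<And>j. j < L \<Longrightarrow> (\<Sum>i<L. M j i) = (1 :: real)"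
    "c \<le> \<bar>fdet L M\<bar>"
    using assms unfolding covers_def by blast
  have "(\<Prod>j<L. \<Sum>i<L. \<bar>M j i\<bar>) = (\<Prod>j<L. 1)"
    using M(1,2) by (intro prod.cong) auto
  then show ?thesis using M(3) abs_fdet_le[of L M] by simp
qed

lemma sum_remove_lt: "k < (L :: nat) \<Longrightarrow> (\<Sum>i<L. f i) = f k + (\<Sum>i\<in>{..<L} - {k}. f i :: real)"
  by (rule sum.remove) auto

text \<open>Let \<open>a i\<close> be the normalized excess of vertex \<open>i\<close> over the mean
  slack, with \<open>a k = -1\<close> at the lowest vertex. Dividing the edge from \<open>k\<close>
  to \<open>i\<close> by 1 + \<sigma> \<open>a i\<close> multiplies the barycentric coordinate of
  \<open>i\<close> by that number, and the coordinate of \<open>k\<close> absorbs the difference.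
  The latter stays nonnegative because the points \<open>T j\<close> satisfy the constraint that the
  centroid violates. The determinant is multiplied by the product bounded in
  \<open>shrink_factor\<close>: edges to vertices below the mean get longer, yet the volume
  falls.\<close>

lemma covers_shrink:
  assumes cov: "covers (Suc n) R T Y c" and c: "0 \<le> c"
    and v: "v < R" and Tv: "\<And>j. j < Suc n \<Longrightarrow> T j v \<le> 0" and pos: "0 < (\<Sum>i<Suc n. Y i v)"
    and k: "k < Suc n" and low: "\<And>i. i < Suc n \<Longrightarrow> Y k v \<le> Y i v"
    and \<mu>: "\<mu> = (\<Sum>i<Suc n. Y i v) / (real n + 1)"
    and \<sigma>: "\<sigma> = 1 / (2 * (real n + 1)\<^sup>2)"
    and Y': "\<And>i r. i < Suc n \<Longrightarrow> r < R \<Longrightarrow>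
      Y' i r = Y k r + 1 / (1 + \<sigma> * (Y i v - \<mu>) / (\<mu> - Y k v)) * (Y i r - Y k r)"
  shows "covers (Suc n) R T Y' ((1 + \<sigma> / 2) * c)"
proof -
  let ?L = "Suc n"
  let ?O = "{..<?L} - {k}"
  obtain M where M: "\<And>j i. j < ?L \<Longrightarrow> i < ?L \<Longrightarrow> 0 \<le> M j i" "\<And>j. j < ?L \<Longrightarrow> (\<Sum>i<?L. M j i) = 1"
    "\<And>j r. j < ?L \<Longrightarrow> r < R \<Longrightarrow> T j r = (\<Sum>i<?L. M j i * Y i r)" "c \<le> \<bar>fdet ?L M\<bar>"
    using cov unfolding covers_def by blast
  have \<mu>0: "0 < \<mu>" using pos unfolding \<mu> by simp
  \<comment> \<open>A convex combination of the vertex slacks equals \<open>T 0 v\<close>, which is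
    nonpositive; hence so is the lowest one. With \<mu> > 0 this makes the denominator \<mu> -
    \<open>Y k v\<close> positive.\<close>
  have "Y k v \<le> 0"
  proof -
    have "Y k v = (\<Sum>i<?L. M 0 i * Y k v)" using M(2)[of 0] by (simp add: sum_distrib_right[symmetric])
    also have "\<dots> \<le> (\<Sum>i<?L. M 0 i * Y i v)"
      using M(1) low by (intro sum_mono mult_left_mono) auto
    also have "\<dots> \<le> 0" using M(3)[OF _ v, of 0] Tv[of 0] by simp
    finally show ?thesis .
  qed
  define \<alpha> where "\<alpha> = \<mu> - Y k v"
  have \<alpha>: "\<alpha> > 0" using \<mu>0 \<open>Y k v \<le> 0\<close> by (simp add: \<alpha>_def)
  define a where "a i = (Y i v - \<mu>) / \<alpha>" for i
  have ak: "a k = -1" using \<alpha> by (simp add: a_def \<alpha>_def field_simps)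
  have a_ge: "-1 \<le> a i" if "i < ?L" for i
    using low[OF that] \<alpha> by (simp add: a_def \<alpha>_def field_simps)
  have "(\<Sum>i<?L. a i) = ((\<Sum>i<?L. Y i v) - (real n + 1) * \<mu>) / \<alpha>"
    unfolding a_def by (simp add: sum_divide_distrib[symmetric] sum_subtractf algebra_simps del: sum.lessThan_Suc)
  then have "(\<Sum>i<?L. a i) = 0" by (simp add: \<mu> del: sum.lessThan_Suc)
  then have asum: "(\<Sum>i\<in>?O. a i) = 1"
    using sum_remove_lt[OF k, of a] ak by simp
  have s: "0 < \<sigma>" "\<sigma> \<le> 1/2" unfolding \<sigma> by (auto simp: field_simps)
  have u0: "1 + \<sigma> * a i > 0" if "i < ?L" for i
    using mult_left_mono[OF a_ge[OF that], of \<sigma>] s by auto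
  \<comment> \<open>The passage from old to new barycentric coordinates is multiplication by
    \<open>P\<close>, a diagonal matrix with a full column \<open>k\<close>.\<close>
  define P where "P l i = (if i = k then (if l = k then 1 else - \<sigma> * a l)
    else if l = i then 1 + \<sigma> * a i else 0)" for l i
  define M' where "M' j i = (\<Sum>l<?L. M j l * P l i)" for j i
  have M'_other: "M' j i = (1 + \<sigma> * a i) * M j i" if "i < ?L" "i \<noteq> k" for j i
  proof -
    have "M' j i = (\<Sum>l<?L. if l = i then M j i * (1 + \<sigma> * a i) else 0)"
      unfolding M'_def P_def using that by (intro sum.cong) auto
    then show ?thesis using that by (simp del: sum.lessThan_Suc)
  qed
  have M'_k: "M' j k = M j k - \<sigma> * (\<Sum>i\<in>?O. a i * M j i)" for j
    unfolding M'_def sum_remove_lt[OF k] P_def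
    by (simp add: sum_distrib_left sum_negf[symmetric] mult_ac del: lessThan_Suc)
  have Y'_k: "Y' k r = Y k r" if "r < R" for r using Y'[OF k that] by simp
  have "0 \<le> M' j i" if j: "j < ?L" and i: "i < ?L" for j i
  proof (cases "i = k")
    case False
    then show ?thesis using M'_other[OF i] u0[OF i] M(1)[OF j i] by simp
  next
    case True
    \<comment> \<open>By affinity the barycentric mean of \<open>a\<close> at the point
      \<open>j\<close> is (\<open>T j v\<close> - \<mu>) / \<alpha>.\<close>
    have "(\<Sum>i<?L. a i * M j i) = ((\<Sum>i<?L. M j i * Y i v) - \<mu> * (\<Sum>i<?L. M j i)) / \<alpha>"
      unfolding a_def
      by (simp add: sum_divide_distrib sum_subtractf sum_distrib_left algebra_simps diff_divide_distrib del: sum.lessThan_Suc)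
    also have "\<dots> \<le> 0"
      using Tv[OF j] M(2,3)[OF j] v \<mu>0 \<alpha> by (simp add: divide_le_0_iff del: sum.lessThan_Suc)
    finally have "(\<Sum>i\<in>?O. a i * M j i) \<le> M j k"
      using sum_remove_lt[OF k, of "\<lambda>i. a i * M j i"] ak by simp
    then have "\<sigma> * (\<Sum>i\<in>?O. a i * M j i) \<le> \<sigma> * M j k" using s by (intro mult_left_mono) auto
    also have "\<dots> \<le> 1 * M j k" using s M(1)[OF j k] by (intro mult_right_mono) auto
    finally show ?thesis unfolding True M'_k by simp
  qed
  moreover have "(\<Sum>i<?L. M' j i) = 1" if j: "j < ?L" for j
  proof -
    have "(\<Sum>i<?L. M' j i) = M' j k + (\<Sum>i\<in>?O. (1 + \<sigma> * a i) * M j i)"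
      unfolding sum_remove_lt[OF k] using M'_other by (simp del: lessThan_Suc)
    also have "\<dots> = M j k + (\<Sum>i\<in>?O. M j i)"
      unfolding M'_k by (simp add: sum_distrib_left algebra_simps sum.distrib del: lessThan_Suc)
    also have "\<dots> = (\<Sum>i<?L. M j i)" by (rule sum_remove_lt[OF k, symmetric])
    finally show ?thesis using M(2)[OF j] by simp
  qed
  moreover have "T j r = (\<Sum>i<?L. M' j i * Y' i r)" if j: "j < ?L" and r: "r < R" for j r
  proof -
    have *: "M' j i * Y' i r = (1 + \<sigma> * a i) * M j i * Y k r + M j i * (Y i r - Y k r)" if "i \<in> ?O" for i
    proof -
      have i: "i < ?L" "i \<noteq> k" using that by auto
      have "Y' i r = Y k r + 1 / (1 + \<sigma> * a i) * (Y i r - Y k r)"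
        unfolding a_def \<alpha>_def using Y'[OF i(1) r] by simp
      then have "(1 + \<sigma> * a i) * Y' i r = (1 + \<sigma> * a i) * Y k r + (Y i r - Y k r)"
        using u0[OF i(1)] by (simp add: field_simps)
      then have "M j i * ((1 + \<sigma> * a i) * Y' i r) = M j i * ((1 + \<sigma> * a i) * Y k r + (Y i r - Y k r))"
        by simp
      then show ?thesis unfolding M'_other[OF i] by (simp only: algebra_simps)
    qed
    have "(\<Sum>i<?L. M' j i * Y' i r) = M' j k * Y k r +
        (\<Sum>i\<in>?O. (1 + \<sigma> * a i) * M j i * Y k r + M j i * (Y i r - Y k r))"
      unfolding sum_remove_lt[OF k] Y'_k[OF r] using * by (simp del: lessThan_Suc)
    also have "\<dots> = M j k * Y k r + (\<Sum>i\<in>?O. M j i * Y i r)"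
      unfolding M'_k by (simp add: sum_distrib_left sum_distrib_right algebra_simps sum.distrib
        sum_subtractf del: lessThan_Suc)
    also have "\<dots> = (\<Sum>i<?L. M j i * Y i r)" by (rule sum_remove_lt[OF k, symmetric])
    finally show ?thesis using M(3)[OF j r] by simp
  qed
  moreover have "(1 + \<sigma> / 2) * c \<le> \<bar>fdet ?L M'\<bar>"
  proof -
    have "fdet ?L P = (\<Prod>i<?L. P i i)"
      by (rule fdet_arrow[OF k]) (auto simp: P_def)
    also have "\<dots> = (\<Prod>i\<in>?O. 1 + \<sigma> * a i)"
      by (subst prod.remove[of _ k]) (use k in \<open>auto simp: P_def intro!: prod.cong\<close>)
    also have "\<dots> \<ge> 1 + \<sigma> / 2"
      using a_ge asum k by (intro shrink_factor[OF _ _ _ _ \<sigma>]) auto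
    finally have P: "1 + \<sigma> / 2 \<le> fdet ?L P" .
    have "fdet ?L M' = fdet ?L M * fdet ?L P" unfolding M'_def by (rule fdet_mult)
    moreover have "(1 + \<sigma> / 2) * c \<le> fdet ?L P * \<bar>fdet ?L M\<bar>"
      using P M(4) c s by (intro mult_mono) auto
    ultimately show ?thesis using P s by (simp add: abs_mult mult.commute)
  qed
  ultimately show ?thesis unfolding covers_def by blast
qed

text \<open>The enclosing simplex has the vertices 0 and (n + 1) times the unit vectors, the
  enclosed one the vertices \<open>x\<close> and \<open>x\<close> plus \<delta> times a unit vector;
  at \<open>j = n\<close> nothing is shifted. Coordinate sums are at most n + 1, so coordinates
  divided by n + 1 are barycentric and the vertex 0 takes the rest. The bound is the ratio of the
  two volumes.\<close>

lemma covers_start: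
  assumes \<delta>: "0 < \<delta>" "\<delta> \<le> 1" and x: "\<And>i. i < n \<Longrightarrow> 0 \<le> x i \<and> x i \<le> (1 :: real)"
    and T: "\<And>j r. j < Suc n \<Longrightarrow> r < R \<Longrightarrow>
       T j r = (\<Sum>i<n. (x i + (if i = j then \<delta> else 0)) * C i r) + e r"
    and Y: "\<And>i r. i < n \<Longrightarrow> r < R \<Longrightarrow> Y i r = (real n + 1) * C i r + e r"
    and Yn: "\<And>r. r < R \<Longrightarrow> Y n r = e r"
  shows "covers (Suc n) R T Y ((\<delta> / (real n + 1)) ^ n)"
proof -
  define \<rho> where "\<rho> = \<delta> / (real n + 1)"
  define q where "q j i = (x i + (if i = j then \<delta> else 0)) / (real n + 1)" for j i
  define M where "M j i = (if i < n then q j i else 1 - (\<Sum>l<n. q j l))" for j i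
  have q0: "0 \<le> q j i" if "i < n" for j i using x[OF that] \<delta> by (simp add: q_def)
  have "(\<Sum>l<n. q j l) \<le> 1" for j
  proof -
    have "(\<Sum>l<n. x l + (if l = j then \<delta> else 0)) = (\<Sum>l<n. x l) + (if j < n then \<delta> else 0)"
      by (simp add: sum.distrib)
    also have "(\<Sum>l<n. x l) \<le> (\<Sum>l<n. 1)" using x by (intro sum_mono) auto
    finally have "(\<Sum>l<n. x l + (if l = j then \<delta> else 0)) \<le> real n + 1" using \<delta> by (auto split: if_splits)
    then show ?thesis by (simp add: q_def sum_divide_distrib[symmetric])
  qed
  then have "0 \<le> M j i" for j i unfolding M_def using q0 by auto
  moreover have "(\<Sum>i<Suc n. M j i) = 1" for j by (simp add: M_def)
  moreover have "T j r = (\<Sum>i<Suc n. M j i * Y i r)" if j: "j < Suc n" and r: "r < R" for j r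
  proof -
    have "(\<Sum>i<Suc n. M j i * Y i r) = (\<Sum>i<n. q j i * ((real n + 1) * C i r + e r)) + (1 - (\<Sum>l<n. q j l)) * e r"
      using Y[OF _ r] Yn[OF r] by (simp add: M_def)
    also have "\<dots> = (\<Sum>i<n. q j i * ((real n + 1) * C i r)) + e r"
      by (simp add: algebra_simps sum.distrib sum_distrib_left)
    also have "(\<Sum>i<n. q j i * ((real n + 1) * C i r)) = (\<Sum>i<n. (x i + (if i = j then \<delta> else 0)) * C i r)"
      by (intro sum.cong) (auto simp: q_def)
    finally show ?thesis using T[OF j r] by simp
  qed
  moreover have "\<rho> ^ n \<le> \<bar>fdet (Suc n) M\<bar>"
  proof -
    \<comment> \<open>Multiplying by \<open>U\<close> from the right turns the last column of
      \<open>M\<close> into its row sums, which are 1; multiplying \<open>Lo\<close> by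
      \<open>U\<close> from the left adds its last row to all others. So \<open>M\<close> is similar
      to the triangular matrix \<open>Lo\<close>.\<close>
    define U where "U i j = (if i = j \<or> j = n then 1 else 0 :: real)" for i j
    define Lo where "Lo i j = (if i = n then if j = n then 1 else x j / (real n + 1) else if i = j then \<rho> else 0)" for i j
    have "fdet (Suc n) U = (\<Prod>i<Suc n. U i i)" by (rule fdet_upper) (auto simp: U_def)
    then have U: "fdet (Suc n) U = 1" by (simp add: U_def)
    have "fdet (Suc n) Lo = (\<Prod>i<Suc n. Lo i i)" by (rule fdet_lower) (auto simp: Lo_def)
    also have "\<dots> = \<rho> ^ n" by (simp add: Lo_def)
    finally have Lo: "fdet (Suc n) Lo = \<rho> ^ n" .
    have "fdet (Suc n) (\<lambda>i j. \<Sum>l<Suc n. M i l * U l j) = fdet (Suc n) (\<lambda>i j. \<Sum>l<Suc n. U i l * Lo l j)"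
    proof (rule fdet_cong)
      fix i j assume ij: "i < Suc n" "j < Suc n"
      have "(\<Sum>l<Suc n. M i l * U l j) = (if j = n then 1 else q i j)"
      proof (cases "j = n")
        case True
        then show ?thesis using \<open>\<And>j. (\<Sum>i<Suc n. M j i) = 1\<close>[of i] by (simp add: U_def)
      next
        case False
        then have "(\<Sum>l<Suc n. M i l * U l j) = (\<Sum>l<Suc n. if l = j then q i j else 0)"
          using ij by (intro sum.cong) (auto simp: U_def M_def)
        then show ?thesis using ij False by (simp del: sum.lessThan_Suc)
      qed
      moreover have "(\<Sum>l<Suc n. U i l * Lo l j) = (if j = n then 1 else q i j)"
      proof (cases "i = n")
        case True
        have "(\<Sum>l<Suc n. U i l * Lo l j) = (\<Sum>l<Suc n. if l = n then Lo n j else 0)"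
          using True by (intro sum.cong) (auto simp: U_def)
        then show ?thesis using True ij by (auto simp: Lo_def q_def)
      next
        case False
        have "(\<Sum>l<Suc n. U i l * Lo l j) = Lo n j + (\<Sum>l<n. U i l * Lo l j)"
          by (simp add: U_def)
        also have "(\<Sum>l<n. U i l * Lo l j) = (\<Sum>l<n. if l = i then Lo i j else 0)"
          by (intro sum.cong) (auto simp: U_def)
        finally show ?thesis using False ij by (auto simp: Lo_def q_def \<rho>_def add_divide_distrib)
      qed
      ultimately show "(\<Sum>l<Suc n. M i l * U l j) = (\<Sum>l<Suc n. U i l * Lo l j)" by simp
    qed
    then have "fdet (Suc n) M = \<rho> ^ n" unfolding fdet_mult U Lo by simp
    then show ?thesis by simp
  qed
  ultimately show ?thesis unfolding covers_def \<rho>_def[symmetric] by blast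
qed

text \<open>As \<sigma> / 2 is 1 / (4 (n + 1)^2), the determinant at least doubles in 4 (n + 1)^2
  rounds. Its initial bound 1 / ((n + 1) (n + 2)^(n + 3))^n exceeds 2 to the power -(n (n + 2) (n +
  4) + 1), and it never passes 1.\<close>

definition rounds_bound :: "nat \<Rightarrow> nat" where
  "rounds_bound n = 4 * (n + 1)\<^sup>2 * (n * (n + 2) * (n + 4) + 1)"

lemma rounds_bound:
  assumes \<delta>: "\<delta> = 1 / (real n + 2) ^ (n + 3)" and \<sigma>: "\<sigma> = 1 / (2 * (real n + 1)\<^sup>2)"
    and le: "(1 + \<sigma> / 2) ^ t * (\<delta> / (real n + 1)) ^ n \<le> 1"
  shows "t < rounds_bound n"
proof (rule ccontr)
  assume nt: "\<not> t < rounds_bound n"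
  define K where "K = n * (n + 2) * (n + 4) + 1"
  have t: "4 * (n + 1)\<^sup>2 * K \<le> t" using nt by (simp add: rounds_bound_def K_def)
  have s: "0 < \<sigma>" unfolding \<sigma> by (auto simp: field_simps)
  have eq: "real (4 * (n + 1)\<^sup>2) * (\<sigma> / 2) = 1" unfolding \<sigma> by (simp add: field_simps)
  have "2 \<le> (1 + \<sigma> / 2) ^ (4 * (n + 1)\<^sup>2)"
    using Bernoulli_inequality[of "\<sigma> / 2" "4 * (n + 1)\<^sup>2"] s unfolding eq by simp
  then have "2 ^ K \<le> ((1 + \<sigma> / 2) ^ (4 * (n + 1)\<^sup>2)) ^ K" by (intro power_mono) auto
  also have "\<dots> \<le> (1 + \<sigma> / 2) ^ t" unfolding power_mult[symmetric]
    using s t by (intro power_increasing) auto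
  finally have 1: "2 ^ K \<le> (1 + \<sigma> / 2) ^ t" .
  have "(real n + 1) * (real n + 2) ^ (n + 3) \<le> (real n + 2) * (real n + 2) ^ (n + 3)"
    by (intro mult_right_mono) auto
  also have "\<dots> = (real n + 2) ^ (n + 4)" by (simp add: eval_nat_numeral)
  finally have "((real n + 1) * (real n + 2) ^ (n + 3)) ^ n \<le> ((real n + 2) ^ (n + 4)) ^ n"
    by (intro power_mono) auto
  also have "real n + 2 \<le> 2 ^ (n + 2)"
    using less_exp[of "n + 2"] by (metis of_nat_add of_nat_less_numeral_power_cancel_iff of_nat_numeral less_imp_le)
  then have "((real n + 2) ^ (n + 4)) ^ n \<le> ((2 ^ (n + 2)) ^ (n + 4)) ^ n"
    by (intro power_mono) auto
  also have "\<dots> = 2 ^ (n * (n + 2) * (n + 4))" by (simp only: power_mult[symmetric] mult_ac)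
  also have "\<dots> < 2 ^ K" by (simp add: K_def)
  finally have 2: "((real n + 1) * (real n + 2) ^ (n + 3)) ^ n < 2 ^ K" .
  have "(\<delta> / (real n + 1)) ^ n = 1 / ((real n + 1) * (real n + 2) ^ (n + 3)) ^ n"
    unfolding \<delta> by (simp add: power_divide mult.commute)
  then have "(1 + \<sigma> / 2) ^ t / ((real n + 1) * (real n + 2) ^ (n + 3)) ^ n \<le> 1"
    using le by simp
  moreover have "0 < ((real n + 1) * (real n + 2) ^ (n + 3)) ^ n" by simp
  ultimately have "(1 + \<sigma> / 2) ^ t \<le> ((real n + 1) * (real n + 2) ^ (n + 3)) ^ n"
    by (simp only: pos_divide_le_eq)
  with 1 2 show False by linarith
qed

section \<open>From approximate to exact solutions\<close>

lemma fdet_in_Ints: "(\<And>i j. i < n \<Longrightarrow> j < n \<Longrightarrow> f i j \<in> \<int>) \<Longrightarrow> fdet n f \<in> \<int>"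
  unfolding fdet_leibniz
  by (intro Ints_sum Ints_mult Ints_prod) (auto simp: permutes_in_image)

lemma abs_fdet_le_power:
  assumes "\<And>i j. i < n \<Longrightarrow> j < n \<Longrightarrow> \<bar>f i j\<bar> \<le> 1"
  shows "\<bar>fdet n f\<bar> \<le> real n ^ n"
proof -
  have "(\<Sum>j<n. \<bar>f i j\<bar>) \<le> (\<Sum>j<n. 1)" if "i < n" for i
    using assms[OF that] by (intro sum_mono) auto
  then have "(\<Prod>i<n. \<Sum>j<n. \<bar>f i j\<bar>) \<le> (\<Prod>i<n. real n)"
    by (intro prod_mono) (auto intro: sum_nonneg)
  then show ?thesis using abs_fdet_le[of n f] by simp
qed

text \<open>The entries of \<open>C\<close> are signed minors, hence integers. Their bound (n -
  1)^(n - 1) is weakened to n^n, the bound that also holds for the determinant.\<close>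

lemma adjugate_exists:
  assumes int: "\<And>i j. i < n \<Longrightarrow> j < n \<Longrightarrow> B i j \<in> \<int>"
    and le1: "\<And>i j. i < n \<Longrightarrow> j < n \<Longrightarrow> \<bar>B i j\<bar> \<le> (1 :: real)"
  obtains C where "\<And>i j. i < n \<Longrightarrow> j < n \<Longrightarrow> C i j \<in> \<int>"
    and "\<And>i j. i < n \<Longrightarrow> j < n \<Longrightarrow> \<bar>C i j\<bar> \<le> real n ^ n"
    and "\<And>i l. i < n \<Longrightarrow> l < n \<Longrightarrow> (\<Sum>j<n. C i j * B j l) = (if i = l then fdet n B else 0)"
proof -
  define A where "A = Matrix.mat n n (\<lambda>(i, j). B i j)"
  have A: "A \<in> carrier_mat n n" by (simp add: A_def)
  define C where "C i j = adj_mat A $$ (i, j)" for i j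
  have C: "C i j = (-1) ^ (j + i) * fdet (n - 1) (\<lambda>i' j'. B (if i' < j then i' else Suc i') (if j' < i then j' else Suc j'))"
    if "i < n" "j < n" for i j
  proof -
    have "mat_delete A j i = Matrix.mat (n - 1) (n - 1)
        (\<lambda>(i', j'). B (if i' < j then i' else Suc i') (if j' < i then j' else Suc j'))"
      unfolding mat_delete_def A_def by (intro eq_matI) auto
    then show ?thesis
      using that A unfolding C_def adj_mat_def by (simp add: cofactor_def)
  qed
  have 1: "C i j \<in> \<int>" if "i < n" "j < n" for i j
    unfolding C[OF that] by (intro Ints_mult Ints_power fdet_in_Ints int) (use that in \<open>auto split: if_splits\<close>)
  have 2: "\<bar>C i j\<bar> \<le> real n ^ n" if "i < n" "j < n" for i j
  proof -
    have "\<bar>C i j\<bar> \<le> real (n - 1) ^ (n - 1)"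
      unfolding C[OF that] abs_mult
      by (simp add: power_abs) (intro abs_fdet_le_power le1; use that in \<open>auto split: if_splits\<close>)
    also have "\<dots> \<le> real n ^ (n - 1)" by (intro power_mono) auto
    also have "\<dots> \<le> real n ^ n" using that by (intro power_increasing) auto
    finally show ?thesis .
  qed
  have 3: "(\<Sum>j<n. C i j * B j l) = (if i = l then fdet n B else 0)" if "i < n" "l < n" for i l
  proof -
    have "(adj_mat A * A) $$ (i, l) = (Determinant.det A \<cdot>\<^sub>m 1\<^sub>m n) $$ (i, l)"
      using adj_mat[OF A] by simp
    moreover have "(adj_mat A * A) $$ (i, l) = (\<Sum>j<n. C i j * B j l)"
      using that adj_mat(1)[OF A] A
      by (auto simp: scalar_prod_def C_def A_def atLeast0LessThan intro!: sum.cong)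
    moreover have "fdet n B = Determinant.det A" by (simp add: A_def)
    ultimately show ?thesis using that by simp
  qed
  show ?thesis by (rule that[OF 1 2 3])
qed

text \<open>
  By Cramer's rule \<open>\<Delta> y\<close> is integral, where \<open>\<Delta>\<close> is the determinant of the basis, and close to \<open>\<Delta> x\<close>;
  an integer below 1 is nonpositive.
\<close>

lemma basic_solution_feasible:
  fixes A :: "nat \<Rightarrow> nat \<Rightarrow> real"
  assumes int: "\<And>l r. l \<le> n \<Longrightarrow> r < R \<Longrightarrow> A l r \<in> \<int>"
    and le1: "\<And>l r. l < n \<Longrightarrow> r < R \<Longrightarrow> \<bar>A l r\<bar> \<le> 1"
    and e: "\<And>j. j < n \<Longrightarrow> e j < R"
    and B: "fdet n (\<lambda>j l. A l (e j)) \<noteq> 0"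
    and z: "\<And>r. r < R \<Longrightarrow> (\<Sum>l<n. x l * A l r) + A n r - \<epsilon> \<le> 0"
    and ze: "\<And>j. j < n \<Longrightarrow> (\<Sum>l<n. x l * A l (e j)) + A n (e j) - \<epsilon> = 0"
    and ye: "\<And>j. j < n \<Longrightarrow> (\<Sum>l<n. y l * A l (e j)) + A n (e j) = 0"
    and \<epsilon>: "\<epsilon> = 1 / (real n + 2) ^ (n + 3)" and r: "r < R"
  shows "(\<Sum>l<n. y l * A l r) + A n r \<le> 0"
proof -
  let ?B = "\<lambda>j l. A l (e j)"
  define \<Delta> where "\<Delta> = fdet n ?B"
  have int': "?B j l \<in> \<int>" if "j < n" "l < n" for j l
    using int[of l "e j"] e that by simp
  have le1': "\<bar>?B j l\<bar> \<le> 1" if "j < n" "l < n" for j l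
    using le1[of l "e j"] e that by simp
  obtain C where C: "\<And>i j. i < n \<Longrightarrow> j < n \<Longrightarrow> C i j \<in> \<int>"
    "\<And>i j. i < n \<Longrightarrow> j < n \<Longrightarrow> \<bar>C i j\<bar> \<le> real n ^ n"
    "\<And>i l. i < n \<Longrightarrow> l < n \<Longrightarrow> (\<Sum>j<n. C i j * ?B j l) = (if i = l then fdet n ?B else 0)"
    by (rule adjugate_exists[of n ?B, OF int' le1'], assumption+, rule that)
  \<comment> \<open>Cramer's rule: the adjugate recovers \<Delta> times a vector from its values at
    the basis constraints. It is applied to \<open>y\<close>, which gives integrality, and to the
    difference of \<open>x\<close> and \<open>y\<close>, whose values there all equal
    \<epsilon>.\<close>
  have solve: "\<Delta> * w i = (\<Sum>j<n. C i j * (\<Sum>l<n. w l * ?B j l))" if i: "i < n" for w i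
  proof -
    have "(\<Sum>j<n. C i j * (\<Sum>l<n. w l * ?B j l)) = (\<Sum>l<n. w l * (\<Sum>j<n. C i j * ?B j l))"
      unfolding sum_distrib_left by (subst sum.swap) (simp add: mult_ac)
    also have "\<dots> = (\<Sum>l<n. if l = i then w i * \<Delta> else 0)"
      using C(3)[OF i] by (intro sum.cong) (auto simp: \<Delta>_def)
    finally show ?thesis using i by (simp add: mult.commute)
  qed
  have yB: "(\<Sum>l<n. y l * ?B j l) = - A n (e j)" if "j < n" for j using ye[OF that] by simp
  have xB: "(\<Sum>l<n. (x l - y l) * ?B j l) = \<epsilon>" if "j < n" for j
    using ze[OF that] ye[OF that] by (simp add: left_diff_distrib sum_subtractf)
  have yI: "\<Delta> * y i \<in> \<int>" if "i < n" for i
  proof -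
    have "\<Delta> * y i = (\<Sum>j<n. C i j * - A n (e j))" unfolding solve[OF that] using yB by simp
    also have "\<dots> \<in> \<int>" using C(1)[OF that] int e by (intro Ints_sum Ints_mult) auto
    finally show ?thesis .
  qed
  have \<Delta>I: "\<Delta> \<in> \<int>" unfolding \<Delta>_def using int e by (intro fdet_in_Ints) auto
  have \<Delta>le: "\<bar>\<Delta>\<bar> \<le> real n ^ n" unfolding \<Delta>_def using le1 e by (intro abs_fdet_le_power) auto
  have \<epsilon>0: "\<epsilon> > 0" unfolding \<epsilon> by simp
  have diff: "\<bar>\<Delta> * (x i - y i)\<bar> \<le> \<epsilon> * (real n * real n ^ n)" if i: "i < n" for i
  proof -
    have "\<Delta> * (x i - y i) = (\<Sum>j<n. C i j * \<epsilon>)" using solve[OF i, of "\<lambda>l. x l - y l"] xB by simp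
    then have "\<bar>\<Delta> * (x i - y i)\<bar> \<le> (\<Sum>j<n. \<bar>C i j * \<epsilon>\<bar>)" by simp
    also have "\<dots> \<le> (\<Sum>j<n. real n ^ n * \<epsilon>)"
      using C(2)[OF i] \<epsilon>0 by (intro sum_mono) (auto simp: abs_mult)
    finally show ?thesis by (simp add: mult_ac)
  qed
  define Y where "Y = (\<Sum>l<n. y l * A l r) + A n r"
  define Z where "Z = (\<Sum>l<n. x l * A l r) + A n r - \<epsilon>"
  have Z: "Z \<le> 0" using z[OF r] by (simp add: Z_def)
  have "\<Delta> * Y = (\<Sum>l<n. (\<Delta> * y l) * A l r) + \<Delta> * A n r"
    unfolding Y_def by (simp add: sum_distrib_left distrib_left mult_ac)
  also have "\<dots> \<in> \<int>"
    using Ints_mult[OF yI int[OF _ r]] Ints_mult[OF \<Delta>I int[OF _ r]] by (intro Ints_add Ints_sum) auto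
  finally have "\<Delta> * Y \<in> \<int>" .
  \<comment> \<open>The absolute value of \<Delta> as factor preserves the sign of
    \<open>Y\<close>.\<close>
  then have Yint: "\<bar>\<Delta>\<bar> * Y \<in> \<int>" by (cases "\<Delta> \<ge> 0") auto
  have "Y - Z - \<epsilon> = - (\<Sum>l<n. (x l - y l) * A l r)"
    by (simp add: Y_def Z_def left_diff_distrib sum_subtractf)
  then have "\<bar>\<Delta> * (Y - Z - \<epsilon>)\<bar> = \<bar>\<Sum>l<n. \<Delta> * (x l - y l) * A l r\<bar>"
    by (simp add: sum_distrib_left mult.assoc)
  also have "\<dots> \<le> (\<Sum>l<n. \<bar>\<Delta> * (x l - y l) * A l r\<bar>)" by (rule sum_abs)
  also have "\<dots> \<le> (\<Sum>l<n. \<epsilon> * (real n * real n ^ n) * 1)"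
    unfolding abs_mult[of _ "A _ r"] using diff le1 r \<epsilon>0 by (intro sum_mono mult_mono) auto
  also have "\<dots> = \<epsilon> * real n ^ (n + 2)" by simp
  finally have "\<bar>\<Delta>\<bar> * \<bar>Y - Z - \<epsilon>\<bar> \<le> \<epsilon> * real n ^ (n + 2)" by (simp add: abs_mult)
  moreover have "\<bar>\<Delta>\<bar> * (Y - Z - \<epsilon>) \<le> \<bar>\<Delta>\<bar> * \<bar>Y - Z - \<epsilon>\<bar>" by (intro mult_left_mono) auto
  moreover have "\<bar>\<Delta>\<bar> * Z \<le> 0" using Z by (simp add: mult_le_0_iff)
  moreover have "\<bar>\<Delta>\<bar> * \<epsilon> \<le> \<epsilon> * real n ^ n" using \<Delta>le \<epsilon>0 by (simp add: mult.commute)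
  ultimately have le: "\<bar>\<Delta>\<bar> * Y \<le> \<epsilon> * (real n ^ n + real n ^ (n + 2))"
    by (simp add: algebra_simps)
  \<comment> \<open>This is where the exponent n + 3 of \<epsilon> comes from: n^(n + 2) accounts
    for the difference of the two solutions in constraint \<open>r\<close>, and n^n for the
    tolerance itself, both scaled by the determinant.\<close>
  have "real n ^ n + real n ^ (n + 2) = real n ^ n * (1 + (real n)\<^sup>2)"
    by (simp add: algebra_simps power_add power2_eq_square)
  also have "\<dots> \<le> (real n + 2) ^ n * (real n + 2)\<^sup>2"
    by (intro mult_mono power_mono) (auto simp: power2_eq_square algebra_simps)
  also have "\<dots> = 1 * (real n + 2) ^ (n + 2)" by (simp add: power_add power2_eq_square)
  also have "\<dots> < (real n + 2) * (real n + 2) ^ (n + 2)" by (intro mult_strict_right_mono) auto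
  also have "\<dots> = (real n + 2) ^ (n + 3)" by (simp add: eval_nat_numeral)
  finally have "\<epsilon> * (real n ^ n + real n ^ (n + 2)) < 1" unfolding \<epsilon> by (simp add: field_simps)
  with le have "\<bar>\<Delta>\<bar> * Y < 1" by linarith
  with Yint have "\<bar>\<Delta>\<bar> * Y \<le> 0" by (auto elim!: Ints_cases)
  moreover have "\<bar>\<Delta>\<bar> > 0" using B by (simp add: \<Delta>_def)
  ultimately show ?thesis unfolding Y_def[symmetric] by (simp add: mult_le_0_iff)
qed

text \<open>
  After \<open>i\<close> moves, \<open>z\<close> holds the slacks of the current point of the relaxed polyhedron and row \<open>n\<close> of \<open>D\<close>
  those of the solution of the tight constraints \<open>e 0, \<dots>, e (i - 1)\<close> without tolerance; the rows from \<open>i\<close>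
  on are directions orthogonal to these constraints. A direction \<open>j\<close> has coordinate 1 at \<open>j\<close>, so the
  constraint \<open>- x j \<le> 0\<close> stops the move along it.
\<close>

definition purified :: "nat \<Rightarrow> nat \<Rightarrow> (nat \<Rightarrow> nat \<Rightarrow> real) \<Rightarrow> real \<Rightarrow> nat \<Rightarrow> (nat \<Rightarrow> nat \<Rightarrow> real) \<Rightarrow> (nat \<Rightarrow> real) \<Rightarrow> bool" where
  "purified n R A \<epsilon> i D z \<longleftrightarrow>
     (\<forall>r<R. z r \<le> 0) \<and>
     (\<exists>x. \<forall>r<R. z r = (\<Sum>l<n. x l * A l r) + A n r - \<epsilon>) \<and>
     (\<exists>y. \<forall>r<R. D n r = (\<Sum>l<n. y l * A l r) + A n r) \<and>
     (\<exists>d. \<forall>j<n. \<forall>r<R. D j r = (\<Sum>l<n. d j l * A l r)) \<and>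
     (\<forall>j l. i \<le> j \<longrightarrow> j < n \<longrightarrow> i \<le> l \<longrightarrow> l < n \<longrightarrow> D j l = (if j = l then -1 else 0)) \<and>
     (\<exists>e. \<forall>j<i. e j < R \<and> z (e j) = 0 \<and> D n (e j) = 0 \<and> D j (e j) \<noteq> 0 \<and>
       (\<forall>l. j < l \<longrightarrow> l < n \<longrightarrow> D l (e j) = 0))"

text \<open>The tableau needs no preparation: initially the directions are the coordinate axes and
  the point without tolerance is the origin.\<close>

lemma purified_start:
  assumes "\<And>r. r < R \<Longrightarrow> z r \<le> 0" "\<And>r. r < R \<Longrightarrow> z r = (\<Sum>l<n. x l * A l r) + A n r - \<epsilon>"
    and "\<And>l r. l < n \<Longrightarrow> r < n \<Longrightarrow> A l r = (if l = r then -1 else 0)"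
    and D: "\<And>l r. l \<le> n \<Longrightarrow> r < R \<Longrightarrow> D l r = A l r" and "n \<le> R"
  shows "purified n R A \<epsilon> 0 D z"
proof -
  have "\<exists>y. \<forall>r<R. D n r = (\<Sum>l<n. y l * A l r) + A n r"
    using D by (intro exI[of _ "\<lambda>_. 0"]) auto
  moreover have "\<exists>d. \<forall>j<n. \<forall>r<R. D j r = (\<Sum>l<n. d j l * A l r)"
  proof (intro exI allI impI)
    fix j r assume "j < n" "r < R"
    have "(\<Sum>l<n. (if l = j then 1 else 0) * A l r) = (\<Sum>l<n. if l = j then A j r else 0)"
      by (intro sum.cong) auto
    then show "D j r = (\<Sum>l<n. (if l = j then 1 else 0) * A l r)"
      using \<open>j < n\<close> \<open>r < R\<close> D by simp
  qed
  ultimately show ?thesis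
    unfolding purified_def using assms by auto
qed

text \<open>This is the ratio test of the simplex method: constraints with nonnegative entry in row
  \<open>i\<close> only gain room, and the least ratio tells which of the others becomes tight
  first. Constraints that are already tight stay so because direction \<open>i\<close> vanishes on
  them. Subtracting multiples of row \<open>i\<close> makes the later directions vanish at
  \<open>p\<close>, and moves the second point to where \<open>p\<close> is tight without tolerance;
  whether that point is feasible is settled only at the end.\<close>

lemma purified_step:
  assumes pur: "purified n R A \<epsilon> i D z" and i: "i < n" and R: "n \<le> R"
    and p: "p < R" "D i p < 0" and min: "\<And>r. r < R \<Longrightarrow> D i r < 0 \<Longrightarrow> z p / D i p \<le> z r / D i r"
    and z': "\<And>r. r < R \<Longrightarrow> z' r = z r - z p / D i p * D i r"
    and D': "\<And>j r. j \<le> n \<Longrightarrow> r < R \<Longrightarrow> D' j r = (if i < j then D j r - D j p / D i p * D i r else D j r)"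
  shows "purified n R A \<epsilon> (Suc i) D' z'"
proof -
  obtain x y d e where h: "\<forall>r<R. z r \<le> 0"
    "\<forall>r<R. z r = (\<Sum>l<n. x l * A l r) + A n r - \<epsilon>"
    "\<forall>r<R. D n r = (\<Sum>l<n. y l * A l r) + A n r"
    "\<forall>j<n. \<forall>r<R. D j r = (\<Sum>l<n. d j l * A l r)"
    "\<forall>j l. i \<le> j \<longrightarrow> j < n \<longrightarrow> i \<le> l \<longrightarrow> l < n \<longrightarrow> D j l = (if j = l then -1 else 0)"
    "\<forall>j<i. e j < R \<and> z (e j) = 0 \<and> D n (e j) = 0 \<and> D j (e j) \<noteq> 0 \<and>
       (\<forall>l. j < l \<longrightarrow> l < n \<longrightarrow> D l (e j) = 0)"
    using pur unfolding purified_def by - (elim conjE exE, rule that)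
  note z0 = h(1)[rule_format] and x = h(2)[rule_format] and y = h(3)[rule_format]
    and d = h(4)[rule_format] and unit = h(5)[rule_format] and e = h(6)[rule_format]
  have "z' r \<le> 0" if r: "r < R" for r
  proof (cases "D i r < 0")
    case True
    with min[OF r] have "z r / D i r * D i r \<le> z p / D i p * D i r"
      by (intro mult_right_mono_neg) auto
    with True show ?thesis using z'[OF r] by simp
  next
    case False
    then have "0 \<le> z p / D i p * D i r"
      using z0[OF p(1)] p(2) by (intro mult_nonneg_nonneg divide_nonpos_nonpos) auto
    then show ?thesis using z'[OF r] z0[OF r] by simp
  qed
  moreover have "\<exists>x. \<forall>r<R. z' r = (\<Sum>l<n. x l * A l r) + A n r - \<epsilon>"
  proof (intro exI allI impI)
    fix r assume r: "r < R"
    show "z' r = (\<Sum>l<n. (x l - z p / D i p * d i l) * A l r) + A n r - \<epsilon>"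
      unfolding z'[OF r] x[OF r] d[OF i r]
      by (simp add: algebra_simps sum_subtractf sum_distrib_left)
  qed
  moreover have "\<exists>y. \<forall>r<R. D' n r = (\<Sum>l<n. y l * A l r) + A n r"
  proof (intro exI allI impI)
    fix r assume r: "r < R"
    have "D' n r = D n r - D n p / D i p * D i r" using D'[OF _ r, of n] i by simp
    then show "D' n r = (\<Sum>l<n. (y l - D n p / D i p * d i l) * A l r) + A n r"
      unfolding y[OF r] d[OF i r]
      by (simp add: algebra_simps sum_subtractf sum_distrib_left)
  qed
  moreover have "\<exists>d. \<forall>j<n. \<forall>r<R. D' j r = (\<Sum>l<n. d j l * A l r)"
  proof (intro exI allI impI)
    fix j r assume j: "j < n" and r: "r < R"
    show "D' j r = (\<Sum>l<n. (if i < j then d j l - D j p / D i p * d i l else d j l) * A l r)"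
      using D'[OF _ r, of j] j unfolding d[OF j r] d[OF i r]
      by (auto simp add: algebra_simps sum_subtractf sum_distrib_left)
  qed
  \<comment> \<open>Direction \<open>i\<close> vanishes in the columns after \<open>i\<close> and
    below \<open>n\<close>, so the unit entries of the later directions are untouched.\<close>
  moreover have "D' j l = (if j = l then -1 else 0)"
    if "Suc i \<le> j" "j < n" "Suc i \<le> l" "l < n" for j l
    using that D'[of j l] unit[of j l] unit[of i l] i R by simp
  moreover have "\<exists>e. \<forall>j<Suc i. e j < R \<and> z' (e j) = 0 \<and> D' n (e j) = 0 \<and> D' j (e j) \<noteq> 0 \<and>
       (\<forall>l. j < l \<longrightarrow> l < n \<longrightarrow> D' l (e j) = 0)"
  proof (intro exI[of _ "e(i := p)"] allI impI)
    fix j assume "j < Suc i"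
    then consider "j = i" | "j < i" by linarith
    then show "(e(i := p)) j < R \<and> z' ((e(i := p)) j) = 0 \<and> D' n ((e(i := p)) j) = 0 \<and>
       D' j ((e(i := p)) j) \<noteq> 0 \<and> (\<forall>l. j < l \<longrightarrow> l < n \<longrightarrow> D' l ((e(i := p)) j) = 0)"
    proof cases
      case 1
      then show ?thesis using p z'[of p] D'[of _ p] i by auto
    next
      case 2
      then show ?thesis using e[OF 2] z'[of "e j"] D'[of _ "e j"] i by auto
    qed
  qed
  ultimately show ?thesis unfolding purified_def by blast
qed

text \<open>The tight constraints evaluated on the directions form a triangular matrix with nonzero
  diagonal. By multiplicativity of the determinant the tight constraints are independent, and
  Cramer's argument applies to them.\<close>

lemma purified_final:
  assumes pur: "purified n R A \<epsilon> n D z"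
    and int: "\<And>l r. l \<le> n \<Longrightarrow> r < R \<Longrightarrow> A l r \<in> \<int>"
    and le1: "\<And>l r. l < n \<Longrightarrow> r < R \<Longrightarrow> \<bar>A l r\<bar> \<le> 1"
    and \<epsilon>: "\<epsilon> = 1 / (real n + 2) ^ (n + 3)"
  obtains y where "\<And>r. r < R \<Longrightarrow> D n r = (\<Sum>l<n. y l * A l r) + A n r" "\<And>r. r < R \<Longrightarrow> D n r \<le> 0"
proof -
  obtain x y d e where h: "\<forall>r<R. z r \<le> 0"
    "\<forall>r<R. z r = (\<Sum>l<n. x l * A l r) + A n r - \<epsilon>"
    "\<forall>r<R. D n r = (\<Sum>l<n. y l * A l r) + A n r"
    "\<forall>j<n. \<forall>r<R. D j r = (\<Sum>l<n. d j l * A l r)"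
    "\<forall>j l. n \<le> j \<longrightarrow> j < n \<longrightarrow> n \<le> l \<longrightarrow> l < n \<longrightarrow> D j l = (if j = l then -1 else 0)"
    "\<forall>j<n. e j < R \<and> z (e j) = 0 \<and> D n (e j) = 0 \<and> D j (e j) \<noteq> 0 \<and>
       (\<forall>l. j < l \<longrightarrow> l < n \<longrightarrow> D l (e j) = 0)"
    using pur unfolding purified_def by - (elim conjE exE, rule that)
  note z0 = h(1)[rule_format] and x = h(2)[rule_format] and y = h(3)[rule_format]
    and d = h(4)[rule_format] and unit = h(5)[rule_format] and e = h(6)[rule_format]
  have "fdet n (\<lambda>j l. A l (e j)) * fdet n (\<lambda>l k. d k l) = fdet n (\<lambda>j k. D k (e j))"
    unfolding fdet_mult[symmetric] using e d by (intro fdet_cong) (auto simp: mult.commute intro!: sum.cong)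
  also have "\<dots> = (\<Prod>j<n. D j (e j))"
    using e by (intro fdet_lower) auto
  also have "\<dots> \<noteq> 0" using e by simp
  finally have B: "fdet n (\<lambda>j l. A l (e j)) \<noteq> 0" by auto
  have "D n r \<le> 0" if r: "r < R" for r
    unfolding y[OF r]
  proof (rule basic_solution_feasible[where e = e and x = x and \<epsilon> = \<epsilon> and A = A and R = R])
    show "A l r \<in> \<int>" if "l \<le> n" "r < R" for l r by (rule int[OF that])
    show "\<bar>A l r\<bar> \<le> 1" if "l < n" "r < R" for l r by (rule le1[OF that])
    show "e j < R" if "j < n" for j using e[OF that] by simp
    show "(\<Sum>l<n. x l * A l r) + A n r - \<epsilon> \<le> 0" if "r < R" for r using x[OF that] z0[OF that] by simp
    show "(\<Sum>l<n. x l * A l (e j)) + A n (e j) - \<epsilon> = 0" if "j < n" for j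
      using x[of "e j"] e[OF that] by simp
    show "(\<Sum>l<n. y l * A l (e j)) + A n (e j) = 0" if "j < n" for j
      using y[of "e j"] e[OF that] by simp
  qed (fact B \<epsilon> r)+
  then show ?thesis using that y by blast
qed

section \<open>A program logic for expectations\<close>

text \<open>A calculus of lower bounds for expectations, in the manner of weakest preexpectations.
  The certain postcondition \<open>Q\<close> and the bound \<open>v\<close> are carried together
  because the rounding keeps its invariant surely but its potential only on average. The budget
  \<open>t\<close> includes halting.\<close>

definition reaches :: "nat \<Rightarrow> program \<Rightarrow> (memory \<Rightarrow> bool) \<Rightarrow> (memory \<Rightarrow> real) \<Rightarrow> memory \<Rightarrow> real \<Rightarrow> bool" where
  "reaches t c Q \<psi> s v \<longleftrightarrow> (\<forall>(c', s') \<in> set_pmf (run t c s). c' = Skip \<and> Q s') \<and>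
     v \<le> measure_pmf.expectation (run t c s) (\<lambda>(c', s'). \<psi> s')"

text \<open>A step draws at most one coin, so all distributions that occur have finite support and
  integrability is never an issue.\<close>

lemma finite_set_pmf_step: "finite (set_pmf (step c s))"
  by (induction c arbitrary: s) (auto simp: split_def)

lemma finite_set_pmf_run: "finite (set_pmf (run t c s))"
  by (induction t arbitrary: c s) (auto simp: finite_set_pmf_step split_def)

lemma expectation_bind_finite:
  fixes f :: "'b \<Rightarrow> real"
  assumes "finite (set_pmf p)" "\<And>x. x \<in> set_pmf p \<Longrightarrow> finite (set_pmf (q x))"
  shows "measure_pmf.expectation (bind_pmf p q) f =
    measure_pmf.expectation p (\<lambda>x. measure_pmf.expectation (q x) f)"
  by (subst pmf_expectation_bind[where A = "set_pmf p"])
    (use assms in \<open>auto simp: integral_measure_pmf[where A = "set_pmf p"] scaleR_conv_of_real\<close>)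

lemma expectation_mono_finite:
  fixes f :: "'b \<Rightarrow> real"
  assumes "finite (set_pmf p)" "\<And>x. x \<in> set_pmf p \<Longrightarrow> f x \<le> g x"
  shows "measure_pmf.expectation p f \<le> measure_pmf.expectation p g"
  using assms by (auto simp: integral_measure_pmf[where A = "set_pmf p"] intro!: sum_mono mult_left_mono)

lemma reaches_conseq:
  assumes "reaches t c Q \<psi> s v" "\<And>s'. Q s' \<Longrightarrow> Q' s'" "\<And>s'. Q s' \<Longrightarrow> \<psi> s' \<le> \<psi>' s'" "v' \<le> v"
  shows "reaches t c Q' \<psi>' s v'"
proof -
  have "measure_pmf.expectation (run t c s) (\<lambda>(c', s'). \<psi> s') \<le>
      measure_pmf.expectation (run t c s) (\<lambda>(c', s'). \<psi>' s')"
    using assms(1,3) by (intro expectation_mono_finite finite_set_pmf_run) (auto simp: reaches_def)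
  then show ?thesis using assms by (fastforce simp: reaches_def)
qed

text \<open>The law of total expectation, with \<open>\<phi>\<close> as a lower bound for the
  remaining \<open>t'\<close> steps.\<close>

lemma reaches_bind:
  assumes "\<forall>(c', s') \<in> set_pmf (run t c s). reaches t' c' Q \<psi> s' (\<phi> c' s')"
    and "v \<le> measure_pmf.expectation (run t c s) (\<lambda>(c', s'). \<phi> c' s')"
  shows "reaches (t + t') c Q \<psi> s v"
proof -
  have "measure_pmf.expectation (run t c s) (\<lambda>(c', s'). \<phi> c' s') \<le>
      measure_pmf.expectation (run t c s) (\<lambda>x. measure_pmf.expectation (case x of (c', s') \<Rightarrow> run t' c' s') (\<lambda>(c', s'). \<psi> s'))"
    using assms(1) by (intro expectation_mono_finite finite_set_pmf_run) (auto simp: reaches_def)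
  also have "\<dots> = measure_pmf.expectation (run (t + t') c s) (\<lambda>(c', s'). \<psi> s')"
    unfolding run_add by (subst expectation_bind_finite) (auto simp: finite_set_pmf_run)
  finally show ?thesis
    using assms unfolding reaches_def run_add by fastforce
qed

lemma reaches_Skip:
  assumes "Q s" "v \<le> \<psi> s" shows "reaches t Skip Q \<psi> s v"
  using assms by (simp add: reaches_def run_Skip)

lemma reaches_mono_time:
  assumes "reaches t c Q \<psi> s v" "t \<le> t'" shows "reaches t' c Q \<psi> s v"
proof -
  obtain d where t': "t' = t + d" using assms(2) le_Suc_ex by blast
  show ?thesis unfolding t'
    by (rule reaches_bind[where \<phi> = "\<lambda>_. \<psi>"]) (use assms(1) in \<open>auto simp: reaches_def run_Skip\<close>)
qed

lemma reaches_step_return: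
  assumes "step c s = return_pmf (c', s')" "reaches t c' Q \<psi> s' v"
  shows "reaches (Suc t) c Q \<psi> s v"
  using assms by (simp add: reaches_def bind_return_pmf)

lemma reaches_SetNat:
  "Q (set_nat a i j (nval e s) s) \<Longrightarrow> v \<le> \<psi> (set_nat a i j (nval e s) s) \<Longrightarrow> reaches (Suc t) (SetNat a i j e) Q \<psi> s v"
  by (rule reaches_step_return) (auto intro: reaches_Skip)

lemma reaches_SetReal:
  "Q (set_real a i j (rval e s) s) \<Longrightarrow> v \<le> \<psi> (set_real a i j (rval e s) s) \<Longrightarrow> reaches (Suc t) (SetReal a i j e) Q \<psi> s v"
  by (rule reaches_step_return) (auto intro: reaches_Skip)

lemma reaches_Flip:
  assumes p: "0 \<le> rval e s" "rval e s \<le> 1"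
    and "0 < rval e s \<Longrightarrow> Q (set_nat a i j 1 s)" "rval e s < 1 \<Longrightarrow> Q (set_nat a i j 0 s)"
    and "v \<le> rval e s * \<psi> (set_nat a i j 1 s) + (1 - rval e s) * \<psi> (set_nat a i j 0 s)"
  shows "reaches (Suc t) (Flip a i j e) Q \<psi> s v"
proof -
  have "reaches (1 + t) (Flip a i j e) Q \<psi> s v"
  proof (rule reaches_mono_time[of 1])
    have "run 1 (Flip a i j e) s =
        map_pmf (\<lambda>b. (Skip, set_nat a i j (if b then 1 else 0) s)) (bernoulli_pmf (rval e s))"
      by (simp add: split_def bind_return_pmf')
    then show "reaches 1 (Flip a i j e) Q \<psi> s v"
      using assms unfolding reaches_def by (auto simp: set_pmf_iff mult.commute split: if_splits)
  qed simp
  then show ?thesis by simp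
qed

lemma reaches_Cond:
  assumes "bval b s \<Longrightarrow> reaches t c Q \<psi> s v" "\<not> bval b s \<Longrightarrow> reaches t c' Q \<psi> s v"
  shows "reaches (Suc t) (Cond b c c') Q \<psi> s v"
  by (rule reaches_step_return[where c' = "if bval b s then c else c'"]) (use assms in auto)

text \<open>Here \<open>\<phi>\<close> is a preexpectation of \<open>c'\<close>, and the extra step
  is the one that drops the finished \<open>Skip\<close>. The induction is on the time of
  \<open>c\<close>, because the semantics performs each step of \<open>c\<close> underneath
  \<open>Seq\<close>.\<close>

lemma reaches_Seq:
  "reaches t c Q \<phi> s v \<Longrightarrow> (\<And>s'. Q s' \<Longrightarrow> reaches t' c' Q' \<psi> s' (\<phi> s')) \<Longrightarrow>
   reaches (t + 1 + t') (Seq c c') Q' \<psi> s v"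
proof (induction t arbitrary: c s v)
  case 0
  then have c: "c = Skip" "Q s" "v \<le> \<phi> s" by (auto simp: reaches_def)
  have "reaches (Suc t') (Seq c c') Q' \<psi> s (\<phi> s)"
    by (rule reaches_step_return[OF _ 0(2)[OF c(2)]]) (simp add: c(1))
  then show ?case using c(3) by (auto elim: reaches_conseq)
next
  case (Suc t)
  show ?case
  proof (cases "c = Skip")
    case True
    with Suc(2) have c: "Q s" "v \<le> \<phi> s" by (auto simp: reaches_def run_Skip bind_return_pmf)
    have "reaches (Suc t') (Seq c c') Q' \<psi> s (\<phi> s)"
      by (rule reaches_step_return[OF _ Suc(3)[OF c(1)]]) (simp add: True)
    then have "reaches (Suc t + 1 + t') (Seq c c') Q' \<psi> s (\<phi> s)" by (rule reaches_mono_time) simp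
    then show ?thesis using c(2) by (auto elim: reaches_conseq)
  next
    case False
    define E where "E c' s' = measure_pmf.expectation (run t c' s') (\<lambda>(c', s'). \<phi> s')" for c' s'
    have IH: "reaches (t + 1 + t') (Seq c2 c') Q' \<psi> s2 (E c2 s2)" if "(c2, s2) \<in> set_pmf (step c s)" for c2 s2
    proof (rule Suc.IH)
      show "reaches t c2 Q \<phi> s2 (E c2 s2)"
        using Suc(2) that unfolding reaches_def E_def by (fastforce simp: split_def)
    qed (rule Suc(3))
    have "run 1 (Seq c c') s = map_pmf (\<lambda>(c'', s'). (Seq c'' c', s')) (step c s)"
      using False by (simp add: split_def bind_return_pmf')
    moreover have "v \<le> measure_pmf.expectation (step c s) (\<lambda>(c2, s2). E c2 s2)"
    proof -
      have "v \<le> measure_pmf.expectation (run (Suc t) c s) (\<lambda>(c', s'). \<phi> s')"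
        using Suc(2) by (simp add: reaches_def)
      also have "\<dots> = measure_pmf.expectation (step c s) (\<lambda>x. measure_pmf.expectation (case x of (c', s') \<Rightarrow> run t c' s') (\<lambda>(c', s'). \<phi> s'))"
        unfolding run.simps by (subst expectation_bind_finite) (auto simp: finite_set_pmf_step finite_set_pmf_run)
      finally show ?thesis by (simp add: E_def split_def)
    qed
    \<comment> \<open>Such a step always leaves a \<open>Seq\<close>, so the default 0 concerns no
      reachable program.\<close>
    ultimately have "reaches (1 + (t + 1 + t')) (Seq c c') Q' \<psi> s v"
      by (intro reaches_bind[where \<phi> = "\<lambda>c2 s2. case c2 of Seq c3 _ \<Rightarrow> E c3 s2 | _ \<Rightarrow> 0"])
        (use IH in \<open>auto simp: split_def\<close>)
    then show ?thesis by simp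
  qed
qed

text \<open>Optional stopping after boundedly many rounds: \<open>\<phi>\<close> may depend on the
  round and must not fall in expectation. The cost \<open>t + 2\<close> of a round contains the test
  of the condition and the step that drops \<open>Skip\<close>; the final 1 pays for the failing
  test.\<close>

lemma reaches_While:
  assumes body: "\<And>j s. I j s \<Longrightarrow> bval b s \<Longrightarrow> j < N \<and> reaches t c (I (Suc j)) (\<phi> (Suc j)) s (\<phi> j s)"
    and exit: "\<And>j s. I j s \<Longrightarrow> \<not> bval b s \<Longrightarrow> Q s \<and> \<phi> j s \<le> \<psi> s"
    and "I j s"
  shows "reaches ((N - j) * (t + 2) + 1) (While b c) Q \<psi> s (\<phi> j s)"
  using assms(3)
proof (induction "N - j" arbitrary: j s rule: less_induct)
  case less
  show ?case
  proof (cases "bval b s")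
    case False
    have "reaches (Suc ((N - j) * (t + 2))) (While b c) Q \<psi> s (\<phi> j s)"
      by (rule reaches_step_return[where c' = Skip]) (use exit[OF less(2) False] False in \<open>auto intro: reaches_Skip\<close>)
    then show ?thesis by simp
  next
    case True
    note * = body[OF less(2) True]
    have "reaches (t + 1 + ((N - Suc j) * (t + 2) + 1)) (Seq c (While b c)) Q \<psi> s (\<phi> j s)"
    proof (rule reaches_Seq[OF conjunct2[OF *]])
      fix s' assume "I (Suc j) s'"
      then show "reaches ((N - Suc j) * (t + 2) + 1) (While b c) Q \<psi> s' (\<phi> (Suc j) s')"
        using * by (intro less(1)) auto
    qed
    then have "reaches (Suc (t + 1 + ((N - Suc j) * (t + 2) + 1))) (While b c) Q \<psi> s (\<phi> j s)"
      by (rule reaches_step_return[rotated]) (use True in simp)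
    moreover have "Suc (t + 1 + ((N - Suc j) * (t + 2) + 1)) = (N - j) * (t + 2) + 1"
      using * by (simp add: Suc_diff_Suc[symmetric])
    ultimately show ?thesis by simp
  qed
qed

section \<open>Frames\<close>

primrec nat_mods :: "program \<Rightarrow> nat set" where
  "nat_mods Skip = {}"
| "nat_mods (SetNat a i j e) = {a}"
| "nat_mods (SetReal a i j e) = {}"
| "nat_mods (Flip a i j e) = {a}"
| "nat_mods (Seq c c') = nat_mods c \<union> nat_mods c'"
| "nat_mods (Cond b c c') = nat_mods c \<union> nat_mods c'"
| "nat_mods (While b c) = nat_mods c"

primrec real_mods :: "program \<Rightarrow> nat set" where
  "real_mods Skip = {}"
| "real_mods (SetNat a i j e) = {}"
| "real_mods (SetReal a i j e) = {a}"
| "real_mods (Flip a i j e) = {}"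
| "real_mods (Seq c c') = real_mods c \<union> real_mods c'"
| "real_mods (Cond b c c') = real_mods c \<union> real_mods c'"
| "real_mods (While b c) = real_mods c"

text \<open>Arrays are named by constants of the program text, so the set of written arrays is
  syntactic, and non-interference of program parts is decided by comparing numbers.\<close>

definition framed :: "nat set \<Rightarrow> nat set \<Rightarrow> memory \<Rightarrow> memory \<Rightarrow> bool" where
  "framed A B s s' \<longleftrightarrow> (\<forall>a. a \<notin> A \<longrightarrow> nat_cells s' a = nat_cells s a) \<and>
     (\<forall>a. a \<notin> B \<longrightarrow> real_cells s' a = real_cells s a)"

lemma framed_step:
  "(c', s') \<in> set_pmf (step c s) \<Longrightarrow>
    nat_mods c' \<subseteq> nat_mods c \<and> real_mods c' \<subseteq> real_mods c \<and> framed (nat_mods c) (real_mods c) s s'"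
proof (induction c arbitrary: c' s')
  case (Seq c1 c2)
  then show ?case
    by (auto simp: framed_def split: if_splits) (blast | metis subsetD)+
qed (auto simp: framed_def set_nat_def set_real_def upd_cell_def split: if_splits)

lemma framed_run:
  "(c', s') \<in> set_pmf (run t c s) \<Longrightarrow> framed (nat_mods c) (real_mods c) s s'"
proof (induction t arbitrary: c s)
  case (Suc t)
  then obtain c1 s1 where *: "(c1, s1) \<in> set_pmf (step c s)" "(c', s') \<in> set_pmf (run t c1 s1)" by auto
  then show ?case using framed_step[OF *(1)] Suc.IH[OF *(2)] unfolding framed_def by (metis subsetD)
qed (simp add: framed_def)

lemma reaches_framed:
  assumes "reaches t c Q \<psi> s v"
  shows "reaches t c (\<lambda>s'. Q s' \<and> framed (nat_mods c) (real_mods c) s s') \<psi> s v"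
  using assms framed_run by (fastforce simp: reaches_def)


text \<open>\<open>N\<close> bounds the number of iterations of every loop execution.\<close>

primrec cost :: "nat \<Rightarrow> program \<Rightarrow> nat" where
  "cost N Skip = 0"
| "cost N (SetNat a i j e) = 1"
| "cost N (SetReal a i j e) = 1"
| "cost N (Flip a i j e) = 1"
| "cost N (Seq c c') = cost N c + 1 + cost N c'"
| "cost N (Cond b c c') = 1 + (cost N c + cost N c')"
| "cost N (While b c) = N * (cost N c + 2) + 1"

text \<open>Loops are nested to a fixed depth, so \<open>cost\<close> is a polynomial in the
  iteration bound; charging both branches of a conditional, and not their maximum, keeps it
  one.\<close>

lemma cost_poly: "\<exists>q. \<forall>x. cost (poly p x) c = poly q x"
proof (induction c)
  case (Seq c1 c2)
  then obtain q1 q2 where "\<forall>x. cost (poly p x) c1 = poly q1 x" "\<forall>x. cost (poly p x) c2 = poly q2 x" by blast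
  then show ?case by (intro exI[of _ "q1 + 1 + q2"]) simp
next
  case (Cond b c1 c2)
  then obtain q1 q2 where "\<forall>x. cost (poly p x) c1 = poly q1 x" "\<forall>x. cost (poly p x) c2 = poly q2 x" by blast
  then show ?case by (intro exI[of _ "1 + (q1 + q2)"]) simp
next
  case (While b c)
  then obtain q where "\<forall>x. cost (poly p x) c = poly q x" by blast
  then show ?case by (intro exI[of _ "p * (q + [:2:]) + 1"]) simp
qed (auto intro: exI[of _ "0 :: nat poly"] exI[of _ "1 :: nat poly"])

section \<open>Proof rules with the syntactic time bound\<close>

abbreviation achieves :: "nat \<Rightarrow> program \<Rightarrow> (memory \<Rightarrow> bool) \<Rightarrow> (memory \<Rightarrow> real) \<Rightarrow> memory \<Rightarrow> real \<Rightarrow> bool" where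
  "achieves N c \<equiv> reaches (cost N c) c"

lemma achieves_Skip: "Q s \<Longrightarrow> v \<le> \<psi> s \<Longrightarrow> achieves N Skip Q \<psi> s v"
  by (rule reaches_Skip)

lemma achieves_SetNat:
  "Q (set_nat a i j (nval e s) s) \<Longrightarrow> v \<le> \<psi> (set_nat a i j (nval e s) s) \<Longrightarrow> achieves N (SetNat a i j e) Q \<psi> s v"
  using reaches_SetNat[of Q a i j e s v \<psi> 0] by simp

lemma achieves_SetReal:
  "Q (set_real a i j (rval e s) s) \<Longrightarrow> v \<le> \<psi> (set_real a i j (rval e s) s) \<Longrightarrow> achieves N (SetReal a i j e) Q \<psi> s v"
  using reaches_SetReal[of Q a i j e s v \<psi> 0] by simp

lemma achieves_Flip:
  assumes "0 \<le> rval e s" "rval e s \<le> 1"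
    and "0 < rval e s \<Longrightarrow> Q (set_nat a i j 1 s)" "rval e s < 1 \<Longrightarrow> Q (set_nat a i j 0 s)"
    and "v \<le> rval e s * \<psi> (set_nat a i j 1 s) + (1 - rval e s) * \<psi> (set_nat a i j 0 s)"
  shows "achieves N (Flip a i j e) Q \<psi> s v"
  using reaches_Flip[OF assms, of 0] by simp

lemma achieves_Seq:
  "achieves N c Q \<phi> s v \<Longrightarrow> (\<And>s'. Q s' \<Longrightarrow> achieves N c' Q' \<psi> s' (\<phi> s')) \<Longrightarrow> achieves N (Seq c c') Q' \<psi> s v"
  using reaches_Seq[of "cost N c" c Q \<phi> s v "cost N c'" c' Q' \<psi>] by simp

lemma achieves_Cond:
  assumes "bval b s \<Longrightarrow> achieves N c Q \<psi> s v" "\<not> bval b s \<Longrightarrow> achieves N c' Q \<psi> s v"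
  shows "achieves N (Cond b c c') Q \<psi> s v"
proof -
  have "reaches (Suc (cost N c + cost N c')) (Cond b c c') Q \<psi> s v"
  proof (rule reaches_Cond)
    show "reaches (cost N c + cost N c') c Q \<psi> s v" if "bval b s"
      by (rule reaches_mono_time[OF assms(1)[OF that]]) simp
    show "reaches (cost N c + cost N c') c' Q \<psi> s v" if "\<not> bval b s"
      by (rule reaches_mono_time[OF assms(2)[OF that]]) simp
  qed
  then show ?thesis by simp
qed

lemma achieves_While:
  assumes "\<And>j s. I j s \<Longrightarrow> bval b s \<Longrightarrow> j < N \<and> achieves N c (I (Suc j)) (\<phi> (Suc j)) s (\<phi> j s)"
    and "\<And>j s. I j s \<Longrightarrow> \<not> bval b s \<Longrightarrow> Q s \<and> \<phi> j s \<le> \<psi> s"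
    and "I 0 s" "v \<le> \<phi> 0 s"
  shows "achieves N (While b c) Q \<psi> s v"
proof -
  have *: "reaches (N * (cost N c + 2) + 1) (While b c) Q \<psi> s (\<phi> 0 s)"
    using reaches_While[of I b N "cost N c" c \<phi> Q \<psi> 0 s] assms(1-3) by simp
  show ?thesis unfolding cost.simps by (rule reaches_conseq[OF *]) (use assms(4) in auto)
qed

abbreviation nvar :: "nat \<Rightarrow> nexp" where
  "nvar a \<equiv> NCell a (NConst 0) (NConst 0)"

abbreviation rvar :: "nat \<Rightarrow> rexp" where
  "rvar a \<equiv> RCell a (NConst 0) (NConst 0)"

abbreviation put_nat :: "nat \<Rightarrow> nat \<Rightarrow> memory \<Rightarrow> memory" where
  "put_nat a x s \<equiv> set_nat a (NConst 0) (NConst 0) x s"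

definition For :: "nat \<Rightarrow> nexp \<Rightarrow> program \<Rightarrow> program" where
  "For a bnd c = Seq (SetNat a (NConst 0) (NConst 0) (NConst 0))
     (While (NLess (nvar a) bnd) (Seq c (SetNat a (NConst 0) (NConst 0) (NPlus (nvar a) (NConst 1)))))"

lemma For_mods [simp]:
  "nat_mods (For a bnd c) = insert a (nat_mods c)" "real_mods (For a bnd c) = real_mods c"
  by (auto simp: For_def)

lemma cells_set [simp]:
  "nat_cells (set_nat a i j x s) = upd_cell (nat_cells s) a (nval i s) (nval j s) x"
  "real_cells (set_nat a i j x s) = real_cells s"
  "nat_cells (set_real a i j y s) = nat_cells s"
  "real_cells (set_real a i j y s) = upd_cell (real_cells s) a (nval i s) (nval j s) y"
  by (simp_all add: set_nat_def set_real_def)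

lemma upd_cell_other [simp]: "b \<noteq> a \<Longrightarrow> upd_cell h a i j x b = h b"
  by (simp add: upd_cell_def)

lemma upd_cell_same: "upd_cell h a i j x a p q = (if p = i \<and> q = j then x else h a p q)"
  by (simp add: upd_cell_def)

lemma framed_refl: "framed A B s s"
  by (simp add: framed_def)

lemma framed_trans: "framed A B s s' \<Longrightarrow> framed A' B' s' s'' \<Longrightarrow> A \<subseteq> C \<Longrightarrow> A' \<subseteq> C \<Longrightarrow> B \<subseteq> E \<Longrightarrow> B' \<subseteq> E \<Longrightarrow>
    framed C E s s''"
  unfolding framed_def by (metis subsetD)

lemma framed_put: "framed A B s s' \<Longrightarrow> a \<in> A \<Longrightarrow> framed A B s (put_nat a x s')"
  by (auto simp: framed_def upd_cell_def)

text \<open>The bound is evaluated anew before every round, hence the condition on all memories that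
  agree with \<open>s\<close> outside the written arrays. \<open>I\<close> and \<open>\<phi>\<close>
  receive the round as an argument and ignore the counter cell, so they survive its reset and its
  increments.\<close>

lemma achieves_For:
  assumes a: "a \<notin> nat_mods c"
    and bnd: "\<And>s'. framed (insert a (nat_mods c)) (real_mods c) s s' \<Longrightarrow> nval bnd s' = L" and L: "L \<le> N"
    and indep: "\<And>j x s'. I j (put_nat a x s') = I j s'" "\<And>j x s'. \<phi> j (put_nat a x s') = \<phi> j s'"
    and init: "I 0 s" "v \<le> \<phi> 0 s"
    and body: "\<And>j s'. j < L \<Longrightarrow> framed (insert a (nat_mods c)) (real_mods c) s s' \<Longrightarrow>
      nat_cells s' a 0 0 = j \<Longrightarrow> I j s' \<Longrightarrow> achieves N c (I (Suc j)) (\<phi> (Suc j)) s' (\<phi> j s')"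
    and final: "\<And>s'. framed (insert a (nat_mods c)) (real_mods c) s s' \<Longrightarrow> I L s' \<Longrightarrow> Q s' \<and> \<phi> L s' \<le> \<psi> s'"
  shows "achieves N (For a bnd c) Q \<psi> s v"
  unfolding For_def
proof (rule achieves_Seq[where Q = "\<lambda>s'. s' = put_nat a 0 s" and \<phi> = "\<phi> 0"])
  let ?F = "framed (insert a (nat_mods c)) (real_mods c) s"
  let ?J = "\<lambda>j s'. I j s' \<and> ?F s' \<and> j \<le> L \<and> nat_cells s' a 0 0 = j"
  fix s1 assume s1: "s1 = put_nat a 0 s"
  show "achieves N (While (NLess (nvar a) bnd)
     (Seq c (SetNat a (NConst 0) (NConst 0) (NPlus (nvar a) (NConst 1))))) Q \<psi> s1 (\<phi> 0 s1)"
  proof (rule achieves_While[where I = ?J and \<phi> = \<phi>])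
    fix j s' assume J: "?J j s'" and b: "bval (NLess (nvar a) bnd) s'"
    have jL: "j < L" using J b bnd by simp
    have "achieves N c (\<lambda>s2. I (Suc j) s2 \<and> framed (nat_mods c) (real_mods c) s' s2) (\<phi> (Suc j)) s' (\<phi> j s')"
      using J by (intro reaches_framed body jL) auto
    then have "achieves N (Seq c (SetNat a (NConst 0) (NConst 0) (NPlus (nvar a) (NConst 1)))) (?J (Suc j)) (\<phi> (Suc j)) s' (\<phi> j s')"
    proof (rule achieves_Seq)
      fix s2 assume s2: "I (Suc j) s2 \<and> framed (nat_mods c) (real_mods c) s' s2"
      then have F: "?F s2" using J by (auto intro: framed_trans)
      have "nat_cells s2 a 0 0 = j" using s2 J a by (simp add: framed_def)
      then show "achieves N (SetNat a (NConst 0) (NConst 0) (NPlus (nvar a) (NConst 1))) (?J (Suc j)) (\<phi> (Suc j)) s2 (\<phi> (Suc j) s2)"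
        using s2 F jL by (intro achieves_SetNat) (auto simp: indep upd_cell_same intro: framed_put)
    qed
    then show "j < N \<and> achieves N (Seq c (SetNat a (NConst 0) (NConst 0) (NPlus (nvar a) (NConst 1)))) (?J (Suc j)) (\<phi> (Suc j)) s' (\<phi> j s')"
      using jL L by simp
  next
    fix j s' assume J: "?J j s'" and b: "\<not> bval (NLess (nvar a) bnd) s'"
    then have "j = L" using bnd by simp
    then show "Q s' \<and> \<phi> j s' \<le> \<psi> s'" using J final by simp
  next
    show "?J 0 s1" using init unfolding s1 by (auto simp: indep upd_cell_same intro: framed_put framed_refl)
  qed simp
next
  show "achieves N (SetNat a (NConst 0) (NConst 0) (NConst 0)) (\<lambda>s'. s' = put_nat a 0 s) (\<phi> 0) s v"
    by (rule achieves_SetNat) (use init in \<open>auto simp: indep\<close>)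
qed

section \<open>Certain postconditions and loops that fill arrays\<close>

abbreviation ensures :: "nat \<Rightarrow> program \<Rightarrow> (memory \<Rightarrow> bool) \<Rightarrow> memory \<Rightarrow> bool" where
  "ensures N c Q s \<equiv> achieves N c Q (\<lambda>_. 0) s 0"

lemma ensures_Seq: "ensures N c (\<lambda>s'. ensures N c' Q s') s \<Longrightarrow> ensures N (Seq c c') Q s"
  by (rule achieves_Seq)

lemma ensures_SetNat: "Q (set_nat a i j (nval e s) s) \<Longrightarrow> ensures N (SetNat a i j e) Q s"
  by (rule achieves_SetNat) auto

lemma ensures_SetReal: "Q (set_real a i j (rval e s) s) \<Longrightarrow> ensures N (SetReal a i j e) Q s"
  by (rule achieves_SetReal) auto

lemma ensures_Skip: "Q s \<Longrightarrow> ensures N Skip Q s"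
  by (rule achieves_Skip) auto

lemma ensures_conseq: "ensures N c Q s \<Longrightarrow> (\<And>s'. Q s' \<Longrightarrow> Q' s') \<Longrightarrow> ensures N c Q' s"
  by (erule reaches_conseq) auto

lemma ensures_framed: "ensures N c Q s \<Longrightarrow> (\<And>s'. Q s' \<Longrightarrow> framed (nat_mods c) (real_mods c) s s' \<Longrightarrow> Q' s') \<Longrightarrow> ensures N c Q' s"
  by (drule reaches_framed, erule reaches_conseq) auto

lemma ensures_For:
  assumes "a \<notin> nat_mods c"
    and "\<And>s'. framed (insert a (nat_mods c)) (real_mods c) s s' \<Longrightarrow> nval bnd s' = L" "L \<le> N"
    and "\<And>j x s'. I j (put_nat a x s') = I j s'"
    and "I 0 s"
    and "\<And>j s'. j < L \<Longrightarrow> framed (insert a (nat_mods c)) (real_mods c) s s' \<Longrightarrow>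
      nat_cells s' a 0 0 = j \<Longrightarrow> I j s' \<Longrightarrow> ensures N c (I (Suc j)) s'"
    and "\<And>s'. framed (insert a (nat_mods c)) (real_mods c) s s' \<Longrightarrow> I L s' \<Longrightarrow> Q s'"
  shows "ensures N (For a bnd c) Q s"
  by (rule achieves_For[where I = I and L = L and \<phi> = "\<lambda>_ _. 0"]) (use assms in auto)

lemma ensures_Cond:
  "(bval b s \<Longrightarrow> ensures N c Q s) \<Longrightarrow> (\<not> bval b s \<Longrightarrow> ensures N c' Q s) \<Longrightarrow> ensures N (Cond b c c') Q s"
  by (rule achieves_Cond)

text \<open>The array is described as a whole, outside the filled range too: a body that overwrites
  in place thus learns which cells still hold their old values, and such loops can be
  nested.\<close>

lemma ensures_fill_row:
  assumes b: "b \<notin> nat_mods c"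
    and bnd: "\<And>s'. framed (insert b (nat_mods c)) (real_mods c) s s' \<Longrightarrow> nval bnd s' = L" "L \<le> N"
    and body: "\<And>j s'. j < L \<Longrightarrow> framed (insert b (nat_mods c)) (real_mods c) s s' \<Longrightarrow> nat_cells s' b 0 0 = j \<Longrightarrow>
      real_cells s' arr = (\<lambda>p q. if p = i \<and> q < j then F q else real_cells s arr p q) \<Longrightarrow>
      ensures N c (\<lambda>s''. real_cells s'' arr = upd_cell (real_cells s') arr i j (F j) arr) s'"
  shows "ensures N (For b bnd c)
    (\<lambda>s'. real_cells s' arr = (\<lambda>p q. if p = i \<and> q < L then F q else real_cells s arr p q)) s"
proof (rule ensures_For[where L = L and I = "\<lambda>j s'. real_cells s' arr =
      (\<lambda>p q. if p = i \<and> q < j then F q else real_cells s arr p q)"])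
  fix j s'
  assume *: "j < L" "framed (insert b (nat_mods c)) (real_mods c) s s'" "nat_cells s' b 0 0 = j"
    "real_cells s' arr = (\<lambda>p q. if p = i \<and> q < j then F q else real_cells s arr p q)"
  show "ensures N c (\<lambda>s'. real_cells s' arr = (\<lambda>p q. if p = i \<and> q < Suc j then F q else real_cells s arr p q)) s'"
    by (rule ensures_conseq[OF body[OF *]]) (auto simp: upd_cell_def *(4) fun_eq_iff less_Suc_eq)
qed (use b bnd in auto)

lemma ensures_fill_col:
  assumes b: "b \<notin> nat_mods c"
    and bnd: "\<And>s'. framed (insert b (nat_mods c)) (real_mods c) s s' \<Longrightarrow> nval bnd s' = L" "L \<le> N"
    and body: "\<And>j s'. j < L \<Longrightarrow> framed (insert b (nat_mods c)) (real_mods c) s s' \<Longrightarrow> nat_cells s' b 0 0 = j \<Longrightarrow>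
      real_cells s' arr = (\<lambda>p q. if p < j \<and> q = 0 then F p else real_cells s arr p q) \<Longrightarrow>
      ensures N c (\<lambda>s''. real_cells s'' arr = upd_cell (real_cells s') arr j 0 (F j) arr) s'"
  shows "ensures N (For b bnd c)
    (\<lambda>s'. real_cells s' arr = (\<lambda>p q. if p < L \<and> q = 0 then F p else real_cells s arr p q)) s"
proof (rule ensures_For[where L = L and I = "\<lambda>j s'. real_cells s' arr =
      (\<lambda>p q. if p < j \<and> q = 0 then F p else real_cells s arr p q)"])
  fix j s'
  assume *: "j < L" "framed (insert b (nat_mods c)) (real_mods c) s s'" "nat_cells s' b 0 0 = j"
    "real_cells s' arr = (\<lambda>p q. if p < j \<and> q = 0 then F p else real_cells s arr p q)"
  show "ensures N c (\<lambda>s'. real_cells s' arr = (\<lambda>p q. if p < Suc j \<and> q = 0 then F p else real_cells s arr p q)) s'"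
    by (rule ensures_conseq[OF body[OF *]]) (auto simp: upd_cell_def *(4) fun_eq_iff less_Suc_eq)
qed (use b bnd in auto)

lemma ensures_fill:
  assumes ab: "a \<notin> nat_mods c" "b \<notin> nat_mods c" "a \<noteq> b"
    and bnd1: "\<And>s'. framed ({a, b} \<union> nat_mods c) (real_mods c) s s' \<Longrightarrow> nval bnd1 s' = L1" "L1 \<le> N"
    and bnd2: "\<And>s'. framed ({a, b} \<union> nat_mods c) (real_mods c) s s' \<Longrightarrow> nval bnd2 s' = L2" "L2 \<le> N"
    and body: "\<And>i j s'. i < L1 \<Longrightarrow> j < L2 \<Longrightarrow> framed ({a, b} \<union> nat_mods c) (real_mods c) s s' \<Longrightarrow>
      nat_cells s' a 0 0 = i \<Longrightarrow> nat_cells s' b 0 0 = j \<Longrightarrow>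
      real_cells s' arr = (\<lambda>p q. if p < i \<and> q < L2 \<or> p = i \<and> q < j then F p q else real_cells s arr p q) \<Longrightarrow>
      ensures N c (\<lambda>s''. real_cells s'' arr = upd_cell (real_cells s') arr i j (F i j) arr) s'"
  shows "ensures N (For a bnd1 (For b bnd2 c))
    (\<lambda>s'. real_cells s' arr = (\<lambda>p q. if p < L1 \<and> q < L2 then F p q else real_cells s arr p q)) s"
proof (rule ensures_For[where L = L1 and I = "\<lambda>i s'. real_cells s' arr =
      (\<lambda>p q. if p < i \<and> q < L2 then F p q else real_cells s arr p q)"])
  let ?F = "framed ({a, b} \<union> nat_mods c) (real_mods c)"
  fix i s1
  assume i: "i < L1" and fr: "framed (insert a (nat_mods (For b bnd2 c))) (real_mods (For b bnd2 c)) s s1"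
    and a: "nat_cells s1 a 0 0 = i"
    and arr: "real_cells s1 arr = (\<lambda>p q. if p < i \<and> q < L2 then F p q else real_cells s arr p q)"
  have fr2: "?F s s2" if "framed (insert b (nat_mods c)) (real_mods c) s1 s2" for s2
    using fr that by (auto intro: framed_trans)
  have "ensures N (For b bnd2 c)
      (\<lambda>s'. real_cells s' arr = (\<lambda>p q. if p = i \<and> q < L2 then F i q else real_cells s1 arr p q)) s1"
  proof (rule ensures_fill_row[OF ab(2)])
    fix j s2
    assume j: "j < L2" and fr1: "framed (insert b (nat_mods c)) (real_mods c) s1 s2" and b: "nat_cells s2 b 0 0 = j"
      and arr2: "real_cells s2 arr = (\<lambda>p q. if p = i \<and> q < j then F i q else real_cells s1 arr p q)"
    have "nat_cells s2 a = nat_cells s1 a" using fr1 ab by (simp add: framed_def)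
    then show "ensures N c (\<lambda>s''. real_cells s'' arr = upd_cell (real_cells s2) arr i j (F i j) arr) s2"
      using a b j by (intro body i fr2 fr1) (auto simp: arr2 arr fun_eq_iff)
  qed (use bnd2 fr2 in auto)
  then show "ensures N (For b bnd2 c)
      (\<lambda>s'. real_cells s' arr = (\<lambda>p q. if p < Suc i \<and> q < L2 then F p q else real_cells s arr p q)) s1"
    by (rule ensures_conseq) (auto simp: arr fun_eq_iff less_Suc_eq)
next
  fix s' assume "framed (insert a (nat_mods (For b bnd2 c))) (real_mods (For b bnd2 c)) s s'"
  then have "framed ({a, b} \<union> nat_mods c) (real_mods c) s s'" by (simp add: framed_def)
  then show "nval bnd1 s' = L1" by (rule bnd1)
qed (use ab bnd1 in auto)

lemma ensures_sum:
  assumes bnd: "\<And>s'. framed {a} {acc} s s' \<Longrightarrow> nval bnd s' = L" "L \<le> N"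
    and pos: "\<And>s'. framed {a} {acc} s s' \<Longrightarrow> nval p s' = P \<and> nval q s' = Q"
    and f: "\<And>i s'. i < L \<Longrightarrow> framed {a} {acc} s s' \<Longrightarrow> nat_cells s' a 0 0 = i \<Longrightarrow> rval e s' = f i"
  shows "ensures N (For a bnd (SetReal acc p q (RPlus (RCell acc p q) e)))
    (\<lambda>s'. real_cells s' acc = upd_cell (real_cells s) acc P Q (real_cells s acc P Q + (\<Sum>i<L. f i)) acc) s"
proof (rule ensures_For[where L = L and I = "\<lambda>j s'. real_cells s' acc =
     upd_cell (real_cells s) acc P Q (real_cells s acc P Q + (\<Sum>i<j. f i)) acc"])
  fix j s' assume *: "j < L"
    "framed (insert a (nat_mods (SetReal acc p q (RPlus (RCell acc p q) e)))) (real_mods (SetReal acc p q (RPlus (RCell acc p q) e))) s s'"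
    "nat_cells s' a 0 0 = j"
    and acc: "real_cells s' acc = upd_cell (real_cells s) acc P Q (real_cells s acc P Q + (\<Sum>i<j. f i)) acc"
  then have fr: "framed {a} {acc} s s'" by simp
  show "ensures N (SetReal acc p q (RPlus (RCell acc p q) e)) (\<lambda>s'. real_cells s' acc =
     upd_cell (real_cells s) acc P Q (real_cells s acc P Q + (\<Sum>i<Suc j. f i)) acc) s'"
    by (rule ensures_SetReal) (use pos[OF fr] f[OF *(1) fr *(3)] acc in \<open>auto simp: upd_cell_def fun_eq_iff\<close>)
qed (use bnd in \<open>auto simp: upd_cell_def\<close>)

section \<open>Solving the linear program\<close>

text \<open>
  Registers. Natural-number arrays: 4, 5, 6 and 10 are loop counters; 7 holds a violated or pivot
  constraint, 8 a vertex or the drawn point, 9 a coin. Real arrays: 2 the tableau, 3 the tolerance,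
  4 the slacks at the vertices of the simplex, 5 an accumulator, 6 the contraction factors, 7 the
  slacks at the centroid, 8 the weights of the points, 9 a mean.
\<close>

abbreviation num_points :: nexp where "num_points \<equiv> nvar 0"
abbreviation num_groups :: nexp where "num_groups \<equiv> NCell 0 (NConst 0) (NConst 1)"
abbreviation num_rows :: nexp where "num_rows \<equiv> NPlus (NPlus num_points num_points) num_groups"
abbreviation num_vertices :: nexp where "num_vertices \<equiv> NPlus num_points (NConst 1)"
abbreviation half_guess :: rexp where "half_guess \<equiv> RDiv (rvar 1) (RNat (NConst 2))"

section \<open>Program texts of the solver\<close>

definition tableau_entry :: program where
  "tableau_entry =
     Cond (NLess (nvar 5) num_points)
       (Cond (BAnd (BNot (NLess (nvar 4) (nvar 5))) (BNot (NLess (nvar 5) (nvar 4))))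
          (SetReal 2 (nvar 4) (nvar 5) (RMinus (RNat (NConst 0)) (RNat (NConst 1))))
          (SetReal 2 (nvar 4) (nvar 5) (RNat (NConst 0))))
       (Cond (NLess (nvar 5) (NPlus num_points num_points))
          (Cond (NLess (nvar 4) num_points)
             (Cond (RLess (RCell 0 (nvar 4) (NMinus (nvar 5) num_points)) half_guess)
                (SetReal 2 (nvar 4) (nvar 5) (RNat (NConst 1)))
                (SetReal 2 (nvar 4) (nvar 5) (RNat (NConst 0))))
             (SetReal 2 (nvar 4) (nvar 5) (RMinus (RNat (NConst 0)) (RNat (NConst 1)))))
          (Cond (NLess (nvar 4) num_points)
             (SetReal 2 (nvar 4) (nvar 5) (RMinus (RNat (NConst 0))
                (RNat (NCell 1 (nvar 4) (NMinus (nvar 5) (NPlus num_points num_points))))))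
             (SetReal 2 (nvar 4) (nvar 5)
                (RNat (NCell 2 (NMinus (nvar 5) (NPlus num_points num_points)) (NConst 0))))))"

definition build_tableau :: program where
  "build_tableau = For 4 num_vertices (For 5 num_rows tableau_entry)"

definition set_tolerance :: program where
  "set_tolerance = Seq (SetReal 3 (NConst 0) (NConst 0) (RNat (NConst 1)))
     (For 4 (NPlus num_points (NConst 3))
        (SetReal 3 (NConst 0) (NConst 0) (RDiv (rvar 3) (RNat (NPlus num_points (NConst 2))))))"

definition start_slack :: program where
  "start_slack = Cond (NLess (nvar 4) num_points)
     (SetReal 4 (nvar 4) (nvar 5) (RMinus (RPlus (RTimes (RNat num_vertices) (RCell 2 (nvar 4) (nvar 5)))
         (RCell 2 num_points (nvar 5))) (rvar 3)))
     (SetReal 4 (nvar 4) (nvar 5) (RMinus (RCell 2 num_points (nvar 5)) (rvar 3)))"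

definition start_simplex :: program where
  "start_simplex = For 4 num_vertices (For 5 num_rows start_slack)"

definition sum_slack :: "nexp \<Rightarrow> program" where
  "sum_slack r = Seq (SetReal 5 (NConst 0) (NConst 0) (RNat (NConst 0)))
     (For 4 num_vertices (SetReal 5 (NConst 0) (NConst 0) (RPlus (rvar 5) (RCell 4 (nvar 4) r))))"

text \<open>The sum over the vertices has the sign of the slack at the centroid. The value
  \<open>num_rows\<close> stands for the absence of a violated constraint.\<close>

definition find_violated :: program where
  "find_violated = Seq (SetNat 7 (NConst 0) (NConst 0) num_rows)
     (For 5 num_rows (Seq (sum_slack (nvar 5))
        (Cond (RLess (RNat (NConst 0)) (rvar 5)) (SetNat 7 (NConst 0) (NConst 0) (nvar 5)) Skip)))"

definition find_best_vertex :: program where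
  "find_best_vertex = Seq (SetNat 8 (NConst 0) (NConst 0) (NConst 0))
     (For 4 num_vertices
        (Cond (RLess (RCell 4 (nvar 4) (nvar 7)) (RCell 4 (nvar 8) (nvar 7)))
           (SetNat 8 (NConst 0) (NConst 0) (nvar 4)) Skip))"

text \<open>The contraction overwrites the slacks from which the factors are computed, so the
  factors get an array of their own. The constant fraction is \<sigma>.\<close>

definition set_factors :: program where
  "set_factors = For 4 num_vertices (SetReal 6 (nvar 4) (NConst 0)
     (RDiv (RNat (NConst 1)) (RPlus (RNat (NConst 1))
        (RDiv (RTimes (RDiv (RNat (NConst 1)) (RTimes (RNat (NConst 2)) (RTimes (RNat num_vertices) (RNat num_vertices))))
                 (RMinus (RCell 4 (nvar 4) (nvar 7)) (rvar 9)))
           (RMinus (rvar 9) (RCell 4 (nvar 8) (nvar 7)))))))"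

definition contract :: program where
  "contract = For 4 num_vertices (For 5 num_rows
     (SetReal 4 (nvar 4) (nvar 5) (RPlus (RCell 4 (nvar 8) (nvar 5))
        (RTimes (RCell 6 (nvar 4) (NConst 0)) (RMinus (RCell 4 (nvar 4) (nvar 5)) (RCell 4 (nvar 8) (nvar 5)))))))"

definition shrink_simplex :: program where
  "shrink_simplex = Seq (sum_slack (nvar 7))
     (Seq (SetReal 9 (NConst 0) (NConst 0) (RDiv (rvar 5) (RNat num_vertices)))
     (Seq find_best_vertex (Seq set_factors contract)))"

definition simplex_method :: program where
  "simplex_method = Seq find_violated (While (NLess (nvar 7) num_rows) (Seq shrink_simplex find_violated))"

definition set_centroid :: program where
  "set_centroid = For 5 num_rows (Seq (SetReal 7 (nvar 5) (NConst 0) (RNat (NConst 0)))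
     (For 4 num_vertices (SetReal 7 (nvar 5) (NConst 0)
        (RPlus (RCell 7 (nvar 5) (NConst 0)) (RDiv (RCell 4 (nvar 4) (nvar 5)) (RNat num_vertices))))))"

text \<open>Direction \<open>i\<close> has the entry -1 at the constraint \<open>- x i <= 0\<close>,
  which is therefore an admissible first candidate.\<close>

definition find_pivot :: program where
  "find_pivot = Seq (SetNat 7 (NConst 0) (NConst 0) (nvar 4))
     (For 5 num_rows (Cond (BAnd (RLess (RCell 2 (nvar 4) (nvar 5)) (RNat (NConst 0)))
          (RLess (RDiv (RCell 7 (nvar 5) (NConst 0)) (RCell 2 (nvar 4) (nvar 5)))
             (RDiv (RCell 7 (nvar 7) (NConst 0)) (RCell 2 (nvar 4) (nvar 7)))))
        (SetNat 7 (NConst 0) (NConst 0) (nvar 5)) Skip))"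

text \<open>The ratio is saved beforehand, since the loop overwrites the slack of the pivot
  constraint on which it depends.\<close>

definition move_to_facet :: program where
  "move_to_facet = Seq (SetReal 5 (NConst 0) (NConst 0)
       (RDiv (RCell 7 (nvar 7) (NConst 0)) (RCell 2 (nvar 4) (nvar 7))))
     (For 5 num_rows (SetReal 7 (nvar 5) (NConst 0)
        (RMinus (RCell 7 (nvar 5) (NConst 0)) (RTimes (rvar 5) (RCell 2 (nvar 4) (nvar 5))))))"

definition eliminate :: program where
  "eliminate = For 6 num_vertices (Cond (NLess (nvar 4) (nvar 6))
     (Seq (SetReal 5 (NConst 0) (NConst 0) (RDiv (RCell 2 (nvar 6) (nvar 7)) (RCell 2 (nvar 4) (nvar 7))))
        (For 5 num_rows (SetReal 2 (nvar 6) (nvar 5)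
           (RMinus (RCell 2 (nvar 6) (nvar 5)) (RTimes (rvar 5) (RCell 2 (nvar 4) (nvar 5)))))))
     Skip)"

definition purify :: program where
  "purify = For 4 num_points (Seq find_pivot (Seq move_to_facet eliminate))"

definition solve_lp :: program where
  "solve_lp = Seq build_tableau (Seq set_tolerance (Seq start_simplex (Seq simplex_method (Seq set_centroid purify))))"

text \<open>\<open>near\<close> and \<open>mem\<close> are all that the linear program sees of the
  metric and of the groups. The single number \<open>N\<close> bounds every loop, including those
  over the 2 n + m constraints, the n + 3 divisions for the tolerance and the rounds of
  shrinking.\<close>

locale lp_input =
  fixes N n m :: nat and mem :: "nat \<Rightarrow> nat \<Rightarrow> nat" and demand :: "nat \<Rightarrow> nat" and near :: "nat \<Rightarrow> nat \<Rightarrow> bool"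
  assumes N: "2 * n + m + 3 \<le> N" and rounds: "rounds_bound n \<le> N" and mem_le: "\<And>p i. mem p i \<le> 1"
begin

definition R :: nat where "R = n + n + m"

definition input :: "memory \<Rightarrow> bool" where
  "input s \<longleftrightarrow> nat_cells s 0 0 0 = n \<and> nat_cells s 0 0 (Suc 0) = m \<and> nat_cells s (Suc 0) = mem \<and>
     (\<forall>p. nat_cells s 2 p 0 = demand p) \<and>
     (\<forall>p q. p < n \<longrightarrow> q < n \<longrightarrow> (real_cells s 0 p q < real_cells s (Suc 0) 0 0 / 2) = near p q)"

lemma input_framed:
  "framed A B s s' \<Longrightarrow> 0 \<notin> A \<Longrightarrow> Suc 0 \<notin> A \<Longrightarrow> 2 \<notin> A \<Longrightarrow> 0 \<notin> B \<Longrightarrow> Suc 0 \<notin> B \<Longrightarrow> input s \<Longrightarrow> input s'"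
  unfolding framed_def input_def by simp

text \<open>
  Constraint \<open>r\<close> of the linear program is \<open>(\<Sum>l<n. x l * tab l r) + tab n r \<le> 0\<close>: nonnegativity
  for \<open>r < n\<close>, then the balls, then the demands.
\<close>

definition tab :: "nat \<Rightarrow> nat \<Rightarrow> real" where
  "tab i r =
    (if r < n then if i = r then -1 else 0
     else if r < n + n then if i < n then if near i (r - n) then 1 else 0 else -1
     else if i < n then - real (mem i (r - (n + n))) else real (demand (r - (n + n))))"


section \<open>Correctness of the shrinking phase\<close>

lemma ensures_build_tableau:
  assumes s: "input s"
  shows "ensures N build_tableau (\<lambda>s'. \<forall>i<Suc n. \<forall>r<R. real_cells s' 2 i r = tab i r) s"
proof -
  have mods: "nat_mods tableau_entry = {}" "real_mods tableau_entry = {2}"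
    by (simp_all add: tableau_entry_def)
  have inp: "input s'" if "framed {4, 5} {2} s s'" for s'
    by (rule input_framed[OF that]) (use s in auto)
  have "ensures N build_tableau (\<lambda>s'. real_cells s' 2 =
      (\<lambda>i r. if i < Suc n \<and> r < R then tab i r else real_cells s 2 i r)) s"
    unfolding build_tableau_def
  proof (rule ensures_fill)
    fix i r and s' :: memory
    assume *: "i < Suc n" "r < R" "nat_cells s' 4 0 0 = i" "nat_cells s' 5 0 0 = r"
    assume "framed ({4, 5} \<union> nat_mods tableau_entry) (real_mods tableau_entry) s s'"
    then have "input s'" by (simp add: mods inp)
    then show "ensures N tableau_entry (\<lambda>s''. real_cells s'' 2 = upd_cell (real_cells s') 2 i r (tab i r) 2) s'"
      unfolding tableau_entry_def
      by (intro ensures_Cond ensures_SetReal) (use * in \<open>auto simp: input_def tab_def R_def\<close>)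
  qed (use inp N in \<open>auto simp: mods input_def R_def\<close>)
  then show ?thesis by (rule ensures_conseq) auto
qed

definition \<epsilon> :: real where "\<epsilon> = 1 / (real n + 2) ^ (n + 3)"

lemma ensures_set_tolerance:
  assumes s: "input s"
  shows "ensures N set_tolerance (\<lambda>s'. real_cells s' 3 0 0 = \<epsilon>) s"
  unfolding set_tolerance_def
proof (intro ensures_Seq ensures_SetReal)
  let ?s = "set_real 3 (NConst 0) (NConst 0) (rval (RNat (NConst 1)) s) s"
  have inp: "input s'" if "framed {4} {3} ?s s'" for s'
    by (rule input_framed[OF that]) (use s in \<open>auto simp: input_def\<close>)
  show "ensures N (For 4 (NPlus num_points (NConst 3))
     (SetReal 3 (NConst 0) (NConst 0) (RDiv (rvar 3) (RNat (NPlus num_points (NConst 2))))))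
     (\<lambda>s'. real_cells s' 3 0 0 = \<epsilon>) ?s"
  proof (rule ensures_For[where L = "n + 3" and I = "\<lambda>j s'. real_cells s' 3 0 0 = 1 / (real n + 2) ^ j"])
    fix j and s' :: memory
    assume "framed (insert 4 (nat_mods (SetReal 3 (NConst 0) (NConst 0) (RDiv (rvar 3) (RNat (NPlus num_points (NConst 2)))))))
       (real_mods (SetReal 3 (NConst 0) (NConst 0) (RDiv (rvar 3) (RNat (NPlus num_points (NConst 2)))))) ?s s'"
      and j: "real_cells s' 3 0 0 = 1 / (real n + 2) ^ j"
    then have "input s'" by (simp add: inp)
    then show "ensures N (SetReal 3 (NConst 0) (NConst 0) (RDiv (rvar 3) (RNat (NPlus num_points (NConst 2)))))
        (\<lambda>s'. real_cells s' 3 0 0 = 1 / (real n + 2) ^ Suc j) s'"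
      using j by (intro ensures_SetReal) (auto simp: upd_cell_def input_def mult.commute)
  qed (use inp N in \<open>auto simp: input_def upd_cell_def \<epsilon>_def\<close>)
qed

definition start_value :: "nat \<Rightarrow> nat \<Rightarrow> real" where
  "start_value i r = (if i < n then (real n + 1) * tab i r + tab n r - \<epsilon> else tab n r - \<epsilon>)"

lemma ensures_start_simplex:
  assumes s: "input s" and tab: "\<forall>i<Suc n. \<forall>r<R. real_cells s 2 i r = tab i r" and eps: "real_cells s 3 0 0 = \<epsilon>"
  shows "ensures N start_simplex (\<lambda>s'. \<forall>i<Suc n. \<forall>r<R. real_cells s' 4 i r = start_value i r) s"
proof -
  have mods: "nat_mods start_slack = {}" "real_mods start_slack = {4}"
    by (simp_all add: start_slack_def)
  have inp: "input s'" if "framed {4, 5} {4} s s'" for s'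
    by (rule input_framed[OF that]) (use s in auto)
  have "ensures N start_simplex (\<lambda>s'. real_cells s' 4 =
      (\<lambda>i r. if i < Suc n \<and> r < R then start_value i r else real_cells s 4 i r)) s"
    unfolding start_simplex_def
  proof (rule ensures_fill)
    fix i r and s' :: memory
    assume *: "i < Suc n" "r < R" "nat_cells s' 4 0 0 = i" "nat_cells s' 5 0 0 = r"
    assume fr: "framed ({4, 5} \<union> nat_mods start_slack) (real_mods start_slack) s s'"
    then have "input s'" by (simp add: mods inp)
    moreover have "real_cells s' 2 = real_cells s 2" "real_cells s' 3 = real_cells s 3"
      using fr by (simp_all add: framed_def mods)
    ultimately show "ensures N start_slack (\<lambda>s''. real_cells s'' 4 = upd_cell (real_cells s') 4 i r (start_value i r) 4) s'"
      unfolding start_slack_def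
      by (intro ensures_Cond ensures_SetReal) (use * tab eps in \<open>auto simp: input_def start_value_def R_def less_Suc_eq add.commute\<close>)
  qed (use inp N in \<open>auto simp: mods input_def R_def\<close>)
  then show ?thesis by (rule ensures_conseq) auto
qed

lemma ensures_sum_slack:
  assumes s: "input s" and r: "\<And>s'. framed {4} {5} s s' \<Longrightarrow> nval r s' = v"
  shows "ensures N (sum_slack r) (\<lambda>s'. real_cells s' 5 0 0 = (\<Sum>i<Suc n. real_cells s 4 i v)) s"
  unfolding sum_slack_def
proof (intro ensures_Seq ensures_SetReal)
  let ?s = "set_real 5 (NConst 0) (NConst 0) (rval (RNat (NConst 0)) s) s"
  have fr: "framed {4} {5} s s'" if "framed {4} {5} ?s s'" for s'
    using that by (auto simp: framed_def)
  have inp: "input s'" if "framed {4} {5} ?s s'" for s'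
    by (rule input_framed[OF fr[OF that]]) (use s in \<open>auto simp: input_def\<close>)
  show "ensures N (For 4 num_vertices (SetReal 5 (NConst 0) (NConst 0) (RPlus (rvar 5) (RCell 4 (nvar 4) r))))
     (\<lambda>s'. real_cells s' 5 0 0 = (\<Sum>i<Suc n. real_cells s 4 i v)) ?s"
  proof (rule ensures_conseq, rule ensures_sum[where L = "Suc n" and P = 0 and Q = 0 and f = "\<lambda>i. real_cells s 4 i v"])
    fix i s' assume "framed {4} {5} ?s s'" "nat_cells s' 4 0 0 = i"
    then show "rval (RCell 4 (nvar 4) r) s' = real_cells s 4 i v"
      using r[OF fr] by (auto simp: framed_def)
  qed (use inp N in \<open>auto simp: input_def upd_cell_def\<close>)
qed

lemma ensures_find_violated:
  assumes s: "input s"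
  shows "ensures N find_violated (\<lambda>s'. 
     nat_cells s' 7 0 0 = R \<and> (\<forall>r<R. (\<Sum>i<Suc n. real_cells s 4 i r) \<le> 0) \<or>
     nat_cells s' 7 0 0 < R \<and> (\<Sum>i<Suc n. real_cells s 4 i (nat_cells s' 7 0 0)) > 0) s"
  unfolding find_violated_def
proof (intro ensures_Seq ensures_SetNat)
  let ?c = "Seq (sum_slack (nvar 5))
        (Cond (RLess (RNat (NConst 0)) (rvar 5)) (SetNat 7 (NConst 0) (NConst 0) (nvar 5)) Skip)"
  let ?s = "set_nat 7 (NConst 0) (NConst 0) (nval num_rows s) s"
  let ?S = "\<lambda>r. \<Sum>i<Suc n. real_cells s 4 i r"
  have mods: "nat_mods ?c = {4, 7}" "real_mods ?c = {5}" by (auto simp: sum_slack_def)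
  have fr: "framed {4, 5, 7} {5} s s'" if "framed {5, 4, 7} {5} ?s s'" for s'
    using that by (auto simp: framed_def)
  have inp: "input s'" if "framed {5, 4, 7} {5} ?s s'" for s'
    by (rule input_framed[OF fr[OF that]]) (use s in \<open>auto simp: input_def\<close>)
  show "ensures N (For 5 num_rows ?c) (\<lambda>s'. 
     nat_cells s' 7 0 0 = R \<and> (\<forall>r<R. ?S r \<le> 0) \<or> nat_cells s' 7 0 0 < R \<and> ?S (nat_cells s' 7 0 0) > 0) ?s"
  proof (rule ensures_For[where L = R and I = "\<lambda>j s'. nat_cells s' 7 0 0 = R \<and> (\<forall>r<j. ?S r \<le> 0) \<or>
      nat_cells s' 7 0 0 < R \<and> ?S (nat_cells s' 7 0 0) > 0"])
    fix j and s' :: memory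
    assume j: "j < R" "framed (insert 5 (nat_mods ?c)) (real_mods ?c) ?s s'" "nat_cells s' 5 0 0 = j"
     "nat_cells s' 7 0 0 = R \<and> (\<forall>r<j. ?S r \<le> 0) \<or> nat_cells s' 7 0 0 < R \<and> ?S (nat_cells s' 7 0 0) > 0"
    have s': "input s'" and fr': "framed {4, 5, 7} {5} s s'" using inp fr j(2) unfolding mods by auto
    have "ensures N (sum_slack (nvar 5)) (\<lambda>s''. real_cells s'' 5 0 0 = (\<Sum>i<Suc n. real_cells s' 4 i j)) s'"
      by (rule ensures_sum_slack[OF s']) (use j(3) in \<open>auto simp: framed_def\<close>)
    then show "ensures N ?c (\<lambda>s'. nat_cells s' 7 0 0 = R \<and> (\<forall>r<Suc j. ?S r \<le> 0) \<or>
         nat_cells s' 7 0 0 < R \<and> ?S (nat_cells s' 7 0 0) > 0) s'"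
    proof (intro ensures_Seq, elim ensures_framed)
      fix s2 :: memory assume s2: "real_cells s2 5 0 0 = (\<Sum>i<Suc n. real_cells s' 4 i j)"
        and "framed (nat_mods (sum_slack (nvar 5))) (real_mods (sum_slack (nvar 5))) s' s2"
      then have "framed {4} {5} s' s2" by (simp add: sum_slack_def)
      then have *: "nat_cells s2 5 0 0 = j" "nat_cells s2 7 0 0 = nat_cells s' 7 0 0" "real_cells s' 4 = real_cells s 4"
        using j(3) fr' by (simp_all add: framed_def)
      show "ensures N (Cond (RLess (RNat (NConst 0)) (rvar 5)) (SetNat 7 (NConst 0) (NConst 0) (nvar 5)) Skip)
         (\<lambda>s'. nat_cells s' 7 0 0 = R \<and> (\<forall>r<Suc j. ?S r \<le> 0) \<or>
         nat_cells s' 7 0 0 < R \<and> ?S (nat_cells s' 7 0 0) > 0) s2"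
        by (intro ensures_Cond ensures_SetNat ensures_Skip)
          (use j(1,4) s2 * in \<open>auto simp: upd_cell_def less_Suc_eq simp del: sum.lessThan_Suc\<close>)
    qed
  next
    fix s' assume "framed (insert 5 (nat_mods ?c)) (real_mods ?c) ?s s'"
    then have "input s'" using inp unfolding mods by simp
    then show "nval num_rows s' = R" by (simp add: input_def R_def)
  next
    show "5 \<notin> nat_mods ?c" unfolding mods by simp
  qed (use s N in \<open>auto simp: input_def upd_cell_def R_def simp del: sum.lessThan_Suc\<close>)
qed



definition \<sigma> :: real where "\<sigma> = 1 / (2 * (real n + 1)\<^sup>2)"

lemma ensures_find_best_vertex:
  assumes s: "input s"
  shows "ensures N find_best_vertex (\<lambda>s'. nat_cells s' 8 0 0 < Suc n \<and>
    (\<forall>i<Suc n. real_cells s 4 (nat_cells s' 8 0 0) (nat_cells s 7 0 0) \<le> real_cells s 4 i (nat_cells s 7 0 0))) s"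
  unfolding find_best_vertex_def
proof (intro ensures_Seq ensures_SetNat)
  let ?c = "Cond (RLess (RCell 4 (nvar 4) (nvar 7)) (RCell 4 (nvar 8) (nvar 7)))
           (SetNat 8 (NConst 0) (NConst 0) (nvar 4)) Skip"
  let ?s = "set_nat 8 (NConst 0) (NConst 0) (nval (NConst 0) s) s"
  let ?v = "nat_cells s 7 0 0"
  have fr: "framed {4, 8} {} s s'" if "framed {4, 8} {} ?s s'" for s'
    using that by (auto simp: framed_def)
  have inp: "input s'" if "framed {4, 8} {} ?s s'" for s'
    by (rule input_framed[OF fr[OF that]]) (use s in \<open>auto simp: input_def\<close>)
  show "ensures N (For 4 num_vertices ?c) (\<lambda>s'. nat_cells s' 8 0 0 < Suc n \<and>
    (\<forall>i<Suc n. real_cells s 4 (nat_cells s' 8 0 0) ?v \<le> real_cells s 4 i ?v)) ?s"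
  proof (rule ensures_For[where L = "Suc n" and I = "\<lambda>j s'. nat_cells s' 8 0 0 < Suc n \<and>
    (\<forall>i<j. real_cells s 4 (nat_cells s' 8 0 0) ?v \<le> real_cells s 4 i ?v)"])
    fix j and s' :: memory
    assume j: "j < Suc n" "nat_cells s' 4 0 0 = j" "nat_cells s' 8 0 0 < Suc n \<and>
      (\<forall>i<j. real_cells s 4 (nat_cells s' 8 0 0) ?v \<le> real_cells s 4 i ?v)"
      and "framed (insert 4 (nat_mods ?c)) (real_mods ?c) ?s s'"
    then have "framed {4, 8} {} s s'" using fr by simp
    then have *: "real_cells s' 4 = real_cells s 4" "nat_cells s' 7 = nat_cells s 7" by (simp_all add: framed_def)
    have new: "real_cells s 4 j ?v \<le> real_cells s 4 i ?v"
      if "i < Suc j" "real_cells s 4 j ?v < real_cells s 4 (nat_cells s' 8 0 0) ?v" for i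
    proof (cases "i = j")
      case False
      then have "real_cells s 4 (nat_cells s' 8 0 0) ?v \<le> real_cells s 4 i ?v" using j(3) that(1) by simp
      with that(2) show ?thesis by linarith
    qed simp
    show "ensures N ?c (\<lambda>s'. nat_cells s' 8 0 0 < Suc n \<and>
      (\<forall>i<Suc j. real_cells s 4 (nat_cells s' 8 0 0) ?v \<le> real_cells s 4 i ?v)) s'"
      by (intro ensures_Cond ensures_SetNat ensures_Skip)
        (use j new in \<open>simp_all add: upd_cell_same less_Suc_eq * not_less\<close>)
  qed (use inp N in \<open>auto simp: input_def upd_cell_def\<close>)
qed

lemma ensures_set_factors:
  assumes s: "input s"
  defines "v \<equiv> nat_cells s 7 0 0" and "k \<equiv> nat_cells s 8 0 0" and "\<mu> \<equiv> real_cells s 9 0 0"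
  shows "ensures N set_factors (\<lambda>s'. \<forall>i<Suc n. real_cells s' 6 i 0 =
    1 / (1 + \<sigma> * (real_cells s 4 i v - \<mu>) / (\<mu> - real_cells s 4 k v))) s"
proof -
  have inp: "input s'" if "framed {4} {6} s s'" for s'
    by (rule input_framed[OF that]) (use s in auto)
  have "ensures N set_factors (\<lambda>s'. real_cells s' 6 = (\<lambda>p q. if p < Suc n \<and> q = 0 then
    1 / (1 + \<sigma> * (real_cells s 4 p v - \<mu>) / (\<mu> - real_cells s 4 k v)) else real_cells s 6 p q)) s"
    unfolding set_factors_def
  proof (rule ensures_fill_col, goal_cases)
    case (4 j s')
    then have fr: "framed {4} {6} s s'" by simp
    then have *: "real_cells s' 4 = real_cells s 4" "real_cells s' 9 = real_cells s 9"
       "nat_cells s' 7 = nat_cells s 7"  "nat_cells s' 8 = nat_cells s 8"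
      by (simp_all add: framed_def)
    show ?case
      by (rule ensures_SetReal)
        (use 4 inp[OF fr] in \<open>auto simp: input_def \<sigma>_def v_def k_def \<mu>_def * power2_eq_square add.commute\<close>)
  qed (use inp N in \<open>auto simp: input_def\<close>)
  then show ?thesis by (rule ensures_conseq) auto
qed

lemma ensures_contract:
  assumes s: "input s" and k: "nat_cells s 8 0 0 < Suc n"
  defines "Y \<equiv> real_cells s 4" and "k \<equiv> nat_cells s 8 0 0"
  shows "ensures N contract (\<lambda>s'. \<forall>i<Suc n. \<forall>r<R. real_cells s' 4 i r =
    Y k r + real_cells s 6 i 0 * (Y i r - Y k r)) s"
proof -
  have inp: "input s'" if "framed {4, 5} {4} s s'" for s'
    by (rule input_framed[OF that]) (use s in auto)
  have "ensures N contract (\<lambda>s'. real_cells s' 4 = (\<lambda>i r. if i < Suc n \<and> r < R then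
    Y k r + real_cells s 6 i 0 * (Y i r - Y k r) else real_cells s 4 i r)) s"
    unfolding contract_def
  proof (rule ensures_fill, goal_cases)
    case (8 i r s')
    then have fr: "framed {4, 5} {4} s s'" by simp
    then have *: "real_cells s' 6 = real_cells s 6" "nat_cells s' 8 = nat_cells s 8"
      by (simp_all add: framed_def)
    \<comment> \<open>Overwriting in place is harmless, because vertex \<open>k\<close> is mapped to
      itself.\<close>
    have "real_cells s' 4 k r = Y k r" "real_cells s' 4 i r = Y i r"
      using 8 by (simp_all add: Y_def)
    then show ?case
      by (intro ensures_SetReal) (use 8 in \<open>simp add: * k_def[symmetric]\<close>)
  qed (use inp N in \<open>auto simp: input_def R_def\<close>)
  then show ?thesis by (rule ensures_conseq) auto
qed

definition shrunk :: "nat \<Rightarrow> (nat \<Rightarrow> nat \<Rightarrow> real) \<Rightarrow> (nat \<Rightarrow> nat \<Rightarrow> real) \<Rightarrow> bool" where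
  "shrunk v Y Y' \<longleftrightarrow> (\<exists>k \<mu>. k < Suc n \<and> (\<forall>i<Suc n. Y k v \<le> Y i v) \<and> \<mu> = (\<Sum>i<Suc n. Y i v) / (real n + 1) \<and>
     (\<forall>i<Suc n. \<forall>r<R. Y' i r = Y k r + 1 / (1 + \<sigma> * (Y i v - \<mu>) / (\<mu> - Y k v)) * (Y i r - Y k r)))"

lemma ensures_shrink_simplex:
  assumes s: "input s"
  shows "ensures N shrink_simplex (\<lambda>s'. shrunk (nat_cells s 7 0 0) (real_cells s 4) (real_cells s' 4)) s"
  unfolding shrink_simplex_def
proof (rule ensures_Seq)
  let ?v = "nat_cells s 7 0 0"
  let ?\<mu> = "(\<Sum>i<Suc n. real_cells s 4 i ?v) / (real n + 1)"
  let ?Q = "\<lambda>s'. shrunk ?v (real_cells s 4) (real_cells s' 4)"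
  have "ensures N (sum_slack (nvar 7)) (\<lambda>s'. real_cells s' 5 0 0 = (\<Sum>i<Suc n. real_cells s 4 i ?v)) s"
    by (rule ensures_sum_slack[OF s]) (simp add: framed_def)
  then show "ensures N (sum_slack (nvar 7)) (\<lambda>s1. ensures N (Seq (SetReal 9 (NConst 0) (NConst 0)
     (RDiv (rvar 5) (RNat num_vertices))) (Seq find_best_vertex (Seq set_factors contract))) ?Q s1) s"
  proof (elim ensures_framed, intro ensures_Seq ensures_SetReal)
    fix s1 :: memory
    assume sum: "real_cells s1 5 0 0 = (\<Sum>i<Suc n. real_cells s 4 i ?v)"
      and "framed (nat_mods (sum_slack (nvar 7))) (real_mods (sum_slack (nvar 7))) s s1"
    then have fr1: "framed {4} {5} s s1" by (simp add: sum_slack_def)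
    let ?s2 = "set_real 9 (NConst 0) (NConst 0) (rval (RDiv (rvar 5) (RNat num_vertices)) s1) s1"
    have i1: "input s1" by (rule input_framed[OF fr1]) (use s in auto)
    have fr2: "framed {4} {5, 9} s ?s2" using fr1 by (auto simp: framed_def)
    have i2: "input ?s2" by (rule input_framed[OF fr2]) (use s in auto)
    have \<mu>: "real_cells ?s2 9 0 0 = ?\<mu>"
      using i1 sum by (simp add: upd_cell_def input_def add.commute)
    show "ensures N find_best_vertex (\<lambda>s3. ensures N (Seq set_factors contract) ?Q s3) ?s2"
      using ensures_find_best_vertex[OF i2]
    proof (elim ensures_framed)
      fix s3 :: memory
      let ?k = "nat_cells s3 8 0 0"
      assume k: "?k < Suc n \<and> (\<forall>i<Suc n. real_cells ?s2 4 ?k (nat_cells ?s2 7 0 0) \<le> real_cells ?s2 4 i (nat_cells ?s2 7 0 0))"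
        and "framed (nat_mods find_best_vertex) (real_mods find_best_vertex) ?s2 s3"
      then have "framed {4, 8} {} ?s2 s3" by (simp add: find_best_vertex_def insert_commute)
      then have fr3: "framed {4, 8} {5, 9} s s3" and \<mu>3: "real_cells s3 9 0 0 = ?\<mu>" using fr2 \<mu> by (auto simp: framed_def)
      have i3: "input s3" by (rule input_framed[OF fr3]) (use s in auto)
      have k': "real_cells s 4 ?k ?v \<le> real_cells s 4 i ?v" if "i < Suc n" for i
        using k that fr2 by (simp add: framed_def)
      have eq3: "real_cells s3 4 = real_cells s 4" "nat_cells s3 7 = nat_cells s 7"
        using fr3 by (simp_all add: framed_def)
      show "ensures N (Seq set_factors contract) ?Q s3"
      proof (rule ensures_Seq)
        show "ensures N set_factors (\<lambda>s4. ensures N contract ?Q s4) s3"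
          using ensures_set_factors[OF i3, unfolded \<mu>3 eq3]
        proof (elim ensures_framed)
          fix s4 :: memory
          assume t: "\<forall>i<Suc n. real_cells s4 6 i 0 =
              1 / (1 + \<sigma> * (real_cells s 4 i ?v - ?\<mu>) / (?\<mu> - real_cells s 4 ?k ?v))"
            and "framed (nat_mods set_factors) (real_mods set_factors) s3 s4"
          then have fr: "framed {4} {6} s3 s4" by (simp add: set_factors_def)
          have i4: "input s4" by (rule input_framed[OF fr]) (use i3 in auto)
          have eq4: "real_cells s4 4 = real_cells s 4" "nat_cells s4 8 = nat_cells s3 8"
            using fr eq3 by (simp_all add: framed_def)
          have k4: "nat_cells s4 8 0 0 < Suc n" using k eq4 by simp
          show "ensures N contract ?Q s4"
            using ensures_contract[OF i4 k4, unfolded eq4]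
          proof (elim ensures_conseq)
            fix s' :: memory
            assume *: "\<forall>i<Suc n. \<forall>r<R. real_cells s' 4 i r =
               real_cells s 4 ?k r + real_cells s4 6 i 0 * (real_cells s 4 i r - real_cells s 4 ?k r)"
            show "?Q s'"
              unfolding shrunk_def
              by (intro exI[of _ ?k] exI[of _ ?\<mu>] conjI refl) (use k k' * t in auto)
          qed
        qed
      qed
    qed
  qed
qed

text \<open>The points behind the slack vectors exist only in the proof; the program handles slacks
  alone.\<close>

definition affine_rows :: "(nat \<Rightarrow> nat \<Rightarrow> real) \<Rightarrow> bool" where
  "affine_rows Y \<longleftrightarrow> (\<exists>p. \<forall>i<Suc n. \<forall>r<R. Y i r = (\<Sum>l<n. p i l * tab l r) + tab n r - \<epsilon>)"

lemma affine_rows_shrunk: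
  assumes "affine_rows Y" "shrunk v Y Y'" shows "affine_rows Y'"
proof -
  obtain p where p: "\<And>i r. i < Suc n \<Longrightarrow> r < R \<Longrightarrow> Y i r = (\<Sum>l<n. p i l * tab l r) + tab n r - \<epsilon>"
    using assms(1) unfolding affine_rows_def by blast
  obtain k \<mu> where k: "k < Suc n" and "\<forall>i<Suc n. Y k v \<le> Y i v" "\<mu> = (\<Sum>i<Suc n. Y i v) / (real n + 1)"
    and *: "\<forall>i<Suc n. \<forall>r<R. Y' i r = Y k r + 1 / (1 + \<sigma> * (Y i v - \<mu>) / (\<mu> - Y k v)) * (Y i r - Y k r)"
    using assms(2) unfolding shrunk_def by - (elim exE conjE, rule that)
  define t where "t i = 1 / (1 + \<sigma> * (Y i v - \<mu>) / (\<mu> - Y k v))" for i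
  have Y': "Y' i r = Y k r + t i * (Y i r - Y k r)" if "i < Suc n" "r < R" for i r
    using * that unfolding t_def by blast
  show ?thesis unfolding affine_rows_def
  proof (intro exI allI impI)
    fix i r assume i: "i < Suc n" and r: "r < R"
    show "Y' i r = (\<Sum>l<n. (p k l + t i * (p i l - p k l)) * tab l r) + tab n r - \<epsilon>"
      unfolding Y'[OF i r] p[OF i r] p[OF k r]
      by (simp add: algebra_simps sum.distrib sum_distrib_left sum_subtractf)
  qed
qed

lemma affine_rows_start:
  assumes "\<forall>i<Suc n. \<forall>r<R. Y i r = start_value i r" shows "affine_rows Y"
  unfolding affine_rows_def
proof (intro exI allI impI)
  fix i r assume i: "i < Suc n" and r: "r < R"
  have "(\<Sum>l<n. (if l = i then real n + 1 else 0) * tab l r) = (\<Sum>l<n. if l = i then (real n + 1) * tab i r else 0)"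
    by (intro sum.cong) auto
  then show "Y i r = (\<Sum>l<n. (if l = i then real n + 1 else 0) * tab l r) + tab n r - \<epsilon>"
    using assms i r by (auto simp: start_value_def)
qed

text \<open>The program does not count its rounds. They are limited by the invariant
  \<open>covers\<close>, whose constant is multiplied by 1 + \<sigma> / 2 in every round and cannot
  exceed 1.\<close>

lemma ensures_simplex_method:
  assumes s: "input s" and start: "affine_rows (real_cells s 4)"
    and cov: "covers (Suc n) R T (real_cells s 4) ((\<epsilon> / (real n + 1)) ^ n)"
    and T: "\<And>j r. j < Suc n \<Longrightarrow> r < R \<Longrightarrow> T j r \<le> 0"
  shows "ensures N simplex_method (\<lambda>s'. affine_rows (real_cells s' 4) \<and>
    (\<forall>r<R. (\<Sum>i<Suc n. real_cells s' 4 i r) \<le> 0)) s"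
proof -
  let ?c = "(\<epsilon> / (real n + 1)) ^ n"
  define V where "V s' \<longleftrightarrow> nat_cells s' 7 0 0 = R \<and> (\<forall>r<R. (\<Sum>i<Suc n. real_cells s' 4 i r) \<le> 0) \<or>
     nat_cells s' 7 0 0 < R \<and> (\<Sum>i<Suc n. real_cells s' 4 i (nat_cells s' 7 0 0)) > 0" for s' :: memory
  define I where "I j s' \<longleftrightarrow> input s' \<and> V s' \<and> affine_rows (real_cells s' 4) \<and>
    covers (Suc n) R T (real_cells s' 4) ((1 + \<sigma> / 2) ^ j * ?c)" for j and s' :: memory
  have c0: "0 \<le> (1 + \<sigma> / 2) ^ j * ?c" for j by (simp add: \<sigma>_def \<epsilon>_def)
  have find: "ensures N find_violated (I j) s'"
    if i: "input s'" and aff: "affine_rows (real_cells s' 4)"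
    and cov: "covers (Suc n) R T (real_cells s' 4) ((1 + \<sigma> / 2) ^ j * ?c)" for j s'
    using ensures_find_violated[OF i]
  proof (elim ensures_framed)
    fix s2 :: memory
    assume *: "nat_cells s2 7 0 0 = R \<and> (\<forall>r<R. (\<Sum>i<Suc n. real_cells s' 4 i r) \<le> 0) \<or>
     nat_cells s2 7 0 0 < R \<and> (\<Sum>i<Suc n. real_cells s' 4 i (nat_cells s2 7 0 0)) > 0"
      and "framed (nat_mods find_violated) (real_mods find_violated) s' s2"
    then have fr: "framed {4, 5, 7} {5} s' s2" by (simp add: find_violated_def sum_slack_def insert_commute)
    have "input s2" by (rule input_framed[OF fr]) (use i in auto)
    moreover have "real_cells s2 4 = real_cells s' 4" using fr by (simp add: framed_def)
    ultimately show "I j s2" using * aff cov unfolding I_def V_def by simp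
  qed
  show ?thesis unfolding simplex_method_def
  proof (rule ensures_Seq, rule ensures_conseq[OF find[where j = 0]])
    fix s1 assume "I 0 s1"
    then show "ensures N (While (NLess (nvar 7) num_rows) (Seq shrink_simplex find_violated))
      (\<lambda>s'. affine_rows (real_cells s' 4) \<and> (\<forall>r<R. (\<Sum>i<Suc n. real_cells s' 4 i r) \<le> 0)) s1"
    proof (rule achieves_While[where I = I and \<phi> = "\<lambda>_ _. 0", rotated 2])
      fix j s2 assume I: "I j s2" and b: "bval (NLess (nvar 7) num_rows) s2"
      have i: "input s2" using I by (simp add: I_def)
      have v: "nat_cells s2 7 0 0 < R" using b i by (simp add: input_def R_def)
      then have pos: "(\<Sum>i<Suc n. real_cells s2 4 i (nat_cells s2 7 0 0)) > 0"
        using I unfolding I_def V_def by (simp del: sum.lessThan_Suc)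
      have "(1 + \<sigma> / 2) ^ j * ?c \<le> 1" using I unfolding I_def by (blast dest: covers_le_1)
      then have "j < rounds_bound n" by (rule rounds_bound[OF \<epsilon>_def \<sigma>_def])
      then have "j < N" using rounds by simp
      moreover have "ensures N (Seq shrink_simplex find_violated) (I (Suc j)) s2"
      proof (rule ensures_Seq, rule ensures_framed[OF ensures_shrink_simplex[OF i]])
        fix s3 :: memory
        assume sh: "shrunk (nat_cells s2 7 0 0) (real_cells s2 4) (real_cells s3 4)"
          and fr: "framed (nat_mods shrink_simplex) (real_mods shrink_simplex) s2 s3"
        have "input s3"
          by (rule input_framed[OF fr]) (use i in \<open>auto simp: shrink_simplex_def sum_slack_def find_best_vertex_def
            set_factors_def contract_def\<close>)
        moreover have "covers (Suc n) R T (real_cells s3 4) ((1 + \<sigma> / 2) * ((1 + \<sigma> / 2) ^ j * ?c))"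
        proof -
          let ?v = "nat_cells s2 7 0 0" and ?Y = "real_cells s2 4"
          obtain k \<mu> where *: "k < Suc n" "\<forall>i<Suc n. ?Y k ?v \<le> ?Y i ?v"
            "\<mu> = (\<Sum>i<Suc n. ?Y i ?v) / (real n + 1)"
            "\<forall>i<Suc n. \<forall>r<R. real_cells s3 4 i r = ?Y k r +
               1 / (1 + \<sigma> * (?Y i ?v - \<mu>) / (\<mu> - ?Y k ?v)) * (?Y i r - ?Y k r)"
            using sh unfolding shrunk_def by - (elim exE conjE, rule that)
          have "covers (Suc n) R T ?Y ((1 + \<sigma> / 2) ^ j * ?c)" using I unfolding I_def by simp
          then show ?thesis
          proof (rule covers_shrink[where Y = ?Y and v = ?v and k = k and \<mu> = \<mu> and \<sigma> = \<sigma>])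
            show "T j ?v \<le> 0" if "j < Suc n" for j using T[OF that v] .
            show "?Y k ?v \<le> ?Y i ?v" if "i < Suc n" for i using *(2) that by blast
            show "real_cells s3 4 i r = ?Y k r + 1 / (1 + \<sigma> * (?Y i ?v - \<mu>) / (\<mu> - ?Y k ?v)) * (?Y i r - ?Y k r)"
              if "i < Suc n" "r < R" for i r using *(4) that by blast
          qed (fact c0 v pos *(1) *(3) \<sigma>_def)+
        qed
        moreover have "affine_rows (real_cells s3 4)"
          using I sh unfolding I_def by (blast intro: affine_rows_shrunk)
        ultimately show "ensures N find_violated (I (Suc j)) s3" by (intro find) (auto simp: mult.assoc)
      qed
      ultimately show "j < N \<and> ensures N (Seq shrink_simplex find_violated) (I (Suc j)) s2" by simp
    next
      fix j s2 assume I: "I j s2" and b: "\<not> bval (NLess (nvar 7) num_rows) s2"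
      then show "(affine_rows (real_cells s2 4) \<and> (\<forall>r<R. (\<Sum>i<Suc n. real_cells s2 4 i r) \<le> 0)) \<and> (0 :: real) \<le> 0"
        unfolding I_def V_def by (auto simp: input_def R_def simp del: sum.lessThan_Suc)
    qed simp
  qed (use s start cov in auto)
qed


section \<open>Correctness of the move to a vertex\<close>

lemma ensures_set_centroid:
  assumes s: "input s"
  shows "ensures N set_centroid (\<lambda>s'. \<forall>r<R. real_cells s' 7 r 0 = (\<Sum>i<Suc n. real_cells s 4 i r / (real n + 1))) s"
proof -
  let ?c = "Seq (SetReal 7 (nvar 5) (NConst 0) (RNat (NConst 0)))
     (For 4 num_vertices (SetReal 7 (nvar 5) (NConst 0)
        (RPlus (RCell 7 (nvar 5) (NConst 0)) (RDiv (RCell 4 (nvar 4) (nvar 5)) (RNat num_vertices)))))"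
  let ?f = "\<lambda>r. \<Sum>i<Suc n. real_cells s 4 i r / (real n + 1)"
  have inp: "input s'" if "framed {4, 5} {7} s s'" for s'
    by (rule input_framed[OF that]) (use s in auto)
  have "ensures N set_centroid (\<lambda>s'. real_cells s' 7 =
     (\<lambda>p q. if p < R \<and> q = 0 then ?f p else real_cells s 7 p q)) s"
    unfolding set_centroid_def
  proof (rule ensures_fill_col)
    fix r and s' :: memory
    assume r: "r < R" "nat_cells s' 5 0 0 = r" and "framed (insert 5 (nat_mods ?c)) (real_mods ?c) s s'"
    then have fr: "framed {4, 5} {7} s s'" by (simp add: insert_commute)
    let ?s = "set_real 7 (nvar 5) (NConst 0) (rval (RNat (NConst 0)) s') s'"
    have fr2: "framed {4, 5} {7} s s2" if "framed {4} {7} ?s s2" for s2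
      using fr that by (auto simp: framed_def)
    show "ensures N ?c (\<lambda>s''. real_cells s'' 7 = upd_cell (real_cells s') 7 r 0 (?f r) 7) s'"
    proof (intro ensures_Seq ensures_SetReal, rule ensures_conseq, rule ensures_sum[where L = "Suc n"
        and P = r and Q = 0 and f = "\<lambda>i. real_cells s 4 i r / (real n + 1)"])
      fix i and s2 :: memory assume fr3: "framed {4} {7} ?s s2" "nat_cells s2 4 0 0 = i"
      then have "nat_cells s2 5 0 0 = r" "real_cells s2 4 = real_cells s 4"
        using r(2) fr by (auto simp: framed_def)
      then show "rval (RDiv (RCell 4 (nvar 4) (nvar 5)) (RNat num_vertices)) s2 = real_cells s 4 i r / (real n + 1)"
        using fr3 inp[OF fr2] by (simp add: input_def add.commute)
    next
      fix s2 assume fr3: "framed {4} {7} ?s s2"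
      then show "nval (nvar 5) s2 = r \<and> nval (NConst 0) s2 = 0"
        using r(2) by (auto simp: framed_def)
    next
      fix s2 assume fr3: "framed {4} {7} ?s s2"
      then show "nval num_vertices s2 = Suc n" using inp[OF fr2] by (simp add: input_def)
    next
      fix s2 :: memory assume "real_cells s2 7 = upd_cell (real_cells ?s) 7 r 0 (real_cells ?s 7 r 0 + ?f r) 7"
      then show "real_cells s2 7 = upd_cell (real_cells s') 7 r 0 (?f r) 7"
        using r(2) by (auto simp: upd_cell_def fun_eq_iff)
    qed (use N in auto)
  qed (use inp N in \<open>auto simp: input_def R_def insert_commute\<close>)
  then show ?thesis by (rule ensures_conseq) auto
qed

lemma ensures_find_pivot:
  assumes s: "input s"
  defines "i \<equiv> nat_cells s 4 0 0" and "D \<equiv> real_cells s 2" and "z \<equiv> \<lambda>r. real_cells s 7 r 0"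
  assumes i: "i < n" "D i i < 0"
  shows "ensures N find_pivot (\<lambda>s'. let p = nat_cells s' 7 0 0 in
     p < R \<and> D i p < 0 \<and> (\<forall>r<R. D i r < 0 \<longrightarrow> z p / D i p \<le> z r / D i r)) s"
  unfolding find_pivot_def
proof (intro ensures_Seq ensures_SetNat)
  let ?c = "Cond (BAnd (RLess (RCell 2 (nvar 4) (nvar 5)) (RNat (NConst 0)))
          (RLess (RDiv (RCell 7 (nvar 5) (NConst 0)) (RCell 2 (nvar 4) (nvar 5)))
             (RDiv (RCell 7 (nvar 7) (NConst 0)) (RCell 2 (nvar 4) (nvar 7)))))
        (SetNat 7 (NConst 0) (NConst 0) (nvar 5)) Skip"
  let ?s = "set_nat 7 (NConst 0) (NConst 0) (nval (nvar 4) s) s"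
  let ?I = "\<lambda>j s'. let p = nat_cells s' 7 0 0 in
     p < R \<and> D i p < 0 \<and> (\<forall>r<j. D i r < 0 \<longrightarrow> z p / D i p \<le> z r / D i r)"
  have fr: "framed {5, 7} {} s s'" if "framed {5, 7} {} ?s s'" for s'
    using that by (auto simp: framed_def)
  have inp: "input s'" if "framed {5, 7} {} ?s s'" for s'
    by (rule input_framed[OF fr[OF that]]) (use s in \<open>auto simp: input_def\<close>)
  show "ensures N (For 5 num_rows ?c) (\<lambda>s'. ?I R s') ?s"
  proof (rule ensures_For[where L = R and I = ?I])
    fix j and s' :: memory
    assume j: "j < R" "nat_cells s' 5 0 0 = j" "?I j s'"
      and "framed (insert 5 (nat_mods ?c)) (real_mods ?c) ?s s'"
    then have "framed {5, 7} {} s s'" using fr by simp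
    then have *: "real_cells s' 2 = D" "real_cells s' 7 r 0 = z r" "nat_cells s' 4 0 0 = i" for r
      by (simp_all add: framed_def D_def z_def i_def)
    let ?p = "nat_cells s' 7 0 0"
    have new: "z j / D i j \<le> z r / D i r"
      if "r < Suc j" "z j / D i j < z ?p / D i ?p" "D i r < 0" for r
    proof (cases "r = j")
      case False
      then have "z ?p / D i ?p \<le> z r / D i r" using j(3) that(1,3) by (simp add: Let_def)
      with that(2) show ?thesis by linarith
    qed simp
    show "ensures N ?c (?I (Suc j)) s'"
    proof (intro ensures_Cond ensures_SetNat ensures_Skip, goal_cases)
      case 1
      then show ?case using j new by (simp add: upd_cell_same * Let_def)
    next
      case 2
      then show ?case using j by (auto simp add: * Let_def less_Suc_eq)
    qed
  qed (use inp N i in \<open>auto simp: input_def R_def upd_cell_same i_def\<close>)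
qed

lemma ensures_move_to_facet:
  assumes s: "input s"
  defines "i \<equiv> nat_cells s 4 0 0" and "p \<equiv> nat_cells s 7 0 0" and "D \<equiv> real_cells s 2" and "z \<equiv> \<lambda>r. real_cells s 7 r 0"
  shows "ensures N move_to_facet (\<lambda>s'. \<forall>r<R. real_cells s' 7 r 0 = z r - z p / D i p * D i r) s"
  unfolding move_to_facet_def
proof (intro ensures_Seq ensures_SetReal)
  let ?c = "SetReal 7 (nvar 5) (NConst 0)
        (RMinus (RCell 7 (nvar 5) (NConst 0)) (RTimes (rvar 5) (RCell 2 (nvar 4) (nvar 5))))"
  let ?s = "set_real 5 (NConst 0) (NConst 0) (rval (RDiv (RCell 7 (nvar 7) (NConst 0)) (RCell 2 (nvar 4) (nvar 7))) s) s"
  have fr: "framed {5} {5, 7} s s'" if "framed {5} {7} ?s s'" for s'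
    using that by (auto simp: framed_def)
  have inp: "input s'" if "framed {5} {7} ?s s'" for s'
    by (rule input_framed[OF fr[OF that]]) (use s in \<open>auto simp: input_def\<close>)
  have "ensures N (For 5 num_rows ?c) (\<lambda>s'. real_cells s' 7 = 
      (\<lambda>r q. if r < R \<and> q = 0 then z r - z p / D i p * D i r else real_cells ?s 7 r q)) ?s"
  proof (rule ensures_fill_col)
    fix r and s' :: memory
    assume r: "r < R" "nat_cells s' 5 0 0 = r" and "framed (insert 5 (nat_mods ?c)) (real_mods ?c) ?s s'"
     and arr: "real_cells s' 7 = (\<lambda>r' q. if r' < r \<and> q = 0 then z r' - z p / D i p * D i r' else real_cells ?s 7 r' q)"
    then have "framed {5} {7} ?s s'" by simp
    then have *: "real_cells s' 2 = D" "nat_cells s' 4 0 0 = i" "real_cells s' 5 0 0 = z p / D i p"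
      by (simp_all add: framed_def D_def z_def i_def upd_cell_same p_def)
    have "real_cells s' 7 r 0 = z r" unfolding arr by (simp add: z_def)
    then show "ensures N ?c (\<lambda>s''. real_cells s'' 7 = upd_cell (real_cells s') 7 r 0 (z r - z p / D i p * D i r) 7) s'"
      by (intro ensures_SetReal) (simp add: * r)
  qed (use inp N in \<open>auto simp: input_def R_def\<close>)
  then show "ensures N (For 5 num_rows ?c) (\<lambda>s'. \<forall>r<R. real_cells s' 7 r 0 = z r - z p / D i p * D i r) ?s"
    by (rule ensures_conseq) auto
qed

lemma ensures_eliminate:
  assumes s: "input s"
  defines "i \<equiv> nat_cells s 4 0 0" and "p \<equiv> nat_cells s 7 0 0" and "D \<equiv> real_cells s 2"
  assumes p: "p < R"
  shows "ensures N eliminate (\<lambda>s'. \<forall>j<Suc n. \<forall>r<R. real_cells s' 2 j r =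
    (if i < j then D j r - D j p / D i p * D i r else D j r)) s"
proof -
  let ?d = "SetReal 2 (nvar 6) (nvar 5)
           (RMinus (RCell 2 (nvar 6) (nvar 5)) (RTimes (rvar 5) (RCell 2 (nvar 4) (nvar 5))))"
  let ?c = "Cond (NLess (nvar 4) (nvar 6))
     (Seq (SetReal 5 (NConst 0) (NConst 0) (RDiv (RCell 2 (nvar 6) (nvar 7)) (RCell 2 (nvar 4) (nvar 7))))
        (For 5 num_rows ?d)) Skip"
  let ?I = "\<lambda>l s'. real_cells s' 2 = (\<lambda>j r. if j < l \<and> r < R \<and> i < j then D j r - D j p / D i p * D i r else D j r)"
  have inp: "input s'" if "framed {5, 6} {2, 5} s s'" for s'
    by (rule input_framed[OF that]) (use s in auto)
  have "ensures N eliminate (?I (Suc n)) s"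
    unfolding eliminate_def
  proof (rule ensures_For[where L = "Suc n" and I = ?I])
    fix l and s' :: memory
    assume l: "l < Suc n" "nat_cells s' 6 0 0 = l" "?I l s'"
      and "framed (insert 6 (nat_mods ?c)) (real_mods ?c) s s'"
    then have fr: "framed {5, 6} {2, 5} s s'" by (simp add: insert_commute)
    then have reg: "nat_cells s' 4 0 0 = i" "nat_cells s' 7 0 0 = p" by (simp_all add: framed_def i_def p_def)
    let ?s = "set_real 5 (NConst 0) (NConst 0) (rval (RDiv (RCell 2 (nvar 6) (nvar 7)) (RCell 2 (nvar 4) (nvar 7))) s') s'"
    have fr2: "framed {5, 6} {2, 5} s s2" if "framed {5} {2} ?s s2" for s2
      using fr that by (auto simp: framed_def)
    show "ensures N ?c (?I (Suc l)) s'"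
    proof (intro ensures_Cond ensures_Seq ensures_SetReal ensures_Skip)
      assume "bval (NLess (nvar 4) (nvar 6)) s'"
      then have il: "i < l" using l reg by simp
      have "ensures N (For 5 num_rows ?d) (\<lambda>s'. real_cells s' 2 =
         (\<lambda>j r. if j = l \<and> r < R then D l r - D l p / D i p * D i r else real_cells ?s 2 j r)) ?s"
      proof (rule ensures_fill_row)
        fix r and s2 :: memory
        assume r: "r < R" "nat_cells s2 5 0 0 = r" and "framed (insert 5 (nat_mods ?d)) (real_mods ?d) ?s s2"
          and arr: "real_cells s2 2 = (\<lambda>j r'. if j = l \<and> r' < r then D l r' - D l p / D i p * D i r' else real_cells ?s 2 j r')"
        then have "framed {5} {2} ?s s2" by simp
        then have *: "nat_cells s2 4 0 0 = i" "nat_cells s2 6 0 0 = l" "real_cells s2 5 0 0 = D l p / D i p"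
          using reg l il by (simp_all add: framed_def upd_cell_same)
        have "real_cells s2 2 l r = D l r" "real_cells s2 2 i r = D i r"
          using il l(3) unfolding arr by simp_all
        then show "ensures N ?d (\<lambda>s''. real_cells s'' 2 = upd_cell (real_cells s2) 2 l r (D l r - D l p / D i p * D i r) 2) s2"
          by (intro ensures_SetReal) (simp add: * r)
      qed (use inp[OF fr2] N in \<open>auto simp: input_def R_def\<close>)
      then show "ensures N (For 5 num_rows ?d) (?I (Suc l)) ?s"
        by (rule ensures_conseq) (use l il in \<open>auto simp: fun_eq_iff less_Suc_eq\<close>)
    next
      assume "\<not> bval (NLess (nvar 4) (nvar 6)) s'"
      then have "\<not> i < l" using l reg by simp
      then show "?I (Suc l) s'" using l(3) by (auto simp: fun_eq_iff less_Suc_eq)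
    qed
  qed (use inp N in \<open>auto simp: input_def R_def insert_commute D_def\<close>)
  then show ?thesis by (rule ensures_conseq) auto
qed



lemma ensures_purify:
  assumes s: "input s" and start: "purified n R tab \<epsilon> 0 (real_cells s 2) (\<lambda>r. real_cells s 7 r 0)"
  shows "ensures N purify (\<lambda>s'. purified n R tab \<epsilon> n (real_cells s' 2) (\<lambda>r. real_cells s' 7 r 0)) s"
proof -
  let ?c = "Seq find_pivot (Seq move_to_facet eliminate)"
  let ?I = "\<lambda>i s'. purified n R tab \<epsilon> i (real_cells s' 2) (\<lambda>r. real_cells s' 7 r 0)"
  have mods: "insert 4 (nat_mods ?c) = {4, 5, 6, 7}" "real_mods ?c = {2, 5, 7}"
    by (auto simp: find_pivot_def move_to_facet_def eliminate_def)
  have nm: "4 \<notin> nat_mods ?c" by (auto simp: find_pivot_def move_to_facet_def eliminate_def)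
  have inp: "input s'" if "framed {4, 5, 6, 7} {2, 5, 7} s s'" for s'
    by (rule input_framed[OF that]) (use s in auto)
  show ?thesis unfolding purify_def
  proof (rule ensures_For[where L = n and I = ?I], goal_cases)
    case (2 s')
    then have "input s'" by (intro inp) (simp only: mods)
    then show ?case by (simp add: input_def)
  next
    case (6 i s1)
    then have s1: "input s1" by (intro inp) (simp only: mods)
    have pur: "?I i s1" and i: "i < n" "nat_cells s1 4 0 0 = i" using 6 by auto
    define D z where "D = real_cells s1 2" and "z = (\<lambda>r. real_cells s1 7 r 0)"
    have neg: "D i i < 0" using pur i unfolding purified_def D_def by simp
    show ?case
    proof (rule ensures_Seq, rule ensures_framed[OF ensures_find_pivot[OF s1]])
      fix s2 :: memory
      let ?p = "nat_cells s2 7 0 0"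
      assume "let p = ?p in p < R \<and> real_cells s1 2 (nat_cells s1 4 0 0) p < 0 \<and>
          (\<forall>r<R. real_cells s1 2 (nat_cells s1 4 0 0) r < 0 \<longrightarrow>
           real_cells s1 7 p 0 / real_cells s1 2 (nat_cells s1 4 0 0) p
           \<le> real_cells s1 7 r 0 / real_cells s1 2 (nat_cells s1 4 0 0) r)"
        and "framed (nat_mods find_pivot) (real_mods find_pivot) s1 s2"
      then have p: "?p < R" "D i ?p < 0" "\<And>r. r < R \<Longrightarrow> D i r < 0 \<Longrightarrow> z ?p / D i ?p \<le> z r / D i r"
        and fr2: "framed {5, 7} {} s1 s2"
        by (auto simp: find_pivot_def D_def z_def i insert_commute Let_def)
      have s2: "input s2" by (rule input_framed[OF fr2]) (use s1 in auto)
      have eq2: "real_cells s2 2 = D" "real_cells s2 7 = real_cells s1 7" "nat_cells s2 4 0 0 = i"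
        using fr2 i by (simp_all add: framed_def D_def)
      show "ensures N (Seq move_to_facet eliminate) (?I (Suc i)) s2"
      proof (rule ensures_Seq, rule ensures_framed[OF ensures_move_to_facet[OF s2]])
        fix s3 :: memory
        assume z3: "\<forall>r<R. real_cells s3 7 r 0 = real_cells s2 7 r 0 -
            real_cells s2 7 ?p 0 / real_cells s2 2 (nat_cells s2 4 0 0) ?p * real_cells s2 2 (nat_cells s2 4 0 0) r"
          and "framed (nat_mods move_to_facet) (real_mods move_to_facet) s2 s3"
        then have fr3: "framed {5} {5, 7} s2 s3" by (simp add: move_to_facet_def insert_commute)
        have s3: "input s3" by (rule input_framed[OF fr3]) (use s2 in auto)
        have eq3: "real_cells s3 2 = D" "nat_cells s3 4 0 0 = i" "nat_cells s3 7 0 0 = ?p"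
          using fr3 eq2 by (simp_all add: framed_def)
        show "ensures N eliminate (?I (Suc i)) s3"
        proof (rule ensures_framed[OF ensures_eliminate[OF s3]], unfold eq3)
          fix s4 :: memory
          assume D4: "\<forall>j<Suc n. \<forall>r<R. real_cells s4 2 j r =
               (if i < j then D j r - D j ?p / D i ?p * D i r else D j r)"
            and "framed (nat_mods eliminate) (real_mods eliminate) s3 s4"
          then have "framed {5, 6} {2, 5} s3 s4" by (simp add: eliminate_def insert_commute)
          then have z4: "real_cells s4 7 r 0 = z r - z ?p / D i ?p * D i r" if "r < R" for r
            using z3 that unfolding eq2 by (simp add: framed_def z_def)
          show "?I (Suc i) s4"
            by (rule purified_step[OF pur[folded D_def z_def] i(1) _ p(1,2)])
              (use p(3) z4 D4 in \<open>simp_all add: R_def\<close>)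
        qed (use p in auto)
      qed
    qed (use neg i in \<open>simp_all add: D_def\<close>)
  qed (use nm start N in auto)
qed

section \<open>Both phases together\<close>

definition feasible :: "(nat \<Rightarrow> real) \<Rightarrow> bool" where
  "feasible x \<longleftrightarrow> (\<forall>r<R. (\<Sum>l<n. x l * tab l r) + tab n r \<le> 0)"

lemma tab_le_1: "l < n \<Longrightarrow> \<bar>tab l r\<bar> \<le> 1"
  using mem_le by (auto simp: tab_def)

lemma tab_in_Ints: "tab l r \<in> \<int>"
  by (simp add: tab_def)

text \<open>Raising one coordinate of a feasible \<open>x\<close> by \<epsilon> changes a constraint
  by at most \<epsilon>, since the coefficients have absolute value at most 1. The tolerance
  therefore admits a full simplex at \<open>x\<close>, which keeps the volume of the enclosing
  simplex away from 0.\<close>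

lemma ensures_solve_lp:
  assumes s: "input s" and feas: "feasible x" and x: "\<And>i. i < n \<Longrightarrow> 0 \<le> x i \<and> x i \<le> 1"
  shows "ensures N solve_lp (\<lambda>s'. feasible (\<lambda>i. - real_cells s' 2 n i)) s"
proof -
  define T where "T j r = (\<Sum>i<n. (x i + (if i = j then \<epsilon> else 0)) * tab i r) + (tab n r - \<epsilon>)" for j r
  have \<epsilon>: "0 < \<epsilon>" "\<epsilon> \<le> 1" by (auto simp: \<epsilon>_def)
  have T: "T j r \<le> 0" if r: "r < R" for j r
  proof -
    have "(\<Sum>i<n. (x i + (if i = j then \<epsilon> else 0)) * tab i r) = (\<Sum>i<n. x i * tab i r + (if i = j then \<epsilon> * tab j r else 0))"
      by (intro sum.cong) (auto simp: algebra_simps)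
    also have "\<dots> = (\<Sum>i<n. x i * tab i r) + (if j < n then \<epsilon> * tab j r else 0)"
      by (simp add: sum.distrib)
    also have "(if j < n then \<epsilon> * tab j r else 0) \<le> \<epsilon>"
      using tab_le_1[of j r] \<epsilon> by (auto simp: abs_le_iff)
    finally show ?thesis using feas r unfolding T_def feasible_def by fastforce
  qed
  have cov: "covers (Suc n) R T Y ((\<epsilon> / (real n + 1)) ^ n)" if "\<forall>i<Suc n. \<forall>r<R. Y i r = start_value i r" for Y
    by (rule covers_start[where C = tab and e = "\<lambda>r. tab n r - \<epsilon>" and x = x])
      (use \<epsilon> x that in \<open>simp_all add: start_value_def T_def\<close>)
  note mods = build_tableau_def tableau_entry_def set_tolerance_def start_simplex_def start_slack_def
    simplex_method_def shrink_simplex_def find_violated_def find_best_vertex_def sum_slack_def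
    set_factors_def contract_def set_centroid_def
  show ?thesis unfolding solve_lp_def
  proof (rule ensures_Seq, rule ensures_framed[OF ensures_build_tableau[OF s]])
    fix s1 :: memory
    assume t1: "\<forall>i<Suc n. \<forall>r<R. real_cells s1 2 i r = tab i r"
      and fr1: "framed (nat_mods build_tableau) (real_mods build_tableau) s s1"
    have s1: "input s1" by (rule input_framed[OF fr1]) (use s in \<open>auto simp: mods\<close>)
    show "ensures N (Seq set_tolerance (Seq start_simplex (Seq simplex_method (Seq set_centroid purify))))
       (\<lambda>s'. feasible (\<lambda>i. - real_cells s' 2 n i)) s1"
    proof (rule ensures_Seq, rule ensures_framed[OF ensures_set_tolerance[OF s1]])
      fix s2 :: memory
      assume e2: "real_cells s2 3 0 0 = \<epsilon>" and fr2: "framed (nat_mods set_tolerance) (real_mods set_tolerance) s1 s2"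
      have s2: "input s2" by (rule input_framed[OF fr2]) (use s1 in \<open>auto simp: mods\<close>)
      have "real_cells s2 2 = real_cells s1 2" using fr2 by (simp add: framed_def mods)
      then have t2: "\<forall>i<Suc n. \<forall>r<R. real_cells s2 2 i r = tab i r" using t1 by simp
      show "ensures N (Seq start_simplex (Seq simplex_method (Seq set_centroid purify)))
        (\<lambda>s'. feasible (\<lambda>i. - real_cells s' 2 n i)) s2"
      proof (rule ensures_Seq, rule ensures_framed[OF ensures_start_simplex[OF s2 t2 e2]])
        fix s3 :: memory
        assume Y3: "\<forall>i<Suc n. \<forall>r<R. real_cells s3 4 i r = start_value i r"
          and fr3: "framed (nat_mods start_simplex) (real_mods start_simplex) s2 s3"
        have s3: "input s3" by (rule input_framed[OF fr3]) (use s2 in \<open>auto simp: mods\<close>)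
        have "real_cells s3 2 = real_cells s2 2" using fr3 by (simp add: framed_def mods)
        then have t3: "\<forall>i<Suc n. \<forall>r<R. real_cells s3 2 i r = tab i r" using t2 by simp
        show "ensures N (Seq simplex_method (Seq set_centroid purify))
          (\<lambda>s'. feasible (\<lambda>i. - real_cells s' 2 n i)) s3"
        proof (rule ensures_Seq, rule ensures_framed[OF ensures_simplex_method[OF s3 affine_rows_start[OF Y3] cov[OF Y3] T]])
          fix s4 :: memory
          assume Y4: "affine_rows (real_cells s4 4) \<and> (\<forall>r<R. (\<Sum>i<Suc n. real_cells s4 4 i r) \<le> 0)"
            and fr4: "framed (nat_mods simplex_method) (real_mods simplex_method) s3 s4"
          have s4: "input s4" by (rule input_framed[OF fr4]) (use s3 in \<open>auto simp: mods\<close>)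
          have "real_cells s4 2 = real_cells s3 2" using fr4 by (simp add: framed_def mods)
          then have t4: "\<forall>i<Suc n. \<forall>r<R. real_cells s4 2 i r = tab i r" using t3 by simp
          show "ensures N (Seq set_centroid purify) (\<lambda>s'. feasible (\<lambda>i. - real_cells s' 2 n i)) s4"
          proof (rule ensures_Seq, rule ensures_framed[OF ensures_set_centroid[OF s4]])
            fix s5 :: memory
            assume z5: "\<forall>r<R. real_cells s5 7 r 0 = (\<Sum>i<Suc n. real_cells s4 4 i r / (real n + 1))"
              and fr5: "framed (nat_mods set_centroid) (real_mods set_centroid) s4 s5"
            have s5: "input s5" by (rule input_framed[OF fr5]) (use s4 in \<open>auto simp: mods\<close>)
            have "real_cells s5 2 = real_cells s4 2" using fr5 by (simp add: framed_def mods)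
            then have t5: "\<forall>i<Suc n. \<forall>r<R. real_cells s5 2 i r = tab i r" using t4 by simp
            obtain p where p: "\<And>i r. i < Suc n \<Longrightarrow> r < R \<Longrightarrow> real_cells s4 4 i r = (\<Sum>l<n. p i l * tab l r) + tab n r - \<epsilon>"
              using Y4 unfolding affine_rows_def by blast
            \<comment> \<open>When the loop has ended, the centroid satisfies the relaxed
              constraints; its coordinates are the means of those of the points behind the
              vertices.\<close>
            have pur: "purified n R tab \<epsilon> 0 (real_cells s5 2) (\<lambda>r. real_cells s5 7 r 0)"
            proof (rule purified_start[where x = "\<lambda>l. \<Sum>i<Suc n. p i l / (real n + 1)"])
              fix r assume r: "r < R"
              show "real_cells s5 7 r 0 \<le> 0"
                using z5 r Y4 by (simp add: sum_divide_distrib[symmetric] divide_nonpos_nonneg del: sum.lessThan_Suc)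
              have "real_cells s5 7 r 0 = (\<Sum>i<Suc n. (\<Sum>l<n. p i l * tab l r) / (real n + 1) + (tab n r - \<epsilon>) / (real n + 1))"
                using z5 r p[OF _ r] by (simp add: add_divide_distrib[symmetric] add_diff_eq del: sum.lessThan_Suc)
              also have "\<dots> = (\<Sum>i<Suc n. (\<Sum>l<n. p i l * tab l r) / (real n + 1)) + (\<Sum>i<Suc n. (tab n r - \<epsilon>) / (real n + 1))"
                by (rule sum.distrib)
              also have "(\<Sum>i<Suc n. (tab n r - \<epsilon>) / (real n + 1)) = tab n r - \<epsilon>"
                by (simp add: field_simps)
              also have "(\<Sum>i<Suc n. (\<Sum>l<n. p i l * tab l r) / (real n + 1)) = (\<Sum>l<n. (\<Sum>i<Suc n. p i l / (real n + 1)) * tab l r)"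
                unfolding sum_divide_distrib sum_distrib_right by (subst sum.swap) (simp add: field_simps del: sum.lessThan_Suc)
              finally show "real_cells s5 7 r 0 = (\<Sum>l<n. (\<Sum>i<Suc n. p i l / (real n + 1)) * tab l r) + tab n r - \<epsilon>"
                by (simp del: sum.lessThan_Suc)
            qed (use t5 in \<open>auto simp: tab_def R_def\<close>)
            show "ensures N purify (\<lambda>s'. feasible (\<lambda>i. - real_cells s' 2 n i)) s5"
            proof (rule ensures_conseq[OF ensures_purify[OF s5 pur]])
              fix s6 :: memory assume pur6: "purified n R tab \<epsilon> n (real_cells s6 2) (\<lambda>r. real_cells s6 7 r 0)"
              have "\<exists>y. \<forall>r<R. real_cells s6 2 n r = (\<Sum>l<n. y l * tab l r) + tab n r \<and> real_cells s6 2 n r \<le> 0"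
              proof (rule purified_final[OF pur6])
                fix y assume "\<And>r. r < R \<Longrightarrow> real_cells s6 2 n r = (\<Sum>l<n. y l * tab l r) + tab n r"
                  "\<And>r. r < R \<Longrightarrow> real_cells s6 2 n r \<le> 0"
                then show ?thesis by blast
              qed (auto simp: tab_in_Ints tab_le_1 \<epsilon>_def)
              then obtain y where y: "\<And>r. r < R \<Longrightarrow> real_cells s6 2 n r = (\<Sum>l<n. y l * tab l r) + tab n r"
                "\<And>r. r < R \<Longrightarrow> real_cells s6 2 n r \<le> 0"
                by blast
              \<comment> \<open>The first \<open>n\<close> constraints are \<open>- x i <= 0\<close>
                without constant term, so the solution can be read off their slacks.\<close>
              have "- real_cells s6 2 n i = y i" if i: "i < n" for i
              proof -
                have "(\<Sum>l<n. y l * tab l i) = (\<Sum>l<n. if l = i then - y i else 0)"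
                  using i by (intro sum.cong) (auto simp: tab_def)
                then show ?thesis using y(1)[of i] i by (simp add: tab_def R_def)
              qed
              then show "feasible (\<lambda>i. - real_cells s6 2 n i)"
                using y unfolding feasible_def by simp
            qed
          qed
        qed
      qed
    qed
  qed
qed

end

section \<open>Randomized rounding\<close>

lemma reaches_const:
  "ensures N c Q s \<Longrightarrow> achieves N c Q (\<lambda>_. v) s v"
  by (simp add: reaches_def split_def)

lemma reaches_from_ensures:
  assumes "ensures N c Q s" "\<And>s'. Q s' \<Longrightarrow> Q' s'" "\<And>s'. Q s' \<Longrightarrow> v \<le> \<psi> s'"
  shows "achieves N c Q' \<psi> s v"
  by (rule reaches_conseq[OF reaches_const[OF assms(1)]]) (use assms in auto)

definition set_weights :: program where
  "set_weights = For 4 num_points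
     (SetReal 8 (nvar 4) (NConst 0) (RMinus (RNat (NConst 0)) (RCell 2 num_points (nvar 4))))"

definition sum_weights :: program where
  "sum_weights = Seq (SetReal 5 (NConst 0) (NConst 0) (RNat (NConst 0)))
     (For 4 num_points (SetReal 5 (NConst 0) (NConst 0) (RPlus (rvar 5) (RCell 8 (nvar 4) (NConst 0)))))"

text \<open>Sampling with biased coins: point \<open>j\<close> is taken with probability its weight
  divided by the weight not yet passed over, which real array 5 keeps. The last point of positive
  weight thus meets bias 1. If all weights are 0, the bias is 0 / 0 = 0 and nothing is drawn, which
  natural-number array 8 shows by the value \<open>num_points\<close>.\<close>

definition draw_step :: program where
  "draw_step = Cond (NLess (nvar 8) num_points) Skip
     (Seq (Flip 9 (NConst 0) (NConst 0) (RDiv (RCell 8 (nvar 4) (NConst 0)) (rvar 5)))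
        (Cond (NLess (NConst 0) (nvar 9))
           (SetNat 8 (NConst 0) (NConst 0) (nvar 4))
           (SetReal 5 (NConst 0) (NConst 0) (RMinus (rvar 5) (RCell 8 (nvar 4) (NConst 0))))))"

definition draw_point :: program where
  "draw_point = Seq (SetNat 8 (NConst 0) (NConst 0) num_points) (For 4 num_points draw_step)"

definition clear_ball :: program where
  "clear_ball = For 4 num_points (Cond (RLess (RCell 0 (nvar 4) (nvar 8)) half_guess)
     (SetReal 8 (nvar 4) (NConst 0) (RNat (NConst 0))) Skip)"

definition select_point :: program where
  "select_point = Cond (NLess (nvar 8) num_points)
     (Seq (SetNat 3 (nvar 8) (NConst 0) (NConst 1)) clear_ball) Skip"

definition rounding_step :: program where
  "rounding_step = Seq sum_weights (Seq draw_point select_point)"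

definition round_solution :: program where
  "round_solution = Seq set_weights (For 10 num_points rounding_step)"

locale rounding_input = lp_input +
  assumes near_refl: "p < n \<Longrightarrow> near p p" and near_sym: "p < n \<Longrightarrow> q < n \<Longrightarrow> near p q = near q p"
begin

abbreviation weight :: "memory \<Rightarrow> nat \<Rightarrow> real" where
  "weight s p \<equiv> real_cells s 8 p 0"

section \<open>Drawing a point in proportion to its weight\<close>

lemma ensures_sum_weights:
  assumes s: "input s"
  shows "ensures N sum_weights (\<lambda>s'. real_cells s' 5 0 0 = (\<Sum>p<n. weight s p)) s"
  unfolding sum_weights_def
proof (intro ensures_Seq ensures_SetReal)
  let ?s = "set_real 5 (NConst 0) (NConst 0) (rval (RNat (NConst 0)) s) s"
  have fr: "framed {4} {5} s s'" if "framed {4} {5} ?s s'" for s'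
    using that by (auto simp: framed_def)
  have inp: "input s'" if "framed {4} {5} ?s s'" for s'
    by (rule input_framed[OF fr[OF that]]) (use s in \<open>auto simp: input_def\<close>)
  show "ensures N (For 4 num_points (SetReal 5 (NConst 0) (NConst 0) (RPlus (rvar 5) (RCell 8 (nvar 4) (NConst 0)))))
     (\<lambda>s'. real_cells s' 5 0 0 = (\<Sum>p<n. weight s p)) ?s"
    by (rule ensures_conseq, rule ensures_sum[where L = n and P = 0 and Q = 0 and f = "weight s"])
      (use inp fr N in \<open>auto simp: input_def upd_cell_def framed_def\<close>)
qed

text \<open>\<open>H j / T j\<close> is the mean of \<open>g\<close> over the points from
  \<open>j\<close> on, that is, its expectation given that no earlier point was drawn; every coin
  splits it by total probability.\<close>

lemma achieves_draw_point:
  fixes g :: "nat \<Rightarrow> real"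
  assumes s: "input s" and w0: "\<And>p. p < n \<Longrightarrow> 0 \<le> weight s p" and W: "real_cells s 5 0 0 = (\<Sum>p<n. weight s p)"
  shows "achieves N draw_point
    (\<lambda>s'. if nat_cells s' 8 0 0 < n then 0 < weight s (nat_cells s' 8 0 0) else \<forall>p<n. weight s p = 0)
    (\<lambda>s'. if nat_cells s' 8 0 0 < n then C + g (nat_cells s' 8 0 0) else C) s
    (C + (\<Sum>p<n. weight s p * g p) / (\<Sum>p<n. weight s p))"
proof -
  let ?w = "weight s"
  define T where "T j = (\<Sum>p\<in>{j..<n}. ?w p)" for j
  define H where "H j = (\<Sum>p\<in>{j..<n}. ?w p * g p)" for j
  define I where "I j s' \<longleftrightarrow> (if nat_cells s' 8 0 0 < n then 0 < ?w (nat_cells s' 8 0 0)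
    else real_cells s' 5 0 0 = T j \<and> (0 < T j \<or> (\<forall>p<n. ?w p = 0)))" for j and s' :: memory
  define \<phi> where "\<phi> j s' = (if nat_cells s' 8 0 0 < n then C + g (nat_cells s' 8 0 0) else C + H j / T j)"
    for j and s' :: memory
  have Tn: "T n = 0" "H n = 0" by (simp_all add: T_def H_def)
  have T_Suc: "T j = ?w j + T (Suc j)" and H_Suc: "H j = ?w j * g j + H (Suc j)" if "j < n" for j
    using that by (simp_all add: T_def H_def sum.atLeast_Suc_lessThan)
  have T0: "0 \<le> T j" for j unfolding T_def using w0 by (intro sum_nonneg) auto
  have H0: "H j = 0" if "T j = 0" for j
  proof -
    have "?w p = 0" if "p \<in> {j..<n}" for p
      using sum_nonneg_eq_0_iff[of "{j..<n}" ?w] w0 \<open>T j = 0\<close> that unfolding T_def by auto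
    then show ?thesis by (simp add: H_def)
  qed
  have mods: "nat_mods draw_step = {8, 9}" "real_mods draw_step = {5}" by (auto simp: draw_step_def)
  let ?s = "put_nat 8 (nval num_points s) s"
  have fr: "framed {4, 8, 9} {5} s s'" if "framed {4, 8, 9} {5} ?s s'" for s'
    using that by (auto simp: framed_def)
  have inp: "input s'" if "framed {4, 8, 9} {5} ?s s'" for s'
    by (rule input_framed[OF fr[OF that]]) (use s in \<open>auto simp: input_def\<close>)
  have Ts: "T 0 = (\<Sum>p<n. ?w p)" "H 0 = (\<Sum>p<n. ?w p * g p)"
    by (simp_all add: T_def H_def atLeast0LessThan)
  have all0: "0 < T 0 \<or> (\<forall>p<n. ?w p = 0)"
    using sum_nonneg_eq_0_iff[of "{0..<n}" ?w] w0 T0[of 0] unfolding T_def by force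
  show ?thesis unfolding draw_point_def
  proof (rule achieves_Seq[where Q = "\<lambda>s'. s' = ?s" and \<phi> = "\<lambda>_. C + H 0 / T 0"])
    fix s1 assume s1: "s1 = ?s"
    show "achieves N (For 4 num_points draw_step)
      (\<lambda>s'. if nat_cells s' 8 0 0 < n then 0 < ?w (nat_cells s' 8 0 0) else \<forall>p<n. ?w p = 0)
      (\<lambda>s'. if nat_cells s' 8 0 0 < n then C + g (nat_cells s' 8 0 0) else C) s1 (C + H 0 / T 0)"
      unfolding s1
    proof (rule achieves_For[where L = n and I = I and \<phi> = \<phi>])
      fix s' assume "framed (insert 4 (nat_mods draw_step)) (real_mods draw_step) ?s s'"
      then show "nval num_points s' = n" using inp by (simp add: mods input_def)
    next
      show "I 0 ?s" using s W all0 by (auto simp: I_def Ts upd_cell_same input_def)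
      show "C + H 0 / T 0 \<le> \<phi> 0 ?s" using s by (simp add: \<phi>_def upd_cell_same input_def)
    next
      fix s' assume "framed (insert 4 (nat_mods draw_step)) (real_mods draw_step) ?s s'" and "I n s'"
      then show "(if nat_cells s' 8 0 0 < n then 0 < ?w (nat_cells s' 8 0 0) else \<forall>p<n. ?w p = 0) \<and>
         \<phi> n s' \<le> (if nat_cells s' 8 0 0 < n then C + g (nat_cells s' 8 0 0) else C)"
        by (auto simp: I_def \<phi>_def Tn)
    next
      fix j and s' :: memory
      assume j: "j < n" and "framed (insert 4 (nat_mods draw_step)) (real_mods draw_step) ?s s'"
        and ctr: "nat_cells s' 4 0 0 = j" and I: "I j s'"
      then have fr': "framed {4, 8, 9} {5} ?s s'" by (simp add: mods)
      have i: "input s'" and w: "real_cells s' 8 = real_cells s 8"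
        using inp[OF fr'] fr[OF fr'] by (simp_all add: framed_def)
      let ?p = "?w j / T j"
      show "achieves N draw_step (I (Suc j)) (\<phi> (Suc j)) s' (\<phi> j s')"
        unfolding draw_step_def
      proof (intro achieves_Cond achieves_Skip)
        assume "bval (NLess (nvar 8) num_points) s'"
        then have "nat_cells s' 8 0 0 < n" using i by (simp add: input_def)
        then show "I (Suc j) s'" "\<phi> j s' \<le> \<phi> (Suc j) s'" using I by (simp_all add: I_def \<phi>_def)
      next
        assume "\<not> bval (NLess (nvar 8) num_points) s'"
        then have c: "\<not> nat_cells s' 8 0 0 < n" using i by (simp add: input_def)
        then have T: "real_cells s' 5 0 0 = T j" "0 < T j \<or> (\<forall>p<n. ?w p = 0)" using I by (simp_all add: I_def)
        have bias: "rval (RDiv (RCell 8 (nvar 4) (NConst 0)) (rvar 5)) s' = ?p"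
          using ctr w T by simp
        have p: "0 \<le> ?p" "?p \<le> 1"
          using T0[of j] T0[of "Suc j"] T_Suc[OF j] w0[OF j] by (auto simp: divide_le_eq)
        let ?h = "C + H (Suc j) / T (Suc j)"
        show "achieves N (Seq (Flip 9 (NConst 0) (NConst 0) (RDiv (RCell 8 (nvar 4) (NConst 0)) (rvar 5)))
          (Cond (NLess (NConst 0) (nvar 9)) (SetNat 8 (NConst 0) (NConst 0) (nvar 4))
           (SetReal 5 (NConst 0) (NConst 0) (RMinus (rvar 5) (RCell 8 (nvar 4) (NConst 0)))))) (I (Suc j)) (\<phi> (Suc j)) s' (\<phi> j s')"
        proof (rule achieves_Seq[where Q = "\<lambda>s2. s2 = put_nat 9 1 s' \<and> 0 < ?p \<or> s2 = put_nat 9 0 s' \<and> ?p < 1"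
              and \<phi> = "\<lambda>s2. if nat_cells s2 9 0 0 = 1 then C + g j else ?h"])
          show "achieves N (Flip 9 (NConst 0) (NConst 0) (RDiv (RCell 8 (nvar 4) (NConst 0)) (rvar 5)))
            (\<lambda>s2. s2 = put_nat 9 1 s' \<and> 0 < ?p \<or> s2 = put_nat 9 0 s' \<and> ?p < 1)
            (\<lambda>s2. if nat_cells s2 9 0 0 = 1 then C + g j else ?h) s' (\<phi> j s')"
          proof (rule achieves_Flip, unfold bias)
            \<comment> \<open>Division by 0 yields 0. With \<open>T j = 0\<close> both sides are
              \<open>C\<close>; with only \<open>T (Suc j) = 0\<close> the bias is 1 and
              \<open>?h\<close> gets no weight.\<close>
            have "C + H j / T j \<le> ?p * (C + g j) + (1 - ?p) * ?h"
            proof (cases "T j = 0")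
              case True
              then have "T (Suc j) = 0" using T_Suc[OF j] T0[of "Suc j"] w0[OF j] by simp
              then show ?thesis using True by simp
            next
              case Tj: False
              show ?thesis
              proof (cases "T (Suc j) = 0")
                case True
                then have "?p = 1" "H j = ?w j * g j" using T_Suc[OF j] H_Suc[OF j] H0[OF True] Tj by simp_all
                then show ?thesis by (simp only: times_divide_eq_left[symmetric]) simp
              next
                case False
                have "1 - ?p = T (Suc j) / T j" using Tj T_Suc[OF j] by (simp add: field_simps)
                then have "(1 - ?p) * (H (Suc j) / T (Suc j)) = H (Suc j) / T j" using False by simp
                then have "C + H j / T j = C + ?p * g j + (1 - ?p) * (H (Suc j) / T (Suc j))"
                  by (simp only: H_Suc[OF j] add_divide_distrib) simp
                moreover have "a * (C + x) + (1 - a) * (C + y) = C + a * x + (1 - a) * y" for a x y :: real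
                  by (simp add: algebra_simps)
                ultimately show ?thesis by (simp only: order_refl)
              qed
            qed
            then show "\<phi> j s' \<le> ?p * (if nat_cells (put_nat 9 1 s') 9 0 0 = 1 then C + g j else ?h) +
               (1 - ?p) * (if nat_cells (put_nat 9 0 s') 9 0 0 = 1 then C + g j else ?h)"
              using c by (simp add: \<phi>_def upd_cell_same)
          qed (use p in auto)
        next
          fix s2 assume s2: "s2 = put_nat 9 1 s' \<and> 0 < ?p \<or> s2 = put_nat 9 0 s' \<and> ?p < 1"
          show "achieves N (Cond (NLess (NConst 0) (nvar 9)) (SetNat 8 (NConst 0) (NConst 0) (nvar 4))
           (SetReal 5 (NConst 0) (NConst 0) (RMinus (rvar 5) (RCell 8 (nvar 4) (NConst 0))))) (I (Suc j)) (\<phi> (Suc j)) s2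
           (if nat_cells s2 9 0 0 = 1 then C + g j else ?h)"
          proof (intro achieves_Cond achieves_SetNat achieves_SetReal)
            assume "bval (NLess (NConst 0) (nvar 9)) s2"
            then have s2: "s2 = put_nat 9 1 s'" "0 < ?p" using s2 by (auto simp: upd_cell_same)
            have "0 < ?w j" using s2(2) T0[of j] by (simp add: zero_less_divide_iff)
            then show "I (Suc j) (set_nat 8 (NConst 0) (NConst 0) (nval (nvar 4) s2) s2)"
              "(if nat_cells s2 9 0 0 = 1 then C + g j else ?h) \<le> \<phi> (Suc j) (set_nat 8 (NConst 0) (NConst 0) (nval (nvar 4) s2) s2)"
              using j ctr by (simp_all add: I_def \<phi>_def s2(1) upd_cell_same)
          next
            assume "\<not> bval (NLess (NConst 0) (nvar 9)) s2"
            then have s2: "s2 = put_nat 9 0 s'" "?p < 1" using s2 by (auto simp: upd_cell_same)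
            have "0 < T (Suc j) \<or> (\<forall>p<n. ?w p = 0)"
              using T(2) s2(2) T_Suc[OF j] by (auto simp: divide_less_eq)
            then show "I (Suc j) (set_real 5 (NConst 0) (NConst 0) (rval (RMinus (rvar 5) (RCell 8 (nvar 4) (NConst 0))) s2) s2)"
              "(if nat_cells s2 9 0 0 = 1 then C + g j else ?h) \<le>
                 \<phi> (Suc j) (set_real 5 (NConst 0) (NConst 0) (rval (RMinus (rvar 5) (RCell 8 (nvar 4) (NConst 0))) s2) s2)"
              using c ctr T w T_Suc[OF j] by (simp_all add: I_def \<phi>_def s2(1) upd_cell_same)
          qed
        qed
      qed
    qed (use N in \<open>auto simp: mods I_def \<phi>_def fun_eq_iff\<close>)
  next
    show "achieves N (SetNat 8 (NConst 0) (NConst 0) num_points) (\<lambda>s'. s' = ?s) (\<lambda>_. C + H 0 / T 0) s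
      (C + (\<Sum>p<n. ?w p * g p) / (\<Sum>p<n. ?w p))"
      by (rule achieves_SetNat) (simp_all add: Ts)
  qed
qed


section \<open>The potential of a group and its drift\<close>

definition selected :: "memory \<Rightarrow> nat set" where
  "selected s = {p. p < n \<and> nat_cells s 3 p 0 \<noteq> 0}"

text \<open>Only points of positive weight are drawn, so zero weights in the balls around selected
  points keep all later selections away from them.\<close>

definition fractional :: "memory \<Rightarrow> bool" where
  "fractional s \<longleftrightarrow> input s \<and> (\<forall>p<n. 0 \<le> weight s p) \<and>
     (\<forall>p<n. (\<Sum>q<n. if near p q then weight s q else 0) \<le> 1) \<and>
     (\<forall>q\<in>selected s. \<forall>p<n. near p q \<longrightarrow> weight s p = 0) \<and>
     (\<forall>p\<in>selected s. \<forall>q\<in>selected s. p \<noteq> q \<longrightarrow> \<not> near p q)"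

definition potential :: "(nat \<Rightarrow> bool) \<Rightarrow> memory \<Rightarrow> real" where
  "potential grp s = (\<Sum>p<n. if grp p then (if p \<in> selected s then 1 else 0) + weight s p else 0)"

text \<open>The change of the potential when \<open>q\<close> gets selected: \<open>q\<close> itself
  counts 1, and the weights in its ball are lost.\<close>

definition gain :: "(nat \<Rightarrow> bool) \<Rightarrow> memory \<Rightarrow> nat \<Rightarrow> real" where
  "gain grp s q = (if grp q then 1 else 0) - (\<Sum>p<n. if grp p \<and> near p q then weight s p else 0)"

text \<open>Exchanging the sums charges the losses to the points \<open>p\<close> of the group: what
  remains is the sum over the group of the weight of \<open>p\<close> times 1 minus the weight of
  the ball around \<open>p\<close>. Divided by the total weight, this is the expected change of the
  potential in one round, which is therefore nonnegative.\<close>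

lemma sum_gain_nonneg:
  assumes "fractional s"
  shows "0 \<le> (\<Sum>q<n. weight s q * gain grp s q)"
proof -
  let ?w = "weight s"
  have "(\<Sum>q<n. ?w q * (\<Sum>p<n. if grp p \<and> near p q then ?w p else 0)) =
      (\<Sum>q<n. \<Sum>p<n. if grp p then ?w p * (if near p q then ?w q else 0) else 0)"
    unfolding sum_distrib_left by (intro sum.cong) auto
  also have "\<dots> = (\<Sum>p<n. \<Sum>q<n. if grp p then ?w p * (if near p q then ?w q else 0) else 0)"
    by (rule sum.swap)
  also have "\<dots> = (\<Sum>p<n. if grp p then ?w p * (\<Sum>q<n. if near p q then ?w q else 0) else 0)"
    unfolding sum_distrib_left by (intro sum.cong) auto
  also have "\<dots> \<le> (\<Sum>p<n. if grp p then ?w p * 1 else 0)"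
    using assms unfolding fractional_def by (intro sum_mono) (auto intro!: mult_left_le)
  finally show ?thesis
    by (simp add: gain_def right_diff_distrib sum_subtractf if_distrib[of "\<lambda>x. _ * x"] cong: if_cong)
qed

definition select :: "nat \<Rightarrow> memory \<Rightarrow> memory \<Rightarrow> bool" where
  "select c s s' \<longleftrightarrow> selected s' = insert c (selected s) \<and>
     (\<forall>p<n. weight s' p = (if near p c then 0 else weight s p))"

lemma ensures_select_point:
  assumes s: "input s" and c: "nat_cells s 8 0 0 < n"
  shows "ensures N select_point (select (nat_cells s 8 0 0) s) s"
proof -
  let ?k = "nat_cells s 8 0 0"
  let ?s = "set_nat 3 (nvar 8) (NConst 0) (nval (NConst 1) s) s"
  let ?d = "Cond (RLess (RCell 0 (nvar 4) (nvar 8)) half_guess)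
     (SetReal 8 (nvar 4) (NConst 0) (RNat (NConst 0))) Skip"
  have fr: "framed {3, 4} {8} s s'" if "framed {4} {8} ?s s'" for s'
    using that by (auto simp: framed_def)
  have inp: "input s'" if "framed {4} {8} ?s s'" for s'
    by (rule input_framed[OF fr[OF that]]) (use s in \<open>auto simp: input_def\<close>)
  have "ensures N clear_ball (\<lambda>s'. real_cells s' 8 =
      (\<lambda>p q. if p < n \<and> q = 0 then (if near p ?k then 0 else weight s p) else real_cells ?s 8 p q)) ?s"
    unfolding clear_ball_def
  proof (rule ensures_fill_col)
    fix p and s' :: memory
    assume p: "p < n" "nat_cells s' 4 0 0 = p" and "framed (insert 4 (nat_mods ?d)) (real_mods ?d) ?s s'"
      and arr: "real_cells s' 8 = (\<lambda>p' q. if p' < p \<and> q = 0 then (if near p' ?k then 0 else weight s p') else real_cells ?s 8 p' q)"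
    then have fr': "framed {4} {8} ?s s'" by simp
    have "nat_cells s' 8 0 0 = ?k" using fr[OF fr'] by (simp add: framed_def)
    moreover have "real_cells s' 8 p 0 = weight s p" by (simp add: arr)
    ultimately show "ensures N ?d (\<lambda>s''. real_cells s'' 8 =
        upd_cell (real_cells s') 8 p 0 (if near p ?k then 0 else weight s p) 8) s'"
      using inp[OF fr'] p c
      by (intro ensures_Cond ensures_SetReal ensures_Skip) (auto simp: input_def upd_cell_def fun_eq_iff)
  qed (use inp N in \<open>auto simp: input_def\<close>)
  then have "ensures N clear_ball (select ?k s) ?s"
  proof (rule ensures_framed)
    fix s' :: memory
    assume w: "real_cells s' 8 = (\<lambda>p q. if p < n \<and> q = 0 then (if near p ?k then 0 else weight s p) else real_cells ?s 8 p q)"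
      and "framed (nat_mods clear_ball) (real_mods clear_ball) ?s s'"
    then have "nat_cells s' 3 = nat_cells ?s 3" by (simp add: framed_def clear_ball_def)
    then show "select ?k s s'" using w c by (auto simp: select_def selected_def upd_cell_same)
  qed
  then show ?thesis unfolding select_point_def
    by (intro ensures_Cond ensures_Seq ensures_SetNat ensures_Skip) (use s c in \<open>auto simp: input_def\<close>)
qed

text \<open>A drawn point has positive weight and so lies outside the balls of all selected points.
  It lies in its own ball, so each selection shrinks the support of the weights, and
  \<open>n\<close> rounds exhaust it.\<close>

lemma select_fractional:
  assumes fr: "fractional s" and sel: "select c s s'" and i: "input s'" and c: "c < n" "0 < weight s c"
  shows "fractional s'" "potential grp s' = potential grp s + gain grp s c"
    "card {p. p < n \<and> 0 < weight s' p} < card {p. p < n \<and> 0 < weight s p}"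
proof -
  have w: "weight s' p = (if near p c then 0 else weight s p)" if "p < n" for p
    using sel that by (simp add: select_def)
  have S: "selected s' = insert c (selected s)" using sel by (simp add: select_def)
  have w0: "0 \<le> weight s p" if "p < n" for p using fr that by (simp add: fractional_def)
  have Sn: "p < n" if "p \<in> selected s" for p using that by (simp add: selected_def)
  have far: "\<not> near c q" "\<not> near q c" if "q \<in> selected s" for q
    using fr c near_sym[OF c(1) Sn[OF that]] that unfolding fractional_def by fastforce+
  have cS: "c \<notin> selected s" using far near_refl[OF c(1)] by blast
  show "fractional s'" unfolding fractional_def S
  proof (intro conjI ballI allI impI)
    fix p assume p: "p < n"
    have "(\<Sum>q<n. if near p q then weight s' q else 0) \<le> (\<Sum>q<n. if near p q then weight s q else 0)"
      using w w0 by (intro sum_mono) auto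
    then show "(\<Sum>q<n. if near p q then weight s' q else 0) \<le> 1"
      using fr p unfolding fractional_def by force
    show "0 \<le> weight s' p" using w[OF p] w0[OF p] by simp
  next
    fix q p assume "q \<in> insert c (selected s)" "p < n" "near p q"
    then show "weight s' p = 0" using fr w unfolding fractional_def by auto
  next
    fix p q assume "p \<in> insert c (selected s)" "q \<in> insert c (selected s)" "p \<noteq> q"
    then show "\<not> near p q" using fr far unfolding fractional_def by auto
  qed (fact i)
  have "potential grp s' = (\<Sum>p<n. (if grp p then (if p \<in> selected s then 1 else 0) + weight s p else 0) +
     ((if p = c then if grp c then 1 else 0 else 0) - (if grp p \<and> near p c then weight s p else 0)))"
    unfolding potential_def S using w cS by (intro sum.cong) auto
  also have "\<dots> = potential grp s + gain grp s c"
    using c by (simp add: sum.distrib sum_subtractf potential_def gain_def)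
  finally show "potential grp s' = potential grp s + gain grp s c" .
  show "card {p. p < n \<and> 0 < weight s' p} < card {p. p < n \<and> 0 < weight s p}"
  proof (rule psubset_card_mono)
    have "c \<notin> {p. p < n \<and> 0 < weight s' p}" using w[OF c(1)] near_refl[OF c(1)] by simp
    moreover have "{p. p < n \<and> 0 < weight s' p} \<subseteq> {p. p < n \<and> 0 < weight s p}"
      using w by (auto split: if_splits)
    ultimately show "{p. p < n \<and> 0 < weight s' p} \<subset> {p. p < n \<and> 0 < weight s p}" using c by blast
  qed simp
qed

lemma fractional_framed:
  assumes "fractional s" "framed A B s s'" "{0, 1, 2, 3} \<inter> A = {}" "{0, 1, 8} \<inter> B = {}"
  shows "fractional s'" "potential grp s' = potential grp s" "weight s' = weight s" "selected s' = selected s"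
proof -
  have "input s'" by (rule input_framed[OF assms(2)]) (use assms in \<open>auto simp: fractional_def\<close>)
  moreover have eq: "nat_cells s' 3 = nat_cells s 3" "real_cells s' 8 = real_cells s 8"
    using assms unfolding framed_def by auto
  ultimately show "fractional s'" using assms(1) by (simp add: fractional_def selected_def cong: if_cong)
  show "potential grp s' = potential grp s" "weight s' = weight s" "selected s' = selected s"
    using eq by (simp_all add: potential_def selected_def cong: if_cong)
qed

lemma achieves_rounding_step:
  assumes s: "fractional s" and card: "card {p. p < n \<and> 0 < weight s p} \<le> Suc l"
  shows "achieves N rounding_step (\<lambda>s'. fractional s' \<and> card {p. p < n \<and> 0 < weight s' p} \<le> l)
    (potential grp) s (potential grp s)"
proof -
  let ?Q = "\<lambda>s'. fractional s' \<and> card {p. p < n \<and> 0 < weight s' p} \<le> l"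
  let ?g = "gain grp s" and ?C = "potential grp s"
  have inp: "input s" using s by (simp add: fractional_def)
  have "ensures N sum_weights (\<lambda>s1. real_cells s1 5 0 0 = (\<Sum>p<n. weight s p) \<and> framed {4} {5} s s1) s"
    by (rule ensures_framed[OF ensures_sum_weights[OF inp]]) (auto simp: sum_weights_def)
  then have "achieves N sum_weights (\<lambda>s1. real_cells s1 5 0 0 = (\<Sum>p<n. weight s p) \<and> framed {4} {5} s s1) (\<lambda>_. ?C) s ?C"
    by (rule reaches_const)
  then show ?thesis unfolding rounding_step_def
  proof (rule achieves_Seq)
    fix s1 assume s1: "real_cells s1 5 0 0 = (\<Sum>p<n. weight s p) \<and> framed {4} {5} s s1"
    have disj: "{0, 1, 2, 3} \<inter> {4} = ({} :: nat set)" "{0, 1, 2, 3} \<inter> {4, 8, 9} = ({} :: nat set)"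
      "{0, 1, 8} \<inter> {5} = ({} :: nat set)" by auto
    note f1 = fractional_framed[OF s conjunct2[OF s1] disj(1,3)]
    have i1: "input s1" using f1(1) by (simp add: fractional_def)
    have w1: "weight s1 p = weight s p" for p using fun_cong[OF f1(3)] .
    have g1: "gain grp s1 = ?g" by (simp add: gain_def fun_eq_iff w1 cong: if_cong)
    have "achieves N draw_point
      (\<lambda>s'. if nat_cells s' 8 0 0 < n then 0 < weight s1 (nat_cells s' 8 0 0) else \<forall>p<n. weight s1 p = 0)
      (\<lambda>s'. if nat_cells s' 8 0 0 < n then ?C + ?g (nat_cells s' 8 0 0) else ?C) s1
      (?C + (\<Sum>p<n. weight s1 p * ?g p) / (\<Sum>p<n. weight s1 p))"
      by (rule achieves_draw_point[OF i1]) (use f1(1) s1 in \<open>auto simp: fractional_def w1\<close>)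
    then have "achieves N draw_point
      (\<lambda>s2. (if nat_cells s2 8 0 0 < n then 0 < weight s (nat_cells s2 8 0 0) else \<forall>p<n. weight s p = 0) \<and>
         framed {4, 8, 9} {5} s1 s2)
      (\<lambda>s2. if nat_cells s2 8 0 0 < n then ?C + ?g (nat_cells s2 8 0 0) else ?C) s1 ?C"
    proof (rule reaches_conseq[OF reaches_framed])
      have "0 \<le> (\<Sum>p<n. weight s p * ?g p)" by (rule sum_gain_nonneg[OF s])
      moreover have "0 \<le> (\<Sum>p<n. weight s p)" using s by (auto simp: fractional_def intro: sum_nonneg)
      ultimately show "?C \<le> ?C + (\<Sum>p<n. weight s1 p * ?g p) / (\<Sum>p<n. weight s1 p)"
        by (simp add: w1)
    qed (auto simp: w1 draw_point_def draw_step_def insert_commute)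
    then show "achieves N (Seq draw_point select_point) ?Q (potential grp) s1 ?C"
    proof (rule achieves_Seq)
      fix s2 :: memory
      let ?k = "nat_cells s2 8 0 0"
      assume s2: "(if ?k < n then 0 < weight s ?k else \<forall>p<n. weight s p = 0) \<and> framed {4, 8, 9} {5} s1 s2"
      note f2 = fractional_framed[OF f1(1) conjunct2[OF s2] disj(2,3)]
      have i2: "input s2" using f2(1) by (simp add: fractional_def)
      have w2: "weight s2 p = weight s p" for p using fun_cong[OF f2(3), of p] w1 by simp
      have g2: "gain grp s2 = ?g" by (simp add: gain_def fun_eq_iff w2 cong: if_cong)
      have C2: "potential grp s2 = ?C" using f1(2) f2(2) by simp
      show "achieves N select_point ?Q (potential grp) s2 (if ?k < n then ?C + ?g ?k else ?C)"
      proof (cases "?k < n")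
        case True
        have "ensures N select_point (\<lambda>s3. ?Q s3 \<and> potential grp s3 = ?C + ?g ?k) s2"
        proof (rule ensures_framed[OF ensures_select_point[OF i2 True]])
          fix s3 assume sel: "select ?k s2 s3" and fr: "framed (nat_mods select_point) (real_mods select_point) s2 s3"
          have i3: "input s3" by (rule input_framed[OF fr]) (use i2 in \<open>auto simp: select_point_def clear_ball_def\<close>)
          have "0 < weight s2 ?k" using s2 True w2 by simp
          from select_fractional[OF f2(1) sel i3 True this]
          show "?Q s3 \<and> potential grp s3 = ?C + ?g ?k" using card by (simp add: w2 g2 C2)
        qed
        then show ?thesis using True by (auto elim: reaches_from_ensures)
      next
        \<comment> \<open>No point was drawn, hence no weight is left and the round selects
          nothing.\<close>
        case False
        then have "\<forall>p<n. weight s p = 0" using s2 by simp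
        then have empty: "{p. p < n \<and> 0 < weight s2 p} = {}" using w2 by auto
        have "?Q s2" using f2(1) unfolding empty by simp
        then show ?thesis unfolding select_point_def using False i2 C2
          by (intro achieves_Cond achieves_Skip) (auto simp: input_def)
      qed
    qed
  qed
qed

lemma feasible_imp:
  assumes feas: "feasible x"
  shows feasible_nonneg: "p < n \<Longrightarrow> 0 \<le> x p"
    and feasible_ball: "p < n \<Longrightarrow> (\<Sum>q<n. if near p q then x q else 0) \<le> 1"
    and feasible_demand: "g < m \<Longrightarrow> real (demand g) \<le> (\<Sum>p<n. if mem p g \<noteq> 0 then x p else 0)"
proof -
  show "0 \<le> x p" if p: "p < n"
  proof -
    have "(\<Sum>l<n. x l * tab l p) = (\<Sum>l<n. if l = p then - x p else 0)"
      using p by (intro sum.cong) (auto simp: tab_def)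
    moreover have "tab n p = 0" using p by (simp add: tab_def)
    moreover have "(\<Sum>l<n. x l * tab l p) + tab n p \<le> 0" using feas p by (simp add: feasible_def R_def)
    ultimately show ?thesis using p by simp
  qed
  show "(\<Sum>q<n. if near p q then x q else 0) \<le> 1" if p: "p < n"
  proof -
    have "(\<Sum>l<n. x l * tab l (n + p)) = (\<Sum>q<n. if near p q then x q else 0)"
      using p by (intro sum.cong) (auto simp: tab_def near_sym)
    moreover have "tab n (n + p) = -1" using p by (simp add: tab_def)
    moreover have "(\<Sum>l<n. x l * tab l (n + p)) + tab n (n + p) \<le> 0" using feas p unfolding feasible_def R_def by simp
    ultimately show ?thesis by simp
  qed
  show "real (demand g) \<le> (\<Sum>p<n. if mem p g \<noteq> 0 then x p else 0)" if g: "g < m"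
  proof -
    have "x l * tab l (n + n + g) = - (if mem l g \<noteq> 0 then x l else 0)" if "l < n" for l
      using that mem_le[of l g] by (cases "mem l g = 0") (auto simp: tab_def le_Suc_eq)
    then have "(\<Sum>l<n. x l * tab l (n + n + g)) = (\<Sum>p<n. - (if mem p g \<noteq> 0 then x p else 0))"
      by (intro sum.cong) auto
    moreover have "tab n (n + n + g) = demand g" by (simp add: tab_def)
    moreover have "(\<Sum>l<n. x l * tab l (n + n + g)) + tab n (n + n + g) \<le> 0"
      using feas g unfolding feasible_def R_def by simp
    ultimately show ?thesis by (simp add: sum_negf)
  qed
qed

text \<open>The potential starts as the weight of the group in the linear program and, once all
  weights are 0, counts the selected points of the group.\<close>

lemma achieves_round_solution:
  assumes s: "input s" and feas: "feasible (\<lambda>i. - real_cells s 2 n i)" and out: "\<And>p. p < n \<Longrightarrow> nat_cells s 3 p 0 = 0"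
    and v: "v \<le> (\<Sum>p<n. if grp p then - real_cells s 2 n p else 0)"
  shows "achieves N round_solution (\<lambda>s'. fractional s')
    (\<lambda>s'. \<Sum>p<n. if grp p \<and> p \<in> selected s' then 1 else 0) s v"
proof -
  let ?x = "\<lambda>i. - real_cells s 2 n i"
  note x0 = feasible_nonneg[OF feas] and ball = feasible_ball[OF feas]
  have inp: "input s'" if "framed {4} {8} s s'" for s'
    by (rule input_framed[OF that]) (use s in auto)
  have "ensures N set_weights (\<lambda>s'. real_cells s' 8 = (\<lambda>p q. if p < n \<and> q = 0 then ?x p else real_cells s 8 p q)) s"
    unfolding set_weights_def
  proof (rule ensures_fill_col, goal_cases)
    case (4 p s')
    then have fr: "framed {4} {8} s s'" by simp
    then have "real_cells s' 2 = real_cells s 2" by (simp add: framed_def)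
    then show ?case using 4 inp[OF fr] by (intro ensures_SetReal) (simp add: input_def)
  qed (use inp N in \<open>auto simp: input_def\<close>)
  then have "ensures N set_weights (\<lambda>s1. fractional s1 \<and> v \<le> potential grp s1) s"
  proof (rule ensures_framed)
    fix s1 :: memory
    assume w: "real_cells s1 8 = (\<lambda>p q. if p < n \<and> q = 0 then ?x p else real_cells s 8 p q)"
      and "framed (nat_mods set_weights) (real_mods set_weights) s s1"
    then have fr: "framed {4} {8} s s1" by (simp add: set_weights_def)
    have "nat_cells s1 3 = nat_cells s 3" using fr by (simp add: framed_def)
    then have S: "selected s1 = {}" using out by (auto simp: selected_def)
    have "fractional s1" unfolding fractional_def S using inp[OF fr] x0 ball by (auto simp: w cong: if_cong)
    moreover have "v \<le> potential grp s1" unfolding potential_def S using v by (simp add: w cong: if_cong)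
    ultimately show "fractional s1 \<and> v \<le> potential grp s1" ..
  qed
  then show ?thesis unfolding round_solution_def
  proof (rule achieves_Seq[OF reaches_from_ensures])
    fix s1 assume s1: "fractional s1 \<and> v \<le> potential grp s1"
    have mods: "insert 10 (nat_mods rounding_step) = {3, 4, 8, 9, 10}" "real_mods rounding_step = {5, 8}" "10 \<notin> nat_mods rounding_step"
      by (auto simp: rounding_step_def sum_weights_def draw_point_def draw_step_def select_point_def clear_ball_def)
    let ?I = "\<lambda>j s'. fractional s' \<and> card {p. p < n \<and> 0 < weight s' p} \<le> n - j"
    show "achieves N (For 10 num_points rounding_step) (\<lambda>s'. fractional s')
       (\<lambda>s'. \<Sum>p<n. if grp p \<and> p \<in> selected s' then 1 else 0) s1 (potential grp s1)"
    proof (rule achieves_For[where L = n and I = ?I and \<phi> = "\<lambda>_. potential grp"])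
      fix s' assume "framed (insert 10 (nat_mods rounding_step)) (real_mods rounding_step) s1 s'"
      then have "framed {3, 4, 8, 9, 10} {5, 8} s1 s'" by (simp only: mods)
      then have "input s'" by (rule input_framed) (use s1 in \<open>auto simp: fractional_def\<close>)
      then show "nval num_points s' = n" by (simp add: input_def)
    next
      fix j and s' :: memory assume "j < n" "?I j s'"
      then show "achieves N rounding_step (?I (Suc j)) (potential grp) s' (potential grp s')"
        by (intro achieves_rounding_step) auto
    next
      fix s' assume "?I n s'"
      then have "{p. p < n \<and> 0 < weight s' p} = {}" and fr: "fractional s'" by auto
      then have "weight s' p = 0" if "p < n" for p using that unfolding fractional_def by force
      then have "potential grp s' = (\<Sum>p<n. if grp p \<and> p \<in> selected s' then 1 else 0)"
        unfolding potential_def by (intro sum.cong) auto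
      then show "fractional s' \<and> potential grp s' \<le> (\<Sum>p<n. if grp p \<and> p \<in> selected s' then 1 else 0)"
        using fr by simp
    next
      have "card {p. p < n \<and> 0 < weight s1 p} \<le> card {..<n}" by (intro card_mono) auto
      then show "?I 0 s1" using s1 by simp
    next
      fix j x and s' :: memory
      have "nat_cells (put_nat 10 x s') a = nat_cells s' a" if "a < 4" for a using that by simp
      then have eq: "selected (put_nat 10 x s') = selected s'" "input (put_nat 10 x s') = input s'"
        by (simp_all add: selected_def input_def)
      show "?I j (put_nat 10 x s') = ?I j s'" "potential grp (put_nat 10 x s') = potential grp s'"
        by (simp_all only: fractional_def potential_def eq cells_set)
    qed (use mods(3) N in auto)
  qed auto
qed


text \<open>Nothing is known about the vertex that the solver finds, so \<open>v\<close> has to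
  bound the group weight of every feasible \<open>y\<close>; \<open>x\<close> witnesses that the
  solver has something to find.\<close>

lemma achieves_algorithm:
  assumes s: "input s" and feas: "feasible x" "\<And>i. i < n \<Longrightarrow> 0 \<le> x i \<and> x i \<le> 1"
    and out: "\<And>p. p < n \<Longrightarrow> nat_cells s 3 p 0 = 0"
    and v: "\<And>y. feasible y \<Longrightarrow> v \<le> (\<Sum>p<n. if grp p then y p else 0)"
  shows "achieves N (Seq solve_lp round_solution) (\<lambda>s'. fractional s')
    (\<lambda>s'. \<Sum>p<n. if grp p \<and> p \<in> selected s' then 1 else 0) s v"
proof -
  have mods: "nat_mods solve_lp \<subseteq> {4..9}" "real_mods solve_lp \<subseteq> {2..9}"
    by (auto simp: solve_lp_def build_tableau_def tableau_entry_def set_tolerance_def start_simplex_def start_slack_def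
      simplex_method_def shrink_simplex_def find_violated_def find_best_vertex_def sum_slack_def
      set_factors_def contract_def set_centroid_def purify_def find_pivot_def move_to_facet_def eliminate_def)
  have "ensures N solve_lp (\<lambda>s'. input s' \<and> feasible (\<lambda>i. - real_cells s' 2 n i) \<and> (\<forall>p<n. nat_cells s' 3 p 0 = 0)) s"
  proof (rule ensures_framed[OF ensures_solve_lp[OF s feas]])
    fix s' :: memory
    assume "feasible (\<lambda>i. - real_cells s' 2 n i)" and fr: "framed (nat_mods solve_lp) (real_mods solve_lp) s s'"
    moreover have "input s'" by (rule input_framed[OF fr]) (use s mods in auto)
    moreover have "nat_cells s' 3 = nat_cells s 3" using fr mods unfolding framed_def by auto
    ultimately show "input s' \<and> feasible (\<lambda>i. - real_cells s' 2 n i) \<and> (\<forall>p<n. nat_cells s' 3 p 0 = 0)"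
      using out by simp
  qed
  then show ?thesis
    by (rule achieves_Seq[OF reaches_const]) (intro achieves_round_solution v; auto)
qed

end

section \<open>The algorithm\<close>

lemma rounds_bound_mono: "n \<le> x \<Longrightarrow> rounds_bound n \<le> rounds_bound x"
  unfolding rounds_bound_def by (intro mult_le_mono add_le_mono power_mono) auto

text \<open>The last summand makes room for the loops over the tableau: at \<open>card X + m\<close>
  it is at least 2 n + m + 3.\<close>

definition loop_bound :: "nat poly" where
  "loop_bound = [:4:] * [:1, 1:]\<^sup>2 * ([:0, 1:] * [:2, 1:] * [:4, 1:] + 1) + [:3, 2:]"

lemma poly_loop_bound: "poly loop_bound x = rounds_bound x + (2 * x + 3)"
  by (simp add: loop_bound_def rounds_bound_def algebra_simps)

lemma (in fair_diversification) optimal_set_exists: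
  assumes "ereal \<gamma> \<le> optimal_diversity X d m G k"
  obtains S where "S \<subseteq> X" "\<And>i. i < m \<Longrightarrow> card (S \<inter> G i) = k i"
    "\<And>u v. u \<in> S \<Longrightarrow> v \<in> S \<Longrightarrow> u \<noteq> v \<Longrightarrow> \<gamma> \<le> d u v"
proof -
  have "optimal_diversity X d m G k \<in> diversity d ` fair_sets X m G k"
    unfolding optimal_diversity_def using finite_fair_sets fair_sets_nonempty by (intro Max_in) auto
  then obtain S where S: "S \<in> fair_sets X m G k" "ereal \<gamma> \<le> diversity d S"
    using assms by auto
  show ?thesis
  proof (rule that)
    show "card (S \<inter> G i) = k i" if "i < m" for i using S(1) that by (simp add: fair_sets_def)
    fix u v assume "u \<in> S" "v \<in> S" "u \<noteq> v"
    then have "diversity d S \<le> ereal (d u v)" unfolding diversity_def by (intro Inf_lower) auto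
    then show "\<gamma> \<le> d u v" using S(2) by (metis ereal_less_eq(3) order.trans)
  qed (use S(1) in \<open>auto simp: fair_sets_def\<close>)
qed

lemma card_index_set:
  assumes "distinct xs" shows "card {p. p < length xs \<and> xs ! p \<in> A} = card (set xs \<inter> A)"
proof -
  have "(!) xs ` {p. p < length xs \<and> xs ! p \<in> A} = set xs \<inter> A" by (auto simp: in_set_conv_nth)
  moreover have "inj_on ((!) xs) {p. p < length xs \<and> xs ! p \<in> A}"
    using assms by (auto simp: inj_on_def nth_eq_iff_index_eq)
  ultimately show ?thesis by (metis card_image)
qed

lemma algorithm_correct:
  fixes X :: "'a set"
  assumes fd: "fair_diversification X d m G k" and \<gamma>: "0 < \<gamma>" "ereal \<gamma> \<le> optimal_diversity X d m G k"
    and xs: "distinct xs" "set xs = X"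
  defines "s \<equiv> encode_instance xs d m G k \<gamma>" and "A \<equiv> Seq solve_lp round_solution"
    and "t \<equiv> cost (poly loop_bound (card X + m)) (Seq solve_lp round_solution)"
  shows "halts_within t A s"
    and "\<And>i. i < m \<Longrightarrow> real (k i) \<le> measure_pmf.expectation (output_distribution xs t A s) (\<lambda>S. real (card (S \<inter> G i)))"
    and "\<And>S. S \<in> set_pmf (output_distribution xs t A s) \<Longrightarrow>
      S \<subseteq> X \<and> (\<forall>u\<in>S. \<forall>v\<in>S. u \<noteq> v \<longrightarrow> \<gamma> / 2 \<le> d u v)"
proof -
  interpret fair_diversification X d m G k by (rule fd)
  define n where "n = length xs"
  define mem where "mem p q = (if p < n \<and> q < m \<and> xs ! p \<in> G q then 1 else 0 :: nat)" for p q
  define demand where "demand p = (if p < m then k p else 0)" for p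
  define near where "near p q \<longleftrightarrow> d (xs ! p) (xs ! q) < \<gamma> / 2" for p q
  define N where "N = poly loop_bound (card X + m)"
  have n: "card X = n" using xs distinct_card by (fastforce simp: n_def)
  have inX: "xs ! p \<in> X" if "p < n" for p using that xs(2) by (auto simp: n_def)
  have nth_eq: "xs ! p = xs ! q \<longleftrightarrow> p = q" if "p < n" "q < n" for p q
    using that xs(1) by (simp add: n_def nth_eq_iff_index_eq)
  interpret rounding_input N n m mem demand near
  proof
    show "2 * n + m + 3 \<le> N" by (simp add: N_def poly_loop_bound n)
    show "rounds_bound n \<le> N" using rounds_bound_mono[of n "n + m"] by (simp add: N_def poly_loop_bound n)
    show "near p p" if "p < n" for p using \<gamma> inX[OF that] by (simp add: near_def)
  qed (auto simp: mem_def near_def commute)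
  have inp: "input s"
    by (auto simp: input_def s_def encode_instance_def n_def[symmetric] mem_def demand_def near_def fun_eq_iff)
  have out: "nat_cells s 3 p 0 = 0" for p by (simp add: s_def encode_instance_def)
  obtain S where S: "S \<subseteq> X" "\<And>i. i < m \<Longrightarrow> card (S \<inter> G i) = k i"
    "\<And>u v. u \<in> S \<Longrightarrow> v \<in> S \<Longrightarrow> u \<noteq> v \<Longrightarrow> \<gamma> \<le> d u v"
    using optimal_set_exists[OF \<gamma>(2)] by blast
  \<comment> \<open>The indicator of a fair set with distances at least \<gamma> is never computed;
    it certifies that the linear program has a solution in the unit cube.\<close>
  define x where "x p = (if xs ! p \<in> S then 1 else 0 :: real)" for p
  have "(\<Sum>l<n. x l * tab l r) + tab n r \<le> 0" if r: "r < R" for r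
  proof -
    consider "r < n" | p where "p < n" "r = n + p" | g where "g < m" "r = n + n + g"
      using r unfolding R_def by (metis add.assoc le_add_diff_inverse nat_add_left_cancel_less not_le)
    then show ?thesis
    proof cases
      case 1
      then have "(\<Sum>l<n. x l * tab l r) = (\<Sum>l<n. if l = r then - x r else 0)"
        by (intro sum.cong) (auto simp: tab_def)
      then show ?thesis using 1 by (simp add: tab_def x_def)
    next
      case (2 p)
      \<comment> \<open>The triangle inequality yields a distance strictly below \<gamma> because
        the balls are open, so separation by exactly \<gamma> suffices.\<close>
      have "l = l'" if "l < n" "xs ! l \<in> S" "near l p" "l' < n" "xs ! l' \<in> S" "near l' p" for l l'
      proof (rule ccontr)
        assume "l \<noteq> l'"
        have "d (xs ! l) (xs ! l') \<le> d (xs ! l) (xs ! p) + d (xs ! p) (xs ! l')"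
          using that 2 inX by (intro triangle) auto
        also have "\<dots> < \<gamma>" using that(3,6) commute[of "xs ! p" "xs ! l'"] by (simp add: near_def)
        finally show False using S(3)[of "xs ! l" "xs ! l'"] that nth_eq \<open>l \<noteq> l'\<close> by auto
      qed
      then have "card {l. l < n \<and> xs ! l \<in> S \<and> near l p} \<le> 1"
        unfolding One_nat_def by (subst card_le_Suc0_iff_eq) auto
      moreover have "(\<Sum>l<n. x l * tab l r) = (\<Sum>l<n. if xs ! l \<in> S \<and> near l p then 1 else 0)"
        using 2 by (intro sum.cong) (auto simp: tab_def x_def)
      moreover have "\<dots> = real (card {l. l < n \<and> xs ! l \<in> S \<and> near l p})"
        by (subst sum.inter_filter[symmetric]) (auto intro!: arg_cong[where f = card])
      ultimately show ?thesis using 2 by (simp add: tab_def)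
    next
      case (3 g)
      have "(\<Sum>l<n. x l * tab l r) = (\<Sum>l<n. - (if xs ! l \<in> S \<inter> G g then 1 else 0))"
        using 3 by (intro sum.cong) (auto simp: tab_def x_def mem_def)
      also have "\<dots> = - real (card {l. l < length xs \<and> xs ! l \<in> S \<inter> G g})"
        unfolding sum_negf n_def by (subst sum.inter_filter[symmetric]) (auto intro!: arg_cong[where f = card])
      also have "\<dots> = - real (k g)"
        using card_index_set[OF xs(1), of "S \<inter> G g"] S(1) S(2)[OF 3(1)] xs(2) by (simp add: Int_absorb1 Int_assoc[symmetric])
      finally show ?thesis using 3 by (simp add: tab_def demand_def)
    qed
  qed
  then have feas: "feasible x" by (simp add: feasible_def)
  have x01: "0 \<le> x p \<and> x p \<le> 1" for p by (simp add: x_def)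
  have t: "t = cost N A" by (simp add: t_def A_def N_def)
  \<comment> \<open>Halting and separation concern no particular group; for the empty group the
    bound on the expectation is trivially 0.\<close>
  have "achieves N A fractional (\<lambda>s'. \<Sum>p<n. if False \<and> p \<in> selected s' then 1 else 0) s 0"
    unfolding A_def by (rule achieves_algorithm[OF inp feas x01 out]) simp
  then have supp: "c' = Skip \<and> fractional s'" if "(c', s') \<in> set_pmf (run t A s)" for c' s'
    using that unfolding t reaches_def by auto
  show "halts_within t A s" using supp by (auto simp: halts_within_def)
  have decode: "decode_set xs s' = (!) xs ` selected s'" for s'
    unfolding decode_set_def selected_def n_def[symmetric] by auto
  show "S \<subseteq> X \<and> (\<forall>u\<in>S. \<forall>v\<in>S. u \<noteq> v \<longrightarrow> \<gamma> / 2 \<le> d u v)"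
    if S': "S \<in> set_pmf (output_distribution xs t A s)" for S
  proof -
    obtain c' s' where s': "(c', s') \<in> set_pmf (run t A s)" "S = (!) xs ` selected s'"
      using S' by (auto simp: output_distribution_def decode)
    have "fractional s'" using supp[OF s'(1)] by simp
    then have "\<gamma> / 2 \<le> d (xs ! p) (xs ! q)" if "p \<in> selected s'" "q \<in> selected s'" "xs ! p \<noteq> xs ! q" for p q
      using that unfolding fractional_def near_def by (metis not_le)
    then show ?thesis unfolding s'(2) using inX by (auto simp: selected_def)
  qed
  fix i assume i: "i < m"
  have card: "(\<Sum>p<n. if mem p i \<noteq> 0 \<and> p \<in> selected s' then 1 else 0) = real (card (decode_set xs s' \<inter> G i))" for s'
  proof -
    have "decode_set xs s' \<inter> G i = set xs \<inter> (decode_set xs s' \<inter> G i)" by (auto simp: decode_set_def)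
    then have "card (decode_set xs s' \<inter> G i) = card {p. p < length xs \<and> xs ! p \<in> decode_set xs s' \<inter> G i}"
      using card_index_set[OF xs(1)] by metis
    also have "{p. p < length xs \<and> xs ! p \<in> decode_set xs s' \<inter> G i} = {p. p < n \<and> mem p i \<noteq> 0 \<and> p \<in> selected s'}"
      unfolding decode using nth_eq i by (auto simp: n_def[symmetric] selected_def mem_def)
    finally show ?thesis
      by (simp add: sum.inter_filter[symmetric] Collect_conj_eq lessThan_def)
  qed
  have "achieves N A fractional (\<lambda>s'. \<Sum>p<n. if mem p i \<noteq> 0 \<and> p \<in> selected s' then 1 else 0) s (demand i)"
    unfolding A_def by (rule achieves_algorithm[OF inp feas x01 out feasible_demand]) (use i in auto)
  then have "demand i \<le> measure_pmf.expectation (run t A s) (\<lambda>(c', s'). real (card (decode_set xs s' \<inter> G i)))"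
    unfolding t reaches_def card by simp
  then show "real (k i) \<le> measure_pmf.expectation (output_distribution xs t A s) (\<lambda>S. real (card (S \<inter> G i)))"
    using i by (simp add: output_distribution_def demand_def split_def)
qed

theorem lemma1:
  shows "\<exists>(A :: program) (T :: nat poly).
    \<forall>(X :: 'a set) d m G k \<gamma> xs.
      fair_diversification X d m G k \<longrightarrow>
      0 < \<gamma> \<longrightarrow> ereal \<gamma> \<le> optimal_diversity X d m G k \<longrightarrow>
      distinct xs \<longrightarrow> set xs = X \<longrightarrow>
      (let s = encode_instance xs d m G k \<gamma>;
           t = poly T (card X + m);
           D = output_distribution xs t A s
       in halts_within t A s \<and>
          (\<forall>i<m. measure_pmf.expectation D (\<lambda>S. real (card (S \<inter> G i))) \<ge> real (k i)) \<and>
          (\<forall>S \<in> set_pmf D. S \<subseteq> X \<and> (\<forall>u\<in>S. \<forall>v\<in>S. u \<noteq> v \<longrightarrow> d u v \<ge> \<gamma> / 2)))"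
proof -
  obtain T where T: "\<And>x. cost (poly loop_bound x) (Seq solve_lp round_solution) = poly T x"
    using cost_poly by blast
  show ?thesis
  proof (intro exI[of _ "Seq solve_lp round_solution"] exI[of _ T] allI impI)
    fix X :: "'a set" and d m G k \<gamma> xs
    assume *: "fair_diversification X d m G k" "0 < \<gamma>" "ereal \<gamma> \<le> optimal_diversity X d m G k"
      "distinct xs" "set xs = X"
    show "let s = encode_instance xs d m G k \<gamma>;
           t = poly T (card X + m);
           D = output_distribution xs t (Seq solve_lp round_solution) s
       in halts_within t (Seq solve_lp round_solution) s \<and>
          (\<forall>i<m. measure_pmf.expectation D (\<lambda>S. real (card (S \<inter> G i))) \<ge> real (k i)) \<and>
          (\<forall>S \<in> set_pmf D. S \<subseteq> X \<and> (\<forall>u\<in>S. \<forall>v\<in>S. u \<noteq> v \<longrightarrow> d u v \<ge> \<gamma> / 2))"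
      unfolding Let_def T[symmetric]
    proof (intro conjI allI impI ballI)
    qed (use algorithm_correct[OF *] in blast)+
  qed
qed

end
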